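(* With the parameters and kernels of the context, fix $\mathbf t>0$ and $\mathbf x\in\mathbb R$. For every $M>0$, $$\bar{\mathbf S}^\varepsilon_{-\mathbf t,-\mathbf x}(\zeta,u)\longrightarrow\mathbf S_{-\mathbf t,-\mathbf x}(\zeta,u)\qquad\text{as }\varepsilon\to0,$$ uniformly over $|\zeta-u|\le M$.
   Context: Parameters. Fix $p\in(0,1)$, $q=1-p$, $\rho\in(0,1)$, and integers $a,b\ge0$ with $a+b\ge1$. For $\ell\ge1$ let $\kappa_\ell=0$ if $(\ell-1)\bmod(a+b)\in\{0,\dots,a-1\}$ and $\kappa_\ell=1$ if $(\ell-1)\bmod(a+b)\in\{a,\dots,a+b-1\}$ (sequential and parallel particles respectively, i.e. memory lengths $L_\ell=\kappa_\ell+1\in\{1,2\}$), and let $\kappa(n)=\sum_{\ell=1}^n\kappa_\ell$. Set $\lambda=\frac b{a+b}$, $$\theta=\frac{p-q-p(1+\lambda)\rho+\sqrt{(p^2(1-\lambda)^2+4p\lambda)\rho^2-2p(1+\lambda)\rho+1}}{2q(1-\lambda\rho)}\in(0,p/q),\qquad\hat\theta=\frac qp\theta,$$ $$\alpha=\frac{(p-q\theta)^2}{pq(1+\theta)^2+\lambda(p-q\theta)^2},\qquad\beta=\frac{p(q(1+\theta)^2-1)}{pq(1+\theta)^2+\lambda(p-q\theta)^2},$$ $$\gamma=\Big(\frac{pq\theta}{2(p-q\theta)^2}+\frac{\theta\lambda}{2(1+\theta)^2}\Big)^{1/2},\qquad\sigma=\Big(\frac{2pq\theta(1+\theta)(p-q\theta)}{\gamma(pq(1+\theta)^2+\lambda(p-q\theta)^2)^2}\Big)^{1/3}.$$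 Unscaled kernel. For integers $t\ge0$, $n\ge1$ and $y,x\in\mathbb Z$, $$\bar{\mathcal S}_{(0,n]}(y,x)=-\Big(\frac{1-\hat\theta}{\hat\theta}\Big)^{n}\frac1{2\pi\mathrm i}\oint_{\gamma_1}dw\,\frac{w^{x-y+n-1}}{\hat\theta^{x-y}(1-w)^n}\,(1+pw/q)^{-t}\Big(\frac{q+pw}{q+p\hat\theta}\Big)^{\kappa(n)},$$ where $\gamma_1$ is a simple positively oriented closed contour enclosing, among the singularities of the integrand, only the one at $1$ (so neither $0$ nor $-q/p$). Scaling. Given $\mathbf t,\mathbf x,\zeta,u$ and $\varepsilon>0$, let $t=\varepsilon^{-3/2}\mathbf t$, $n=\alpha\varepsilon^{-3/2}\mathbf t-\sigma^2\varepsilon^{-1}\mathbf x$, $x=\beta\varepsilon^{-3/2}\mathbf t+\rho^{-1}\sigma^2\varepsilon^{-1}\mathbf x+\gamma\sigma\varepsilon^{-1/2}u$, $y=\gamma\sigma\varepsilon^{-1/2}\zeta$ (each replaced by its integer part), and $$\bar{\mathbf S}^\varepsilon_{-\mathbf t,-\mathbf x}(\zeta,u)=\gamma\sigma\varepsilon^{-1/2}(1+\theta)^{t}\,\bar{\mathcal S}_{(0,n]}(y,x).$$ Limit kernel. For $\mathbf t>0$ and $\mathbf x\in\mathbb R$, $\mathbf S_{\mathbf t,\mathbf x}(u,v)=\mathbf t^{-1/3}e^{\frac{2\mathbf x^3}{3\mathbf t^2}-\frac{(u-v)\mathbf x}{\mathbf t}}\mathrm{Ai}\big(\mathbf t^{-1/3}(v-u)+\mathbf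 t^{-4/3}\mathbf x^2\big)$, with $\mathrm{Ai}$ the Airy function, and $\mathbf S_{-\mathbf t,\mathbf x}(\zeta,u)=\mathbf S_{\mathbf t,\mathbf x}(u,\zeta)$ for all $\mathbf x\in\mathbb R$. *)

theory Defs
  imports "HOL-Complex_Analysis.Complex_Analysis"
begin

text \<open>
  The parameters are \<open>p \<in> (0,1)\<close>, \<open>\<rho> \<in> (0,1)\<close> and naturals \<open>a\<close>, \<open>b\<close> with
  \<open>a + b \<ge> 1\<close>; throughout \<open>q = 1 - p\<close>.
\<close>

subsection \<open>Memory pattern and constants\<close>

text \<open>
  \<open>kap a b l\<close> is used for \<open>l \<ge> 1\<close> only: \<open>0\<close> for a sequential particle, \<open>1\<close> for a
  parallel one.
\<close>

definition kap :: "nat \<Rightarrow> nat \<Rightarrow> nat \<Rightarrow> nat" where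
  "kap a b l = (if (l - 1) mod (a + b) \<in> {0..<a} then 0 else 1)"

definition kap_sum :: "nat \<Rightarrow> nat \<Rightarrow> nat \<Rightarrow> nat" where
  "kap_sum a b n = (\<Sum>l=1..n. kap a b l)"

definition lam :: "nat \<Rightarrow> nat \<Rightarrow> real" where
  "lam a b = real b / (real a + real b)"

definition theta :: "real \<Rightarrow> real \<Rightarrow> nat \<Rightarrow> nat \<Rightarrow> real" where
  "theta p \<rho> a b = (let q = 1 - p; l = lam a b in
     (p - q - p * (1 + l) * \<rho>
       + sqrt ((p^2 * (1 - l)^2 + 4 * p * l) * \<rho>^2 - 2 * p * (1 + l) * \<rho> + 1))
     / (2 * q * (1 - l * \<rho>)))"

definition theta_hat :: "real \<Rightarrow> real \<Rightarrow> nat \<Rightarrow> nat \<Rightarrow> real" where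
  "theta_hat p \<rho> a b = (1 - p) / p * theta p \<rho> a b"

definition alpha :: "real \<Rightarrow> real \<Rightarrow> nat \<Rightarrow> nat \<Rightarrow> real" where
  "alpha p \<rho> a b = (let q = 1 - p; l = lam a b; \<theta> = theta p \<rho> a b in
     (p - q * \<theta>)^2 / (p * q * (1 + \<theta>)^2 + l * (p - q * \<theta>)^2))"

definition beta :: "real \<Rightarrow> real \<Rightarrow> nat \<Rightarrow> nat \<Rightarrow> real" where
  "beta p \<rho> a b = (let q = 1 - p; l = lam a b; \<theta> = theta p \<rho> a b in
     p * (q * (1 + \<theta>)^2 - 1) / (p * q * (1 + \<theta>)^2 + l * (p - q * \<theta>)^2))"

definition gam :: "real \<Rightarrow> real \<Rightarrow> nat \<Rightarrow> nat \<Rightarrow> real" where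
  "gam p \<rho> a b = (let q = 1 - p; l = lam a b; \<theta> = theta p \<rho> a b in
     sqrt (p * q * \<theta> / (2 * (p - q * \<theta>)^2) + \<theta> * l / (2 * (1 + \<theta>)^2)))"

definition sig :: "real \<Rightarrow> real \<Rightarrow> nat \<Rightarrow> nat \<Rightarrow> real" where
  "sig p \<rho> a b = (let q = 1 - p; l = lam a b; \<theta> = theta p \<rho> a b; \<gamma> = gam p \<rho> a b in
     root 3 (2 * p * q * \<theta> * (1 + \<theta>) * (p - q * \<theta>)
       / (\<gamma> * (p * q * (1 + \<theta>)^2 + l * (p - q * \<theta>)^2)^2)))"


subsection \<open>The unscaled kernel\<close>

text \<open>
  The contours \<open>\<gamma>\<^sub>1\<close>: \<open>0\<close>, \<open>1\<close> and \<open>- q/p\<close> are the only possible singularities of the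
  integrand of \<open>S_bar\<close>. For a simple closed path the winding number about an enclosed point
  is \<open>1\<close> or \<open>-1\<close>, and the value \<open>1\<close> is positive orientation.
\<close>

definition contour_around_1 :: "real \<Rightarrow> (real \<Rightarrow> complex) \<Rightarrow> bool" where
  "contour_around_1 p \<Gamma> \<longleftrightarrow>
     valid_path \<Gamma> \<and> simple_path \<Gamma> \<and> pathfinish \<Gamma> = pathstart \<Gamma> \<and>
     1 \<in> inside (path_image \<Gamma>) \<and> winding_number \<Gamma> 1 = 1 \<and>
     0 \<in> outside (path_image \<Gamma>) \<and>
     - complex_of_real ((1 - p) / p) \<in> outside (path_image \<Gamma>)"

text \<open>
  \<open>S_bar p \<rho> a b \<Gamma> t n y x\<close> is the kernel with index \<open>(0,n]\<close> at \<open>(y,x)\<close> and time \<open>t\<close>,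
  with the integral taken over \<open>\<Gamma>\<close>. Exponents involving \<open>x - y\<close> may be negative.
\<close>

definition S_bar ::
  "real \<Rightarrow> real \<Rightarrow> nat \<Rightarrow> nat \<Rightarrow> (real \<Rightarrow> complex) \<Rightarrow> nat \<Rightarrow> nat \<Rightarrow> int \<Rightarrow> int \<Rightarrow> complex" where
  "S_bar p \<rho> a b \<Gamma> t n y x =
    (let P = complex_of_real p; Q = complex_of_real (1 - p);
         \<Theta> = complex_of_real (theta_hat p \<rho> a b) in
     - (((1 - \<Theta>) / \<Theta>) ^ n) * (1 / (2 * of_real pi * \<i>)) *
       contour_integral \<Gamma> (\<lambda>w.
         w powi (x - y + int n - 1) / (\<Theta> powi (x - y) * (1 - w) ^ n)
         * (1 + P * w / Q) powi (- int t)
         * ((Q + P * w) / (Q + P * \<Theta>)) ^ kap_sum a b n))"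


subsection \<open>The scaled kernel\<close>

text \<open>
  Integer parts are floors; \<open>nat\<close> is harmless, since the floors in \<open>t_sc\<close> and \<open>n_sc\<close> are
  positive once \<open>\<epsilon>\<close> is small.
\<close>

definition t_sc :: "real \<Rightarrow> real \<Rightarrow> nat" where
  "t_sc \<epsilon> T = nat \<lfloor>\<epsilon> powr (-3/2) * T\<rfloor>"

definition n_sc :: "real \<Rightarrow> real \<Rightarrow> nat \<Rightarrow> nat \<Rightarrow> real \<Rightarrow> real \<Rightarrow> real \<Rightarrow> nat" where
  "n_sc p \<rho> a b \<epsilon> T X =
     nat \<lfloor>alpha p \<rho> a b * \<epsilon> powr (-3/2) * T - (sig p \<rho> a b)^2 * \<epsilon> powr (-1) * X\<rfloor>"

definition x_sc ::
  "real \<Rightarrow> real \<Rightarrow> nat \<Rightarrow> nat \<Rightarrow> real \<Rightarrow> real \<Rightarrow> real \<Rightarrow> real \<Rightarrow> int" where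
  "x_sc p \<rho> a b \<epsilon> T X u =
     \<lfloor>beta p \<rho> a b * \<epsilon> powr (-3/2) * T + (1 / \<rho>) * (sig p \<rho> a b)^2 * \<epsilon> powr (-1) * X
       + gam p \<rho> a b * sig p \<rho> a b * \<epsilon> powr (-1/2) * u\<rfloor>"

definition y_sc :: "real \<Rightarrow> real \<Rightarrow> nat \<Rightarrow> nat \<Rightarrow> real \<Rightarrow> real \<Rightarrow> int" where
  "y_sc p \<rho> a b \<epsilon> \<zeta> = \<lfloor>gam p \<rho> a b * sig p \<rho> a b * \<epsilon> powr (-1/2) * \<zeta>\<rfloor>"

text \<open>
  \<open>S_bar_eps p \<rho> a b \<Gamma> \<epsilon> T X\<close> is the kernel with subscripts \<open>-T, -X\<close>: its arguments
  \<open>T\<close> and \<open>X\<close> are those entering the scaling, before the sign change.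
\<close>

definition S_bar_eps ::
  "real \<Rightarrow> real \<Rightarrow> nat \<Rightarrow> nat \<Rightarrow> (real \<Rightarrow> complex) \<Rightarrow> real \<Rightarrow> real \<Rightarrow> real \<Rightarrow> real \<Rightarrow> real \<Rightarrow> complex"
  where
  "S_bar_eps p \<rho> a b \<Gamma> \<epsilon> T X \<zeta> u =
     complex_of_real (gam p \<rho> a b * sig p \<rho> a b * \<epsilon> powr (-1/2)
       * (1 + theta p \<rho> a b) ^ t_sc \<epsilon> T)
     * S_bar p \<rho> a b \<Gamma> (t_sc \<epsilon> T) (n_sc p \<rho> a b \<epsilon> T X)
         (y_sc p \<rho> a b \<epsilon> \<zeta>) (x_sc p \<rho> a b \<epsilon> T X u)"


subsection \<open>The limit kernel\<close>

text \<open>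
  The Airy function as \<open>1 / (2\<pi>i) \<integral> exp (w\<^sup>3/3 - z w) dw\<close> along the two rays running from
  \<open>e\<^bsup>-i\<pi>/3\<^esup>\<infinity>\<close> through \<open>0\<close> to \<open>e\<^bsup>i\<pi>/3\<^esup>\<infinity>\<close>, each parametrised by its distance \<open>s\<close> from \<open>0\<close>.
  On both rays \<open>w\<^sup>3 = -s\<^sup>3\<close>, so the integrals converge absolutely.
\<close>

definition Airy :: "complex \<Rightarrow> complex" where
  "Airy z = 1 / (2 * of_real pi * \<i>) *
     ((LBINT s:{0..}. cis (pi/3) * exp ((of_real s * cis (pi/3))^3 / 3 - z * (of_real s * cis (pi/3))))
      - (LBINT s:{0..}. cis (-pi/3) * exp ((of_real s * cis (-pi/3))^3 / 3 - z * (of_real s * cis (-pi/3)))))"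

definition S_pos :: "real \<Rightarrow> real \<Rightarrow> real \<Rightarrow> real \<Rightarrow> complex" where
  "S_pos T X u v =
     complex_of_real (T powr (-1/3) * exp (2 * X^3 / (3 * T^2) - (u - v) * X / T))
     * Airy (of_real (T powr (-1/3) * (v - u) + T powr (-4/3) * X^2))"

text \<open>
  \<open>S_lim T X\<close> is the limit kernel for either sign of the time \<open>T\<close>; negative time
  transposes the arguments and leaves \<open>X\<close> alone.
\<close>

definition S_lim :: "real \<Rightarrow> real \<Rightarrow> real \<Rightarrow> real \<Rightarrow> complex" where
  "S_lim T X u v = (if T > 0 then S_pos T X u v else S_pos (- T) X v u)"

end

theory Submission
  imports Defs "HOL-Real_Asymp.Real_Asymp"
begin

text \<open>
  The kernel is treated by steepest descent at a double critical point.

  Put \<open>\<Theta> = theta_hat p \<rho> a b\<close>, \<open>Q = (1 - p)/p\<close>, \<open>A = x - y + n\<close> and \<open>B = t - kap_sum a b n\<close>. Up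
  to its sign, the rescaled kernel \<open>(1 + \<theta>)\<^sup>t S_bar\<close> is the integral of
  \<open>(w/\<Theta>)\<^sup>A ((1 - w)/(1 - \<Theta>))\<^sup>-\<^sup>n ((Q + w)/(Q + \<Theta>))\<^sup>-\<^sup>B dw/w\<close> divided by \<open>2\<pi>i\<close>, so its integrand is
  normalised at \<open>w = \<Theta>\<close>. The logarithm of the integrand consists of a part of order \<open>\<epsilon>\<^sup>-\<^sup>3\<^sup>/\<^sup>2\<close>,
  which by the choice of \<open>\<alpha>\<close> and \<open>\<beta>\<close> vanishes to third order at \<open>\<Theta>\<close>; a part of order \<open>\<epsilon>\<^sup>-\<^sup>1\<close>, which
  by the equation defining \<open>\<theta>\<close> vanishes to second order; a part of order \<open>\<epsilon>\<^sup>-\<^sup>1\<^sup>/\<^sup>2\<close>, proportional to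
  \<open>u - \<zeta>\<close>, which vanishes to first order; and a bounded remainder from the integer parts and from
  \<open>kap_sum\<close>. On the scale \<open>\<epsilon>\<^sup>1\<^sup>/\<^sup>2\<close> around \<open>\<Theta>\<close> these parts turn into \<open>T v\<^sup>3/3\<close>, \<open>- X v\<^sup>2\<close>,
  \<open>(u - \<zeta>) v\<close> and \<open>0\<close>; the constants \<open>\<gamma>\<close> and \<open>\<sigma>\<close> are chosen for that (\<open>phase_identities\<close>,
  \<open>scaling_constants\<close>). The resulting integral is an Airy function, once the cube is completed and
  the contour is rotated (\<open>wedge_integral_eq_S_lim\<close>).

  What makes this rigorous is a contour along which the part of order \<open>\<epsilon>\<^sup>-\<^sup>3\<^sup>/\<^sup>2\<close> descends all the way.
  The circle around \<open>1\<close> through \<open>\<Theta>\<close> is a contour of descent, but it leaves \<open>\<Theta>\<close> vertically, where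
  the cubic term is purely oscillating and cannot dominate the other parts. The contour used here is
  therefore a lens slightly inside that circle, bounded by two circular arcs which leave \<open>\<Theta>\<close> at an
  angle a little below \<open>\<pi>/2\<close> (\<open>contour_integral_lens\<close>). The Moebius map that sends \<open>\<Theta>\<close> to \<open>0\<close>, and the
  point opposite to it on the circle to \<open>\<infinity>\<close>, turns the arcs into straight rays, and along a ray the
  derivative of the phase has an explicit real part, which is negative everywhere
  (\<open>Re_cube_over_denom4\<close>). Hence the real part of the phase is at most \<open>- const \<tau>\<^sup>3\<close> along the whole
  arc, and a single comparison with an integrable function gives an error of order \<open>\<epsilon>\<^sup>1\<^sup>/\<^sup>2\<close>
  (\<open>steep_ray_limit\<close>). The bound depends on \<open>\<zeta>\<close> and \<open>u\<close> only through \<open>|u - \<zeta>| \<le> M\<close>, which is the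
  claimed uniformity.
\<close>

section \<open>Parameters and algebra of the phase\<close>

text \<open>
  Clearing denominators in \<open>1/\<rho> = p/s + l \<theta>/(1 + \<theta>)\<close>, where \<open>s = p - q \<theta>\<close>, gives
  \<open>q (1 - l \<rho>) \<theta>\<^sup>2 - m \<theta> - p (1 - \<rho>) = 0\<close> with \<open>m = p - q - p (1 + l) \<rho>\<close>. The leading
  coefficient is positive and the constant one negative, so exactly one root is positive, and
  the formula for \<open>\<theta>\<close> is that root. The equation is what cancels the linear term of the phase
  at the order \<open>\<epsilon>\<^sup>-\<^sup>1\<close>; \<open>s > 0\<close> says that the saddle \<open>q \<theta> / p\<close> lies left of the pole at \<open>1\<close>.
\<close>

lemma theta_quadratic:
  fixes p \<rho> l :: real
  assumes "0 < p" "p < 1" "0 < \<rho>" "\<rho> < 1" "0 \<le> l" "l \<le> 1"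
  defines "q \<equiv> 1 - p"
  defines "th \<equiv> (p - q - p * (1 + l) * \<rho>
       + sqrt ((p^2 * (1 - l)^2 + 4 * p * l) * \<rho>^2 - 2 * p * (1 + l) * \<rho> + 1))
     / (2 * q * (1 - l * \<rho>))"
  shows "th > 0" "(p - q * th) * (1 + th) = \<rho> * (p * (1 + th) + l * th * (p - q * th))"
    "p - q * th > 0"
proof -
  define d where "d = 1 - l * \<rho>"
  define m where "m = p - q - p * (1 + l) * \<rho>"
  define r where "r = sqrt (m\<^sup>2 + 4 * (q * d) * (p * (1 - \<rho>)))"
  have "l * \<rho> \<le> 1 * \<rho>" using assms(3,6) by (intro mult_right_mono) auto
  then have "l * \<rho> < 1" using assms(4) by simp
  then have d: "d > 0" unfolding d_def by simp
  have q: "q > 0" using assms by simp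
  have rad: "(p^2 * (1 - l)^2 + 4 * p * l) * \<rho>^2 - 2 * p * (1 + l) * \<rho> + 1
      = m\<^sup>2 + 4 * (q * d) * (p * (1 - \<rho>))"
    unfolding m_def d_def q_def by algebra
  have th: "th = (m + r) / (2 * (q * d))"
    unfolding th_def rad r_def m_def d_def by simp
  have pos: "4 * (q * d) * (p * (1 - \<rho>)) > 0" using q d assms by simp
  have r2: "r\<^sup>2 = m\<^sup>2 + 4 * (q * d) * (p * (1 - \<rho>))"
    unfolding r_def using pos by (intro real_sqrt_pow2) (simp add: add_nonneg_nonneg)
  have "\<bar>m\<bar> < r"
    unfolding r_def using pos by (intro real_less_rsqrt) simp
  then have mr: "m + r > 0" by linarith
  then show thp: "th > 0" unfolding th using q d by simp
  have "2 * (q * d) * th - m = r" unfolding th using q d by simp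
  then have "(2 * (q * d) * th - m)\<^sup>2 = m\<^sup>2 + 4 * (q * d) * (p * (1 - \<rho>))" using r2 by simp
  then have "4 * (q * d) * ((q * d) * th\<^sup>2 - m * th - p * (1 - \<rho>)) = 0" by algebra
  then have quad: "(q * d) * th\<^sup>2 - m * th - p * (1 - \<rho>) = 0" using q d by simp
  then show eq: "(p - q * th) * (1 + th) = \<rho> * (p * (1 + th) + l * th * (p - q * th))"
    unfolding m_def d_def q_def by algebra
  have "(p - q * th) * (1 + (1 - l * \<rho>) * th) = \<rho> * (p * (1 + th))"
    using eq by algebra
  moreover have "1 + (1 - l * \<rho>) * th > 0" using d thp unfolding d_def by (simp add: add_pos_pos)
  moreover have "\<rho> * (p * (1 + th)) > 0" using assms thp by simp
  ultimately show "p - q * th > 0" using zero_less_mult_pos2 by metis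
qed

lemma kap_sum_closed:
  assumes "a + b \<ge> 1"
  shows "kap_sum a b n = b * (n div (a + b)) + (n mod (a + b) - a)"
proof (induction n)
  case 0
  show ?case by (simp add: kap_sum_def)
next
  case (Suc n)
  have "kap_sum a b (Suc n) = kap_sum a b n + (if n mod (a + b) < a then 0 else 1)"
    by (simp add: kap_sum_def kap_def)
  moreover have "n mod (a + b) < a + b" using assms by (intro mod_less_divisor) linarith
  ultimately show ?case
    using Suc.IH by (auto simp: mod_Suc div_Suc)
qed

text \<open>
  Over a full period the pattern contributes \<open>b\<close>, which is exactly the mean slope, so only the
  last incomplete period causes an error. It is bounded independently of \<open>n\<close> and therefore
  disappears after scaling.
\<close>

lemma kap_sum_approx:
  assumes "a + b \<ge> 1"
  shows "\<bar>real (kap_sum a b n) - lam a b * real n\<bar> \<le> real (a + b)"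
proof -
  define m where "m = a + b"
  define r where "r = n mod m"
  have m: "m > 0" and r: "r < m"
    using assms unfolding m_def r_def by (linarith, intro mod_less_divisor, linarith)
  have n: "real n = real m * real (n div m) + real r"
    unfolding r_def by (metis div_mult_mod_eq mult.commute of_nat_add of_nat_mult)
  have "lam a b * real n = real b * real (n div m) + lam a b * real r"
  proof -
    have "lam a b * real m = real b" unfolding lam_def using m by (simp add: m_def)
    then show ?thesis unfolding n by (simp add: distrib_left mult.assoc[symmetric])
  qed
  then have "real (kap_sum a b n) - lam a b * real n = real (r - a) - lam a b * real r"
    unfolding kap_sum_closed[OF assms] m_def[symmetric] r_def by simp
  moreover have "0 \<le> lam a b * real r" "lam a b * real r \<le> real m"
  proof -
    have l: "0 \<le> lam a b" "lam a b \<le> 1" using m by (auto simp: lam_def m_def field_simps)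
    then show "0 \<le> lam a b * real r" by simp
    have "lam a b * real r \<le> 1 * real r" using l by (intro mult_right_mono) auto
    with r show "lam a b * real r \<le> real m" by linarith
  qed
  moreover have "real (r - a) \<le> real m" using r by linarith
  ultimately show ?thesis unfolding m_def by linarith
qed

text \<open>
  The phase \<open>A\<^sub>0 l\<^sub>1 - n\<^sub>0 l\<^sub>2 - B\<^sub>0 l\<^sub>3\<close> of order \<open>\<epsilon>\<^sup>-\<^sup>3\<^sup>/\<^sup>2\<close> has, up to a nonvanishing denominator, a
  derivative whose numerator is a quadratic form in \<open>1 - \<tau>\<close> and \<open>\<tau> e\<close> (see
  \<open>ell_combo_deriv\<close>). The first three identities evaluate its coefficients: two vanish, which is
  the double critical point, and the third is the constant that \<open>\<sigma>\<close> normalises. The last two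
  do the same for the phase of order \<open>\<epsilon>\<^sup>-\<^sup>1\<close>, which only has a simple critical point.

  With \<open>X\<^sub>1 = x\<^sub>1 - 1\<close> and \<open>X\<^sub>3 = x\<^sub>3 - 1\<close> every identity reduces to one of the form
  \<open>c\<^sub>0 + c\<^sub>1 X\<^sub>1 + c\<^sub>3 X\<^sub>3 + c X\<^sub>1 X\<^sub>3 = 0\<close>; since \<open>X\<^sub>1 q \<theta> = X\<^sub>3 q (1 + \<theta>) = 2 s\<close>, multiplying by
  \<open>q \<theta> q (1 + \<theta>)\<close> turns it into a polynomial identity.
\<close>

lemma phase_identities:
  fixes p q th l r :: real
  assumes q: "q = 1 - p" "q > 0" and p: "p > 0" and th: "th > 0" and s: "s = p - q * th" "s > 0"
    and D: "D = p * q * (1 + th)^2 + l * s^2" "D > 0"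
    and x1: "x1 = (2 * p - q * th) / (q * th)" and x3: "x3 = (1 + p - q * th) / (q * (1 + th))"
    and A0: "A0 = q * th^2 / D" and n0: "n0 = s^2 / D" and B0: "B0 = p * q * (1 + th)^2 / D"
  shows "A0 * (x1 - 1) + 2 * n0 - B0 * (x3 - 1) = 0"
    "A0 * (x1 - 1) * (x3 - 1) + 2 * n0 * (x1 + x3) - B0 * (x3 - 1) * (x1 - 1) = 0"
    "- A0 * (x1 - 1) * x3 + 2 * n0 * x1 * x3 + B0 * (x3 - 1) * x1
       = p * q * th^2 / (D * s * (1 + th)) * (x1 - 1)^3" 
    "r = p / s + l * th / (1 + th) \<Longrightarrow> (r - 1) * (x1 - 1) - 2 - l * (x3 - 1) = 0"
    "r = p / s + l * th / (1 + th) \<Longrightarrow> 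
      (r - 1) * (x1 - 1) * (x3 - 1) - 2 * (x1 + x3) - l * (x3 - 1) * (x1 - 1) = 
      - (th * D / (s^2 * (1 + th)^2)) * (x1 - 1)^2"
proof -
  have z: "1 + th > 0" using th by simp
  have nz: "q \<noteq> 0" "th \<noteq> 0" "1 + th \<noteq> 0" "D \<noteq> 0" "s \<noteq> 0" using q th D z s by auto
  define X1 X3 where X: "X1 = x1 - 1" "X3 = x3 - 1"
  have h1: "X1 * (q * th) = 2 * s" 
  proof -
    have "x1 * (q * th) = 2 * p - q * th" unfolding x1 using nz by simp
    then show ?thesis unfolding X s by algebra
  qed
  have h3: "X3 * (q * (1 + th)) = 2 * s"
  proof -
    have "x3 * (q * (1 + th)) = 1 + p - q * th" unfolding x3 using nz by simp
    then show ?thesis unfolding X s q by algebra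
  qed
  have xs: "x1 = 1 + X1" "x3 = 1 + X3" unfolding X by auto
  have a: "A0 * X1 = 2 * s / D * th"
  proof -
    have "A0 * X1 = th * (X1 * (q * th)) / D" unfolding A0 by (simp add: power2_eq_square)
    then show ?thesis unfolding h1 by simp
  qed
  have b: "B0 * X3 = 2 * s / D * (p * (1 + th))"
  proof -
    have "B0 * X3 = p * (1 + th) * (X3 * (q * (1 + th))) / D"
      unfolding B0 by (simp add: power2_eq_square)
    then show ?thesis unfolding h3 by simp
  qed
  have n: "n0 = s / D * s" unfolding n0 by (simp add: power2_eq_square)
  define k where "k = s / D"
  have abn: "A0 * X1 = 2 * k * th" "B0 * X3 = 2 * k * (p * (1 + th))" "n0 = k * s"
    using a b n unfolding k_def by auto
  have c1: "th + s - p * (1 + th) = 0" unfolding s q by algebra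
  have nz2: "q * th * (q * (1 + th)) \<noteq> 0" using nz by simp
  \<comment> \<open>Reduces a relation that is affine in \<open>X1\<close> and in \<open>X3\<close> to a polynomial identity in the parameters.\<close>
  have bil: "e0 + e1 * X1 + e3 * X3 + e * (X1 * X3) = 0"
    if "e0 * (q * th) * (q * (1 + th)) + e1 * (2 * s) * (q * (1 + th)) + e3 * (2 * s) * (q * th)
        + e * (2 * s) * (2 * s) = 0" for e0 e1 e3 e :: real
  proof -
    have "(e0 + e1 * X1 + e3 * X3 + e * (X1 * X3)) * (q * th * (q * (1 + th)))
      = e0 * (q * th) * (q * (1 + th)) + e1 * (X1 * (q * th)) * (q * (1 + th))
        + e3 * (X3 * (q * (1 + th))) * (q * th) + e * (X1 * (q * th)) * (X3 * (q * (1 + th)))"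
      by algebra
    then have "(e0 + e1 * X1 + e3 * X3 + e * (X1 * X3)) * (q * th * (q * (1 + th))) = 0"
      unfolding h1 h3 using that by simp
    then show ?thesis using nz2 mult_eq_0_iff by blast
  qed
  have "2 * s + (s - p * (1 + th)) * X1 + (th + s) * X3 + 0 * (X1 * X3) = 0"
    by (rule bil) (unfold s(1) q(1), algebra)
  then have c2: "th * X3 + s * (2 + X1 + X3) - p * (1 + th) * X1 = 0"
    by algebra
  have X13: "X3 * (1 + th) = X1 * th"
  proof -
    have "(X3 * (1 + th)) * q = (X1 * th) * q" using h1 h3 by algebra
    then show ?thesis using nz by simp
  qed
  show "A0 * (x1 - 1) + 2 * n0 - B0 * (x3 - 1) = 0"
    unfolding X[symmetric] abn using c1 by algebra
  have "A0 * X1 * X3 + 2 * n0 * (1 + X1 + (1 + X3)) - B0 * X3 * X1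
      = 2 * k * (th * X3 + s * (2 + X1 + X3) - p * (1 + th) * X1)"
    unfolding abn by algebra
  then show "A0 * (x1 - 1) * (x3 - 1) + 2 * n0 * (x1 + x3) - B0 * (x3 - 1) * (x1 - 1) = 0"
    unfolding X[symmetric] unfolding xs c2 by simp
  have "s * (s + p * (1 + th) - th) + s * (s + p * (1 + th)) * X1 + s * (s - th) * X3
      + (s^2 - p) * (X1 * X3) = 0"
    by (rule bil) (unfold s(1) q(1), algebra)
  then have "(- th * (1 + X3) + s * (1 + X1) * (1 + X3) + p * (1 + th) * (1 + X1)) * s = p * (X1 * X3)"
    by algebra
  then have c3: "- th * (1 + X3) + s * (1 + X1) * (1 + X3) + p * (1 + th) * (1 + X1) = p * (X1 * X3) / s"
    using nz by (simp add: eq_divide_eq)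
  have "p * q * th^2 / (D * s * (1 + th)) * X1^3
     = (X1 * (q * th)) / (D * s) * (p * X1 * ((X1 * th) / (1 + th)))"
    by (simp add: power2_eq_square power3_eq_cube)
  also have "\<dots> = 2 * k * (p * (X1 * X3) / s)"
    unfolding h1 X13[symmetric] k_def using nz by simp
  finally have "p * q * th^2 / (D * s * (1 + th)) * X1^3 = 2 * k * (p * (X1 * X3) / s)" .
  moreover have "- (A0 * X1) * (1 + X3) + 2 * n0 * (1 + X1) * (1 + X3) + B0 * X3 * (1 + X1)
      = 2 * k * (- th * (1 + X3) + s * (1 + X1) * (1 + X3) + p * (1 + th) * (1 + X1))"
    unfolding abn by algebra
  ultimately show "- A0 * (x1 - 1) * x3 + 2 * n0 * x1 * x3 + B0 * (x3 - 1) * x1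
       = p * q * th^2 / (D * s * (1 + th)) * (x1 - 1)^3"
    unfolding X[symmetric] unfolding xs c3 by simp
  assume r: "r = p / s + l * th / (1 + th)"
  have rs: "r * (s * (1 + th)) = p * (1 + th) + l * th * s"
    unfolding r using nz by (simp add: distrib_right)
  define R where "R = p * (1 + th) + l * th * s"
  have "- 2 * s * (1 + th) + (R - s * (1 + th)) * X1 + (- l * s * (1 + th)) * X3 + 0 * (X1 * X3) = 0"
    by (rule bil) (unfold R_def s(1) q(1), algebra)
  then have "((r - 1) * X1 - 2 - l * X3) * (s * (1 + th)) = 0"
    using rs unfolding R_def[symmetric] by algebra
  then show "(r - 1) * (x1 - 1) - 2 - l * (x3 - 1) = 0"
    unfolding X[symmetric] using nz by simp
  have "(-4 * s^2 * (1 + th)) + (-2 * s^2 * (1 + th)) * X1 + (-2 * s^2 * (1 + th)) * X3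
      + (s * (R - s * (1 + th)) - l * s^2 * (1 + th) + (p * q * (1 + th)^2 + l * s^2)) * (X1 * X3) = 0"
    by (rule bil) (unfold R_def s(1) q(1), algebra)
  then have "((r - 1) * X1 * X3 - 2 * (1 + X1 + (1 + X3)) - l * X3 * X1) * (s^2 * (1 + th)) = - D * (X1 * X3)"
    using rs unfolding R_def[symmetric] D(1) by algebra
  then have e: "(r - 1) * X1 * X3 - 2 * (1 + X1 + (1 + X3)) - l * X3 * X1 = - D * (X1 * X3) / (s^2 * (1 + th))"
    using nz by (subst eq_divide_eq) simp
  have X3e: "X3 = X1 * th / (1 + th)" using X13 nz by (simp add: eq_divide_eq)
  show "(r - 1) * (x1 - 1) * (x3 - 1) - 2 * (x1 + x3) - l * (x3 - 1) * (x1 - 1) = 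
      - (th * D / (s^2 * (1 + th)^2)) * (x1 - 1)^2"
    unfolding X[symmetric] unfolding xs e unfolding X3e by (simp add: power2_eq_square ac_simps)
qed

section \<open>The limiting integral and the Airy function\<close>

lemma set_integrable_exp_decay:
  fixes f :: "real \<Rightarrow> complex"
  assumes cont: "continuous_on {0..} f" and bd: "\<And>r. r \<ge> 0 \<Longrightarrow> norm (f r) \<le> B * exp (- r)"
  shows "set_integrable lborel {0..} f"
proof (rule set_integrable_bound)
  have "(\<lambda>r::real. exp (- 1 * r)) absolutely_integrable_on {0..}"
    by (intro nonnegative_absolutely_integrable_1 integrable_on_exp_minus_to_infinity) auto
  then have "set_integrable lborel {0..} (\<lambda>r::real. exp (- 1 * r))"
    unfolding set_integrable_def by (subst (asm) integrable_completion) (auto intro: borel_measurable_continuous_onI continuous_intros)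
  then show "set_integrable lborel {0..} (\<lambda>r. B * exp (- 1 * r))" by simp
  show "set_borel_measurable lborel {0..} f"
    unfolding set_borel_measurable_def
    using borel_measurable_continuous_on_indicator[OF _ cont] by simp
  show "AE r in lborel. r \<in> {0..} \<longrightarrow> norm (f r) \<le> norm (B * exp (- 1 * r))"
    using bd by (intro AE_I2) force
qed

lemma tail_integral_exp_decay:
  fixes f :: "real \<Rightarrow> complex"
  assumes cont: "continuous_on {0..} f" and bd: "\<And>r. r \<ge> 0 \<Longrightarrow> norm (f r) \<le> B * exp (- r)"
    and R: "R \<ge> 0"
  shows "norm ((LBINT r:{0..}. f r) - integral {0..R} f) \<le> B * exp (- R)"
proof -
  have io: "f integrable_on {a..b}" if "0 \<le> a" for a b
    using that by (intro integrable_continuous_real continuous_on_subset[OF cont]) auto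
  have B: "B \<ge> 0" using order_trans[OF norm_ge_zero bd[of 0]] by simp
  have "((\<lambda>S. LBINT r:{0..S}. f r) \<longlongrightarrow> (LBINT r:{0..}. f r)) at_top"
    by (rule tendsto_set_lebesgue_integral_at_top[OF _ set_integrable_exp_decay[OF cont bd]]) auto
  moreover have "(LBINT r:{0..S}. f r) = integral {0..S} f" for S
  proof (rule set_borel_integral_eq_integral)
    show "set_integrable lborel {0..S} f"
      by (rule set_integrable_subset[OF set_integrable_exp_decay[OF cont bd]]) auto
  qed
  ultimately have lim: "((\<lambda>S. integral {0..S} f) \<longlongrightarrow> (LBINT r:{0..}. f r)) at_top" by simp
  have "((\<lambda>S. norm (integral {0..S} f - integral {0..R} f)) \<longlongrightarrow>
      norm ((LBINT r:{0..}. f r) - integral {0..R} f)) at_top"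
    by (intro tendsto_norm tendsto_diff lim tendsto_const)
  moreover have "eventually (\<lambda>S. norm (integral {0..S} f - integral {0..R} f) \<le> B * exp (- R)) at_top"
    using eventually_ge_at_top[of R]
  proof eventually_elim
    case (elim S)
    have "integral {0..R} f + integral {R..S} f = integral {0..S} f"
      by (rule Henstock_Kurzweil_Integration.integral_combine) (use R elim io in auto)
    then have "integral {0..S} f - integral {0..R} f = integral {R..S} f"
      by (metis add_diff_cancel_left')
    then have "norm (integral {0..S} f - integral {0..R} f) = norm (integral {R..S} f)" by simp
    also have "norm (integral {R..S} f) \<le> integral {R..S} (\<lambda>r. B * exp (- r))"
      by (rule integral_norm_bound_integral)
         (use R io bd in \<open>auto intro!: integrable_continuous_real continuous_intros\<close>)
    also have "integral {R..S} (\<lambda>r. B * exp (- r)) = (- B * exp (- S)) - (- B * exp (- R))"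
      by (rule integral_unique, rule fundamental_theorem_of_calculus[OF elim])
         (auto intro!: derivative_eq_intros simp: has_real_derivative_iff_has_vector_derivative[symmetric])
    also have "\<dots> \<le> B * exp (- R)" using B by simp
    finally show ?case .
  qed
  ultimately show ?thesis by (rule tendsto_upperbound) simp
qed

lemma cubic_beats_quadratic:
  fixes \<kappa> C :: real
  assumes "\<kappa> > 0"
  obtains B where "B > 0" "\<And>r. r \<ge> 0 \<Longrightarrow> (1 + r)^4 * exp (C * (1 + r)\<^sup>2 - \<kappa> * r^3) \<le> B * exp (- r)"
proof -
  define h where "h r = (1 + r)^4 * exp (C * (1 + r)\<^sup>2 - \<kappa> * r^3 + r)" for r :: real
  have "(h \<longlongrightarrow> 0) at_top" unfolding h_def using assms by real_asymp
  then have "eventually (\<lambda>r. h r < 1) at_top" by (rule order_tendstoD) simp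
  then obtain R where R: "\<And>r. r \<ge> R \<Longrightarrow> h r < 1" by (auto simp: eventually_at_top_linorder)
  have "continuous_on {0..R} h" unfolding h_def by (intro continuous_intros)
  then have "bounded (h ` {0..R})" by (intro compact_imp_bounded compact_continuous_image) auto
  then obtain K where K: "\<forall>r\<in>{0..R}. \<bar>h r\<bar> \<le> K" by (auto simp: bounded_iff)
  show thesis
  proof (rule that[of "max 1 K"])
    fix r :: real assume r: "r \<ge> 0"
    have "h r \<le> max 1 K"
    proof (cases "r \<le> R")
      case True then show ?thesis using bspec[OF K, of r] r by auto
    next
      case False then show ?thesis using R[of r] by auto
    qed
    moreover have "(1 + r)^4 * exp (C * (1 + r)\<^sup>2 - \<kappa> * r^3) = h r * exp (- r)"
      unfolding h_def by (simp add: exp_add[symmetric] mult.assoc)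
    ultimately show "(1 + r)^4 * exp (C * (1 + r)\<^sup>2 - \<kappa> * r^3) \<le> max 1 K * exp (- r)"
      by simp
  qed simp
qed

definition cubic_exp :: "real \<Rightarrow> real \<Rightarrow> real \<Rightarrow> complex \<Rightarrow> complex" where
  "cubic_exp T X Y v = exp (of_real (T/3) * v^3 - of_real X * v^2 + of_real Y * v)"

text \<open>
  Along a direction \<open>m\<close> in which \<open>Re m\<^sup>3\<close> is negative the cubic term decides; moving the base
  point by \<open>a\<close> only changes terms of degree at most two. The bound is uniform in \<open>Y\<close> and in the
  direction, as is needed for uniformity over \<open>\<zeta>, u\<close> and for estimates on whole segments.
\<close>

lemma norm_cubic_exp_le:
  fixes a m :: complex
  assumes T: "T > 0" and M: "\<bar>Y\<bar> \<le> M" and m: "norm m \<le> 1" "Re (m^3) \<le> - \<kappa>"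
    and a: "norm a \<le> c" and r: "r \<ge> 0"
  shows "norm (cubic_exp T X Y (a + of_real r * m))
    \<le> exp ((T * (1 + c)^3 + \<bar>X\<bar> * (1 + c)\<^sup>2 + M * (1 + c)) * (1 + r)\<^sup>2 - T/3 * \<kappa> * r^3)"
proof -
  have c: "c \<ge> 0" using order_trans[OF norm_ge_zero a] .
  define v where "v = a + of_real r * m"
  have nrm: "norm (of_real r * m) \<le> r"
    using r m mult_left_mono[of "norm m" 1 r] by (simp add: norm_mult)
  have nv: "norm v \<le> (1 + c) * (1 + r)"
  proof -
    have "norm v \<le> c + r" unfolding v_def using norm_triangle_mono[OF a nrm] .
    also have "\<dots> \<le> (1 + c) * (1 + r)" using c r by (simp add: algebra_simps)
    finally show ?thesis .
  qed
  have one: "(1 + r) \<le> (1 + r)\<^sup>2" using r by (simp add: power2_eq_square)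
  have nv1: "norm v \<le> (1 + c) * (1 + r)\<^sup>2"
    using nv mult_left_mono[OF one, of "1 + c"] c by linarith
  have nv2: "(norm v)\<^sup>2 \<le> (1 + c)\<^sup>2 * (1 + r)\<^sup>2"
    using power_mono[OF nv, of 2] by (simp add: power_mult_distrib)
  have cube: "v^3 - of_real (r^3) * m^3 = a * (v\<^sup>2 + v * (of_real r * m) + (of_real r * m)\<^sup>2)"
    unfolding v_def by (simp add: power2_eq_square power3_eq_cube algebra_simps)
  have sub: "norm (v^3 - of_real (r^3) * m^3) \<le> 3 * (1 + c)^3 * (1 + r)\<^sup>2"
  proof -
    have rm: "norm (of_real r * m) \<le> (1 + c) * (1 + r)"
    proof -
      have "r \<le> (1 + c) * (1 + r)" using c r by (simp add: algebra_simps)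
      with nrm show ?thesis by linarith
    qed
    have "norm (v\<^sup>2 + v * (of_real r * m) + (of_real r * m)\<^sup>2) \<le>
      (norm v)\<^sup>2 + norm v * norm (of_real r * m) + (norm (of_real r * m))\<^sup>2"
      by (smt (verit) norm_triangle_ineq norm_mult norm_power)
    also have "\<dots> \<le> ((1 + c) * (1 + r))\<^sup>2 + ((1 + c) * (1 + r)) * ((1 + c) * (1 + r)) + ((1 + c) * (1 + r))\<^sup>2"
      by (intro add_mono power_mono mult_mono nv rm) (use c r in auto)
    also have "\<dots> = 3 * (1 + c)\<^sup>2 * (1 + r)\<^sup>2" by (simp add: power2_eq_square)
    finally have "norm (v^3 - of_real (r^3) * m^3) \<le> (1 + c) * (3 * (1 + c)\<^sup>2 * (1 + r)\<^sup>2)"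
      unfolding cube norm_mult by (intro mult_mono) (use a c r in auto)
    then show ?thesis by (simp add: power2_eq_square power3_eq_cube mult_ac)
  qed
  have "Re (v^3) = r^3 * Re (m^3) + Re (v^3 - of_real (r^3) * m^3)" by simp
  also have "\<dots> \<le> r^3 * (- \<kappa>) + 3 * (1 + c)^3 * (1 + r)\<^sup>2"
    using sub complex_Re_le_cmod[of "v^3 - of_real (r^3) * m^3"] m r
    by (intro add_mono mult_left_mono) auto
  finally have A: "T/3 * Re (v^3) \<le> T/3 * (r^3 * (- \<kappa>) + 3 * (1 + c)^3 * (1 + r)\<^sup>2)"
    using T by (intro mult_left_mono) auto
  have Bq: "- X * Re (v^2) \<le> \<bar>X\<bar> * ((1 + c)\<^sup>2 * (1 + r)\<^sup>2)"
  proof -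
    have "- X * Re (v^2) \<le> \<bar>X\<bar> * \<bar>Re (v^2)\<bar>" by (metis abs_ge_self abs_mult abs_minus_cancel)
    also have "\<dots> \<le> \<bar>X\<bar> * ((1 + c)\<^sup>2 * (1 + r)\<^sup>2)"
      using nv2 abs_Re_le_cmod[of "v^2"] by (intro mult_left_mono) (auto simp: norm_power)
    finally show ?thesis .
  qed
  have Cq: "Y * Re v \<le> M * ((1 + c) * (1 + r)\<^sup>2)"
  proof -
    have "Y * Re v \<le> \<bar>Y\<bar> * \<bar>Re v\<bar>" by (metis abs_ge_self abs_mult)
    also have "\<dots> \<le> M * ((1 + c) * (1 + r)\<^sup>2)"
      using nv1 abs_Re_le_cmod[of v] M by (intro mult_mono) auto
    finally show ?thesis .
  qed
  have "norm (cubic_exp T X Y v) = exp (T/3 * Re (v^3) + (- X * Re (v^2)) + Y * Re v)"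
    unfolding cubic_exp_def by (simp add: norm_exp_eq_Re)
  also have "\<dots> \<le> exp (T/3 * (r^3 * (- \<kappa>) + 3 * (1 + c)^3 * (1 + r)\<^sup>2)
      + \<bar>X\<bar> * ((1 + c)\<^sup>2 * (1 + r)\<^sup>2) + M * ((1 + c) * (1 + r)\<^sup>2))"
    using A Bq Cq by simp
  finally show ?thesis unfolding v_def by (simp add: algebra_simps)
qed

lemma cubic_ray_exp_decay:
  fixes e a :: complex
  assumes T: "T > 0" and e: "norm e = 1" "Re (e^3) < 0"
  shows "\<exists>B>0. \<forall>r\<ge>0. \<forall>Y. \<bar>Y\<bar> \<le> M \<longrightarrow>
    norm (e * cubic_exp T X Y (a + of_real r * e)) \<le> B * exp (- r)"
proof -
  define c where "c = norm a"
  define C where "C = T * (1 + c)^3 + \<bar>X\<bar> * (1 + c)\<^sup>2 + M * (1 + c)"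
  have "T/3 * (- Re (e^3)) > 0" using T e by (simp add: mult_pos_neg)
  then obtain B where B: "B > 0"
    "\<And>r. r \<ge> 0 \<Longrightarrow> (1 + r)^4 * exp (C * (1 + r)\<^sup>2 - T/3 * (- Re (e^3)) * r^3) \<le> B * exp (- r)"
    using cubic_beats_quadratic[of "T/3 * (- Re (e^3))" C] by blast
  show ?thesis
  proof (intro exI[of _ B] conjI allI impI B(1))
    fix r Y :: real assume r: "r \<ge> 0" and Y: "\<bar>Y\<bar> \<le> M"
    have "norm (e * cubic_exp T X Y (a + of_real r * e)) \<le> exp (C * (1 + r)\<^sup>2 - T/3 * (- Re (e^3)) * r^3)"
      unfolding C_def norm_mult e(1) mult_1
      by (rule norm_cubic_exp_le[OF T Y _ _ _ r]) (use e in \<open>auto simp: c_def\<close>)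
    also have "\<dots> \<le> (1 + r)^4 * exp (C * (1 + r)\<^sup>2 - T/3 * (- Re (e^3)) * r^3)"
      using r by (simp add: one_le_power)
    also have "\<dots> \<le> B * exp (- r)" by (rule B(2)[OF r])
    finally show "norm (e * cubic_exp T X Y (a + of_real r * e)) \<le> B * exp (- r)" .
  qed
qed

text \<open>
  Integrals along infinite rays are expressed through a primitive. Rotating and shifting a
  contour then only requires comparing one primitive at the far ends of two rays.
\<close>

lemma ray_integral_primitive:
  fixes f F :: "complex \<Rightarrow> complex" and a e :: complex
  assumes F: "\<And>v. (F has_field_derivative f v) (at v)"
    and bd: "\<And>r. r \<ge> 0 \<Longrightarrow> norm (e * f (a + of_real r * e)) \<le> B * exp (- r)"
    and cont: "continuous_on UNIV f"
  shows "((\<lambda>R. F (a + of_real R * e) - F a) \<longlongrightarrow> (LBINT r:{0..}. e * f (a + of_real r * e))) at_top"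
proof -
  let ?g = "\<lambda>r. e * f (a + of_real r * e)"
  have c: "continuous_on {0..} ?g"
    by (intro continuous_intros continuous_on_compose2[OF cont]) auto
  have eq: "integral {0..R} ?g = F (a + of_real R * e) - F a" if "R \<ge> 0" for R
  proof -
    have "(?g has_integral (F (a + of_real R * e) - F (a + of_real 0 * e))) {0..R}"
    proof (rule fundamental_theorem_of_calculus[OF that])
      fix r :: real
      have "((\<lambda>r. a + of_real r * e) has_vector_derivative e) (at r within {0..R})"
        by (auto intro!: derivative_eq_intros)
      from field_vector_diff_chain_within[OF this has_field_derivative_at_within[OF F]]
      show "((\<lambda>r. F (a + of_real r * e)) has_vector_derivative ?g r) (at r within {0..R})"
        by (simp add: o_def)
    qed
    from integral_unique[OF this] show ?thesis by (simp only: of_real_0 mult_zero_left add_0_right)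
  qed
  have "((\<lambda>R. (LBINT r:{0..}. ?g r) - (F (a + of_real R * e) - F a)) \<longlongrightarrow> 0) at_top"
  proof (rule Lim_null_comparison)
    show "((\<lambda>R. B * exp (- R)) \<longlongrightarrow> 0) at_top" by real_asymp
    show "eventually (\<lambda>R. norm ((LBINT r:{0..}. ?g r) - (F (a + of_real R * e) - F a)) \<le> B * exp (- R)) at_top"
      using eventually_ge_at_top[of 0]
      by eventually_elim (use tail_integral_exp_decay[OF c bd] eq in simp)
  qed
  from tendsto_diff[OF tendsto_const[of "LBINT r:{0..}. ?g r"] this] show ?thesis by simp
qed

lemma Re_cube_le_wedge:
  assumes "0 \<le> Re m" "Re m \<le> 1/2" "(Im m)\<^sup>2 \<ge> 3/4"
  shows "Re (m^3) \<le> - 2 * Re m"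
proof -
  have "(Re m)\<^sup>2 \<le> (1/2)\<^sup>2" using assms by (intro power_mono) auto
  then have "(Re m)\<^sup>2 - 3 * (Im m)\<^sup>2 \<le> -2" using assms by (simp add: power2_eq_square)
  then have "Re m * ((Re m)\<^sup>2 - 3 * (Im m)\<^sup>2) \<le> Re m * (-2)" using assms by (intro mult_left_mono) auto
  moreover have "Re (m^3) = Re m * ((Re m)\<^sup>2 - 3 * (Im m)\<^sup>2)"
    by (simp add: power2_eq_square power3_eq_cube algebra_simps)
  ultimately show ?thesis by simp
qed

text \<open>
  Between the far ends of the two rays the integrand is of size \<open>exp (- const R\<^sup>3)\<close> on the
  whole connecting segment, while the length of the segment grows linearly. The variable \<open>s\<close>
  is the sign that distinguishes the upper from the lower pair of rays.
\<close>

lemma primitive_same_end: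
  fixes a e e1 :: complex and s :: real
  assumes T: "T > 0" and e: "norm e = 1" "0 < Re e" "Re e \<le> 1/2" "s * Im e \<ge> sqrt 3 / 2"
    and e1: "norm e1 = 1" "Re e \<le> Re e1" "Re e1 \<le> 1/2" "s * Im e1 \<ge> sqrt 3 / 2"
    and s: "s * s = 1"
    and F: "\<And>v. (F has_field_derivative cubic_exp T X Y v) (at v)"
  shows "((\<lambda>R. F (of_real R * e) - F (a + of_real R * e1)) \<longlongrightarrow> 0) at_top"
proof -
  define c where "c = norm a"
  define M where "M = \<bar>Y\<bar>"
  define C where "C = T * (1 + c)^3 + \<bar>X\<bar> * (1 + c)\<^sup>2 + M * (1 + c)"
  have "T/3 * (2 * Re e) > 0" using T e by simp
  then obtain B where B: "B > 0"
    "\<And>r. r \<ge> 0 \<Longrightarrow> (1 + r)^4 * exp (C * (1 + r)\<^sup>2 - T/3 * (2 * Re e) * r^3) \<le> B * exp (- r)"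
    using cubic_beats_quadratic[of "T/3 * (2 * Re e)" C] by blast
  have main: "norm (F (of_real R * e) - F (a + of_real R * e1)) \<le> (c + 2) * B * exp (- R)" if R: "R \<ge> 0" for R
  proof -
    let ?S = "closed_segment (of_real R * e) (a + of_real R * e1)"
    let ?K = "exp (C * (1 + R)\<^sup>2 - T/3 * (2 * Re e) * R^3)"
    have bd: "norm (cubic_exp T X Y v) \<le> ?K" if v: "v \<in> ?S" for v
    proof -
      obtain t where t: "0 \<le> t" "t \<le> 1" "v = (1 - t) *\<^sub>R (of_real R * e) + t *\<^sub>R (a + of_real R * e1)"
        using v by (auto simp: in_segment)
      define m where "m = (1 - t) *\<^sub>R e + t *\<^sub>R e1"
      have v2: "v = t *\<^sub>R a + of_real R * m" unfolding t(3) m_def by (simp add: scaleR_conv_of_real algebra_simps)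
      have "norm m \<le> norm ((1 - t) *\<^sub>R e) + norm (t *\<^sub>R e1)" unfolding m_def by (rule norm_triangle_ineq)
      also have "\<dots> = 1" using t e e1 by simp
      finally have m1: "norm m \<le> 1" .
      have re: "Re e \<le> Re m" "Re m \<le> 1/2"
      proof -
        have "(1 - t) * Re e + t * Re e \<le> (1 - t) * Re e + t * Re e1"
          using t e1 by (intro add_mono mult_left_mono) auto
        then show "Re e \<le> Re m" unfolding m_def by (simp add: algebra_simps)
        have "(1 - t) * Re e + t * Re e1 \<le> (1 - t) * (1/2) + t * (1/2)"
          using t e e1 by (intro add_mono mult_left_mono) auto
        also have "\<dots> = 1/2" by algebra
        finally show "Re m \<le> 1/2" unfolding m_def by simp
      qed
      have "(1 - t) * (sqrt 3 / 2) + t * (sqrt 3 / 2) \<le> (1 - t) * (s * Im e) + t * (s * Im e1)"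
        using t e e1 by (intro add_mono mult_left_mono) auto
      also have "\<dots> = s * Im m" unfolding m_def by (simp add: algebra_simps)
      finally have "sqrt 3 / 2 \<le> s * Im m" by (simp only: left_diff_distrib mult_1)
      then have "(sqrt 3 / 2)\<^sup>2 \<le> (s * Im m)\<^sup>2" by (intro power_mono) auto
      also have "\<dots> = (Im m)\<^sup>2" using s by (simp add: power_mult_distrib power2_eq_square)
      finally have im: "(Im m)\<^sup>2 \<ge> 3/4" by (simp add: power_divide)
      have r3: "Re (m^3) \<le> - (2 * Re e)" using Re_cube_le_wedge[OF _ re(2) im] re e by linarith
      have ta: "norm (t *\<^sub>R a) \<le> c" using t mult_right_mono[of t 1 "norm a"] by (simp add: c_def)
      show ?thesis unfolding v2 C_def
        by (rule norm_cubic_exp_le[OF T _ m1 r3 ta R]) (simp add: M_def)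
    qed
    have "norm (F (of_real R * e) - F (a + of_real R * e1)) \<le> ?K * norm (of_real R * e - (a + of_real R * e1))"
      by (rule field_differentiable_bound[OF convex_closed_segment has_field_derivative_at_within[OF F] bd]) auto
    also have "norm (of_real R * e - (a + of_real R * e1)) \<le> (c + 2) * (1 + R)^4"
    proof -
      have "norm (of_real R * e - (a + of_real R * e1)) \<le> norm (of_real R * e) + (norm a + norm (of_real R * e1))"
        by (meson norm_triangle_ineq norm_triangle_ineq4 order_trans add_left_mono)
      also have "\<dots> = c + 2 * R" using R e e1 by (simp add: norm_mult c_def)
      also have "\<dots> \<le> (c + 2) * (1 + R)" using R by (simp add: c_def algebra_simps)
      also have "\<dots> \<le> (c + 2) * (1 + R)^4"
        using R self_le_power[of "1 + R" 4] by (intro mult_left_mono) (auto simp: c_def)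
      finally show ?thesis .
    qed
    then have "?K * norm (of_real R * e - (a + of_real R * e1)) \<le> ?K * ((c + 2) * (1 + R)^4)"
      by (intro mult_left_mono) auto
    also have "\<dots> = (c + 2) * ((1 + R)^4 * ?K)" by (simp add: mult_ac)
    also have "\<dots> \<le> (c + 2) * (B * exp (- R))" using B(2)[OF R] by (intro mult_left_mono) (auto simp: c_def)
    finally show ?thesis by simp
  qed
  show ?thesis
  proof (rule Lim_null_comparison)
    show "((\<lambda>R. (c + 2) * B * exp (- R)) \<longlongrightarrow> 0) at_top" by real_asymp
    show "eventually (\<lambda>R. norm (F (of_real R * e) - F (a + of_real R * e1)) \<le> (c + 2) * B * exp (- R)) at_top"
      using eventually_ge_at_top[of 0] by eventually_elim (rule main)
  qed
qed

text \<open>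
  The substitution \<open>v = X/T + T\<^sup>-\<^sup>1\<^sup>/\<^sup>3 w\<close> completes the cube: it removes the quadratic term and
  produces the argument of the Airy function and the exponential prefactor of the limit kernel.
\<close>

lemma cubic_exp_complete_cube:
  fixes T X Y :: real and w :: complex
  assumes T: "T > 0"
  defines "z \<equiv> T powr (-1/3) * (- Y) + T powr (-4/3) * X\<^sup>2"
  shows "cubic_exp T X Y (of_real (X/T) + of_real (T powr (-1/3)) * w)
    = of_real (exp (- 2 * X^3 / (3 * T\<^sup>2) + Y * X / T)) * cubic_exp 1 0 (- z) w"
proof -
  define k where "k = T powr (-1/3)"
  have k3: "k^3 = 1 / T"
  proof -
    have "k^3 = T powr (-1/3 + -1/3 + -1/3)" unfolding k_def powr_add by (simp add: power3_eq_cube)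
    also have "\<dots> = T powr (-1)" by (rule arg_cong[of _ _ "\<lambda>y. T powr y"]) simp
    finally show ?thesis using T by (simp add: powr_minus_divide)
  qed
  have k4: "T powr (-4/3) = k / T"
  proof -
    have "T powr (-4/3) = T powr (-1/3 + (-1))" by simp
    then show ?thesis unfolding k_def using T by (simp only: powr_add) (simp add: powr_minus_divide)
  qed
  define x where "x = complex_of_real (X/T)"
  define t K where "t = complex_of_real T" and "K = complex_of_real k"
  have tK: "t * K^3 = 1" unfolding t_def K_def using k3 T by (simp add: of_real_power[symmetric] del: of_real_power)
  have Xx: "complex_of_real X = t * x" unfolding x_def t_def using T by simp
  have e: "of_real (T/3) * (x + K * w)^3 - of_real X * (x + K * w)^2 + of_real Y * (x + K * w)
    = (- 2 * t * x^3 / 3 + of_real Y * x) + (w^3/3 - (K * (- of_real Y) + K * t * x\<^sup>2) * w)"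
  proof -
    have "of_real (T/3) = t / 3" unfolding t_def by simp
    moreover have "t * (x + K * w)^3 = t * x^3 + 3 * t * x\<^sup>2 * K * w + 3 * t * x * K\<^sup>2 * w\<^sup>2 + (t * K^3) * w^3"
      by algebra
    then have "t * (x + K * w)^3 = t * x^3 + 3 * t * x\<^sup>2 * K * w + 3 * t * x * K\<^sup>2 * w\<^sup>2 + w^3"
      unfolding tK by simp
    ultimately show ?thesis unfolding Xx by (simp add: field_simps power2_eq_square power3_eq_cube)
  qed
  have a1: "- 2 * t * x^3 / 3 + of_real Y * x = of_real (- 2 * X^3 / (3 * T\<^sup>2) + Y * X / T)"
    unfolding t_def x_def using T by (simp add: field_simps power2_eq_square power3_eq_cube)
  have a2: "K * (- of_real Y) + K * t * x\<^sup>2 = of_real z"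
    unfolding z_def k4 k_def[symmetric] K_def t_def x_def using T by (simp add: field_simps power2_eq_square)
  show ?thesis
    unfolding cubic_exp_def k_def[symmetric] K_def[symmetric] x_def[symmetric] e a1 a2
    by (subst exp_add, simp only: exp_of_real, simp)
qed

lemma continuous_cubic_exp: "continuous_on S (cubic_exp T X Y)"
  unfolding cubic_exp_def by (intro continuous_intros)

text \<open>
  The limiting integrals run along the rays through \<open>0\<close> with directions \<open>e\<close> and \<open>cnj e\<close>; those
  defining the Airy function run, after completing the cube, along the rays through \<open>X/T\<close> with
  directions \<open>cis (\<plusminus>\<pi>/3)\<close>. Both differences of integrals are differences of the same primitive
  at infinity, where the values at the two starting points cancel.
\<close>

lemma wedge_integral_eq_S_lim:
  fixes T X \<zeta> u :: real and e :: complex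
  assumes T: "T > 0" and e: "norm e = 1" "0 < Re e" "Re e \<le> 1/2" "Im e > 0"
  defines "Y \<equiv> u - \<zeta>"
  shows "(LBINT r:{0..}. e * cubic_exp T X Y (of_real r * e))
    - (LBINT r:{0..}. cnj e * cubic_exp T X Y (of_real r * cnj e))
    = 2 * of_real pi * \<i> * S_lim (- T) (- X) \<zeta> u"
proof -
  define k where "k = T powr (-1/3)"
  define x where "x = complex_of_real (X/T)"
  define z where "z = T powr (-1/3) * (- Y) + T powr (-4/3) * X\<^sup>2"
  define c where "c = exp (- 2 * X^3 / (3 * T\<^sup>2) + Y * X / T)"
  have k: "k > 0" unfolding k_def using T by simp
  have "cubic_exp T X Y holomorphic_on UNIV" unfolding cubic_exp_def by (intro holomorphic_intros)
  then obtain F where "\<And>v. v \<in> UNIV \<Longrightarrow> (F has_field_derivative cubic_exp T X Y v) (at v within UNIV)"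
    using holomorphic_convex_primitive'[OF convex_UNIV open_UNIV] by blast
  then have F: "(F has_field_derivative cubic_exp T X Y v) (at v)" for v by simp
  have im: "Im e \<ge> sqrt 3 / 2"
  proof -
    have "(Re e)\<^sup>2 + (Im e)\<^sup>2 = 1" using e(1) by (simp add: cmod_def)
    moreover have "(Re e)\<^sup>2 \<le> (1/2)\<^sup>2" using e by (intro power_mono) auto
    ultimately have "(sqrt 3 / 2)\<^sup>2 \<le> (Im e)\<^sup>2" by (simp add: power_divide)
    then show ?thesis using e(4) by (rule power2_le_imp_le[OF _ less_imp_le])
  qed
  have ray: "((\<lambda>R. F (of_real R * d) - F 0) \<longlongrightarrow> (LBINT r:{0..}. d * cubic_exp T X Y (of_real r * d))) at_top"
    if d: "norm d = 1" "Re (d^3) < 0" for d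
  proof -
    obtain B where B: "\<forall>r\<ge>0. \<forall>Y'. \<bar>Y'\<bar> \<le> \<bar>Y\<bar> \<longrightarrow> norm (d * cubic_exp T X Y' (0 + of_real r * d)) \<le> B * exp (- r)"
      using cubic_ray_exp_decay[OF T d, of "\<bar>Y\<bar>" X 0] by blast
    have "((\<lambda>R. F (0 + of_real R * d) - F 0) \<longlongrightarrow> (LBINT r:{0..}. d * cubic_exp T X Y (0 + of_real r * d))) at_top"
      by (rule ray_integral_primitive[OF F _ continuous_cubic_exp]) (use B in blast)
    then show ?thesis by simp
  qed
  have airy: "((\<lambda>R. F (x + of_real R * d) - F x) \<longlongrightarrow>
      of_real (k * c) * (LBINT s:{0..}. d * exp ((of_real s * d)^3 / 3 - of_real z * (of_real s * d)))) at_top"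
    if d: "norm d = 1" "Re (d^3) < 0" for d
  proof -
    obtain B where B: "\<forall>r\<ge>0. \<forall>Y'. \<bar>Y'\<bar> \<le> \<bar>- z\<bar> \<longrightarrow> norm (d * cubic_exp 1 0 Y' (0 + of_real r * d)) \<le> B * exp (- r)"
      using cubic_ray_exp_decay[OF zero_less_one d, of "\<bar>- z\<bar>" 0 0] by blast
    define G where "G w = F (x + of_real k * w) / of_real (k * c)" for w
    have c0: "c \<noteq> 0" unfolding c_def by simp
    have G: "(G has_field_derivative cubic_exp 1 0 (- z) w) (at w)" for w
    proof -
      have "(G has_field_derivative (cubic_exp T X Y (x + of_real k * w) * of_real k) / of_real (k * c)) (at w)"
        unfolding G_def by (rule DERIV_cdivide, rule DERIV_chain2[OF F]) (auto intro!: derivative_eq_intros)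
      also have "cubic_exp T X Y (x + of_real k * w) = of_real c * cubic_exp 1 0 (- z) w"
        unfolding x_def k_def c_def z_def by (rule cubic_exp_complete_cube[OF T])
      finally show ?thesis using k c0 by simp
    qed
    have "((\<lambda>R. G (0 + of_real R * d) - G 0) \<longlongrightarrow> (LBINT r:{0..}. d * cubic_exp 1 0 (- z) (0 + of_real r * d))) at_top"
      by (rule ray_integral_primitive[OF G _ continuous_cubic_exp]) (use B in blast)
    then have "((\<lambda>R. of_real (k * c) * (G (of_real R * d) - G 0)) \<longlongrightarrow> of_real (k * c) * (LBINT r:{0..}. d * cubic_exp 1 0 (- z) (of_real r * d))) at_top"
      by (intro tendsto_mult tendsto_const) simp
    moreover have "of_real (k * c) * (G (of_real R * d) - G 0) = F (x + of_real (k * R) * d) - F x" for R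
      unfolding G_def using k c0 by (simp add: right_diff_distrib mult_ac)
    moreover have "cubic_exp 1 0 (- z) w = exp (w^3/3 - of_real z * w)" for w unfolding cubic_exp_def by simp
    ultimately have "((\<lambda>R. F (x + of_real (k * R) * d) - F x) \<longlongrightarrow>
      of_real (k * c) * (LBINT s:{0..}. d * exp ((of_real s * d)^3 / 3 - of_real z * (of_real s * d)))) at_top"
      by simp
    then have "((\<lambda>R. F (x + of_real (k * (R / k)) * d) - F x) \<longlongrightarrow>
      of_real (k * c) * (LBINT s:{0..}. d * exp ((of_real s * d)^3 / 3 - of_real z * (of_real s * d)))) at_top"
      by (rule filterlim_compose) (use k in real_asymp)
    then show ?thesis using k by simp
  qed
  define d1 d2 where "d1 = cis (pi/3)" and "d2 = cis (-pi/3)"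
  have cis3: "Re d1 = 1/2" "Im d1 = sqrt 3/2" "norm d1 = 1"
    "Re d2 = 1/2" "Im d2 = - (sqrt 3/2)" "norm d2 = 1"
    unfolding d1_def d2_def by (simp_all add: cos_60 sin_60)
  have neg: "Re (d^3) < 0" if "0 < Re d" "Re d \<le> 1/2" "sqrt 3/2 \<le> \<bar>Im d\<bar>" for d
  proof -
    have "(sqrt 3/2)\<^sup>2 \<le> \<bar>Im d\<bar>\<^sup>2" using that by (intro power_mono) auto
    then show ?thesis using Re_cube_le_wedge[of d] that by (simp add: power_divide)
  qed
  have up: "((\<lambda>R. F (of_real R * e) - F (x + of_real R * d1)) \<longlongrightarrow> 0) at_top"
    by (rule primitive_same_end[where s = 1, OF T _ _ _ _ _ _ _ _ _ F]) (use e im in \<open>simp_all add: cis3\<close>)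
  have dn: "((\<lambda>R. F (of_real R * cnj e) - F (x + of_real R * d2)) \<longlongrightarrow> 0) at_top"
    by (rule primitive_same_end[where s = "-1", OF T _ _ _ _ _ _ _ _ _ F]) (use e im in \<open>simp_all add: cis3\<close>)
  let ?I = "\<lambda>d. LBINT r:{0..}. d * cubic_exp T X Y (of_real r * d)"
  let ?A = "\<lambda>d. LBINT s:{0..}. d * exp ((of_real s * d)^3 / 3 - of_real z * (of_real s * d))"
  have l1: "((\<lambda>R. (F (of_real R * e) - F 0) - (F (of_real R * cnj e) - F 0)
       - (F (of_real R * e) - F (x + of_real R * d1))
       + (F (of_real R * cnj e) - F (x + of_real R * d2))) \<longlongrightarrow> ?I e - ?I (cnj e) - 0 + 0) at_top"
    by (intro tendsto_add tendsto_diff up dn ray) (use e im neg in auto)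
  have l2: "((\<lambda>R. (F (x + of_real R * d1) - F x) - (F (x + of_real R * d2) - F x))
     \<longlongrightarrow> of_real (k * c) * ?A (d1) - of_real (k * c) * ?A (d2)) at_top"
    by (intro tendsto_diff airy) (auto intro!: neg simp: cis3)
  have "?I e - ?I (cnj e) - 0 + 0 = of_real (k * c) * ?A d1 - of_real (k * c) * ?A d2"
    by (rule tendsto_unique[OF _ l1]) (use l2 in \<open>simp_all add: algebra_simps\<close>)
  then have "?I e - ?I (cnj e) = of_real (k * c) * ?A d1 - of_real (k * c) * ?A d2"
    by simp
  also have "\<dots> = of_real (k * c) * (2 * of_real pi * \<i> * Airy (of_real z))"
    unfolding Airy_def d1_def d2_def by (simp add: right_diff_distrib)
  also have "\<dots> = 2 * of_real pi * \<i> * S_lim (- T) (- X) \<zeta> u"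
    unfolding S_lim_def S_pos_def using T by (simp add: k_def c_def z_def Y_def algebra_simps diff_divide_distrib)
  finally show ?thesis .
qed

section \<open>Convergence along one steep ray\<close>

lemma norm_exp_diff_le:
  fixes a b :: complex
  assumes "Re a \<le> K" "Re b \<le> K"
  shows "norm (exp a - exp b) \<le> exp K * norm (a - b)"
proof (rule field_differentiable_bound[OF convex_closed_segment])
  fix z assume "z \<in> closed_segment a b"
  then obtain t where t: "0 \<le> t" "t \<le> 1" "z = (1 - t) *\<^sub>R a + t *\<^sub>R b" by (auto simp: in_segment)
  have "Re z \<le> (1 - t) * K + t * K"
    unfolding t(3) using t assms by (auto intro!: add_mono mult_left_mono)
  also have "\<dots> = K" by (simp add: algebra_simps)
  finally show "norm (exp z) \<le> exp K" by (simp add: norm_exp_eq_Re)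
qed (auto intro!: derivative_eq_intros)

text \<open>
  The local limit on one ray, with an error bound in place of a mere limit. Here \<open>\<eta>\<close> is a multiple
  of \<open>\<epsilon>\<^sup>1\<^sup>/\<^sup>2\<close>, and \<open>\<Phi>3\<close>, \<open>\<Phi>2\<close>, \<open>\<Phi>1\<close> are phases that vanish at \<open>0\<close> to the orders 3, 2, 1 and
  are normalised so that their leading terms are \<open>(\<tau> e)\<^sup>3\<close>, \<open>(\<tau> e)\<^sup>2\<close>, \<open>\<tau> e\<close>.

  After \<open>\<tau> = \<eta> r\<close> the exponent differs from the limiting cubic polynomial by at most
  \<open>\<eta> const (1 + r)\<^sup>4\<close>, because each Taylor remainder has one more factor \<open>\<tau>\<close> than its leading
  term. Both exponents have real part at most \<open>- const r\<^sup>3 + O((1 + r)\<^sup>2)\<close> on the whole range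
  \<open>r \<le> 1/\<eta>\<close>, since the cubic phase descends along the entire path and not only near \<open>0\<close>. The
  integrands thus differ by \<open>\<eta>\<close> times an integrable function. All constants depend on \<open>Y\<close> and on
  the bounded perturbation \<open>\<psi>\<close> only through \<open>M\<close> and \<open>L\<close>.
\<close>

lemma steep_ray_limit:
  fixes \<Phi>1 \<Phi>2 \<Phi>3 g :: "real \<Rightarrow> complex" and e :: complex and T X M C L \<kappa> :: real
  assumes T: "T > 0" and e: "norm e = 1" "Re (e^3) < 0" and \<kappa>: "\<kappa> > 0" and nonneg: "C \<ge> 0" "L \<ge> 0" "M \<ge> 0"
    and cont: "continuous_on {0..1} \<Phi>1" "continuous_on {0..1} \<Phi>2" "continuous_on {0..1} \<Phi>3"
      "continuous_on {0..1} g"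
    and steep: "\<And>\<tau>. \<tau> \<in> {0..1} \<Longrightarrow> Re (\<Phi>3 \<tau>) \<le> - \<kappa> * \<tau>^3"
    and \<Phi>3: "\<And>\<tau>. \<tau> \<in> {0..1} \<Longrightarrow> norm (\<Phi>3 \<tau> - (of_real \<tau> * e)^3) \<le> C * \<tau>^4"
    and \<Phi>2: "\<And>\<tau>. \<tau> \<in> {0..1} \<Longrightarrow> norm (\<Phi>2 \<tau> - (of_real \<tau> * e)^2) \<le> C * \<tau>^3"
    and \<Phi>1: "\<And>\<tau>. \<tau> \<in> {0..1} \<Longrightarrow> norm (\<Phi>1 \<tau> - of_real \<tau> * e) \<le> C * \<tau>^2"
    and g: "\<And>\<tau>. \<tau> \<in> {0..1} \<Longrightarrow> norm (g \<tau> - e) \<le> C * \<tau>"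
  shows "\<exists>B. \<forall>\<eta> Y \<psi>. 0 < \<eta> \<longrightarrow> \<bar>Y\<bar> \<le> M \<longrightarrow> continuous_on {0..1} \<psi> \<longrightarrow>
      (\<forall>\<tau>\<in>{0..1}. norm (\<psi> \<tau>) \<le> L * \<tau>) \<longrightarrow>
      norm (of_real (1/\<eta>) * integral {0..1} (\<lambda>\<tau>. exp (of_real (T/3 / \<eta>^3) * \<Phi>3 \<tau> - of_real (X / \<eta>^2) * \<Phi>2 \<tau>
          + of_real (Y / \<eta>) * \<Phi>1 \<tau> + \<psi> \<tau>) * g \<tau>)
        - (LBINT r:{0..}. e * cubic_exp T X Y (of_real r * e))) \<le> B * \<eta>"
proof -
  define \<kappa>' where "\<kappa>' = T/3 * min \<kappa> (- Re (e^3))"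
  define D where "D = T + \<bar>X\<bar> * (1 + C) + M * (1 + C) + L"
  define K1 where "K1 = C * (T/3 + \<bar>X\<bar> + M) + L"
  define K2 where "K2 = K1 * (1 + C) + C"
  have \<kappa>': "\<kappa>' > 0" unfolding \<kappa>'_def using T \<kappa> e by simp
  then obtain B where B: "B > 0"
    "\<And>r. r \<ge> 0 \<Longrightarrow> (1 + r)^4 * exp (D * (1 + r)\<^sup>2 - \<kappa>' * r^3) \<le> B * exp (- r)"
    using cubic_beats_quadratic[of \<kappa>' D] by blast
  obtain B' where B': "B' > 0" "\<forall>r\<ge>0. \<forall>Y. \<bar>Y\<bar> \<le> M \<longrightarrow> norm (e * cubic_exp T X Y (0 + of_real r * e)) \<le> B' * exp (- r)"
    using cubic_ray_exp_decay[OF T e, of M X 0] by blast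
  have K1: "K1 \<ge> 0" unfolding K1_def using nonneg T by simp
  have K2: "K2 \<ge> 0" unfolding K2_def using nonneg K1 by simp
  show ?thesis
  proof (intro exI[of _ "K2 * B + B'"] allI impI)
    fix \<eta> Y :: real and \<psi> :: "real \<Rightarrow> complex"
    assume \<eta>: "0 < \<eta>" and Y: "\<bar>Y\<bar> \<le> M" and c\<psi>: "continuous_on {0..1} \<psi>"
      and \<psi>: "\<forall>\<tau>\<in>{0..1}. norm (\<psi> \<tau>) \<le> L * \<tau>"
    define E where "E \<tau> = of_real (T/3 / \<eta>^3) * \<Phi>3 \<tau> - of_real (X / \<eta>^2) * \<Phi>2 \<tau>
          + of_real (Y / \<eta>) * \<Phi>1 \<tau> + \<psi> \<tau>" for \<tau>
    define I where "I r = e * cubic_exp T X Y (of_real r * e)" for r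
    define J where "J r = exp (E (\<eta> * r)) * g (\<eta> * r)" for r
    have pw: "(\<lambda>r. r^k \<le> (1 + r)^m) r" if "r \<ge> 0" "k \<le> m" for r :: real and k m
    proof -
      have "r^k \<le> (1 + r)^k" using that by (intro power_mono) auto
      also have "\<dots> \<le> (1 + r)^m" using that by (intro power_increasing) auto
      finally show ?thesis .
    qed
    have close: "norm (J r - I r) \<le> \<eta> * K2 * B * exp (- r)" if r: "r \<in> {0..1/\<eta>}" for r
    proof -
      have r0: "r \<ge> 0" and \<tau>: "\<eta> * r \<in> {0..1}" using r \<eta> by (auto simp: field_simps)
      define d where "d = of_real (T/3) * (of_real r * e)^3 - of_real X * (of_real r * e)^2 + of_real Y * (of_real r * e)"
      define s3 s2 s1 where "s3 = \<Phi>3 (\<eta> * r) - (of_real (\<eta> * r) * e)^3" and "s2 = \<Phi>2 (\<eta> * r) - (of_real (\<eta> * r) * e)^2"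
        and "s1 = \<Phi>1 (\<eta> * r) - of_real (\<eta> * r) * e"
      have s: "norm s3 \<le> C * (\<eta> * r)^4" "norm s2 \<le> C * (\<eta> * r)^3" "norm s1 \<le> C * (\<eta> * r)^2"
        "norm (\<psi> (\<eta> * r)) \<le> L * (\<eta> * r)"
        using \<Phi>3[OF \<tau>] \<Phi>2[OF \<tau>] \<Phi>1[OF \<tau>] \<psi> \<tau> unfolding s1_def s2_def s3_def by auto
      have Ed: "E (\<eta> * r) - d = of_real (T/3 / \<eta>^3) * s3 - of_real (X / \<eta>^2) * s2 + of_real (Y / \<eta>) * s1 + \<psi> (\<eta> * r)"
        unfolding E_def d_def s1_def s2_def s3_def using \<eta>
        by (simp add: field_simps power_mult_distrib)
      have "norm (E (\<eta> * r) - d) \<le> T/3 / \<eta>^3 * norm s3 + \<bar>X\<bar> / \<eta>^2 * norm s2 + \<bar>Y\<bar> / \<eta> * norm s1 + norm (\<psi> (\<eta> * r))"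
      proof -
        have "norm (E (\<eta> * r) - d) \<le> norm (of_real (T/3 / \<eta>^3) * s3) + norm (of_real (X / \<eta>^2) * s2)
            + norm (of_real (Y / \<eta>) * s1) + norm (\<psi> (\<eta> * r))"
          unfolding Ed by (meson norm_triangle_ineq norm_triangle_ineq4 order_trans add_right_mono)
        then show ?thesis using T \<eta> by (simp add: norm_mult norm_divide norm_power)
      qed
      also have "\<dots> \<le> T/3 / \<eta>^3 * (C * (\<eta> * r)^4) + \<bar>X\<bar> / \<eta>^2 * (C * (\<eta> * r)^3) + M / \<eta> * (C * (\<eta> * r)^2) + L * (\<eta> * r)"
        using s \<eta> T Y nonneg by (intro add_mono mult_mono divide_right_mono) auto
      also have "\<dots> = \<eta> * (T/3 * C * r^4 + \<bar>X\<bar> * C * r^3 + M * C * r^2 + L * r^1)"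
        using \<eta> by (simp add: field_simps power_mult_distrib eval_nat_numeral)
      also have "\<dots> \<le> \<eta> * (T/3 * C * (1 + r)^4 + \<bar>X\<bar> * C * (1 + r)^4 + M * C * (1 + r)^4 + L * (1 + r)^4)"
        using \<eta> T nonneg by (intro mult_left_mono add_mono pw r0) auto
      also have "\<dots> = \<eta> * K1 * (1 + r)^4" unfolding K1_def by (simp add: algebra_simps)
      finally have diff: "norm (E (\<eta> * r) - d) \<le> \<eta> * K1 * (1 + r)^4" .
      define Z where "Z = D * (1 + r)\<^sup>2 - \<kappa>' * r^3"
      have ce: "cubic_exp T X Y (of_real r * e) = exp d" unfolding cubic_exp_def d_def ..
      have r3: "T/3 * (- Re (e^3)) * r^3 \<ge> \<kappa>' * r^3" "T/3 * \<kappa> * r^3 \<ge> \<kappa>' * r^3"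
      proof -
        have "\<kappa>' \<le> T/3 * (- Re (e^3))" "\<kappa>' \<le> T/3 * \<kappa>"
          unfolding \<kappa>'_def using T by (intro mult_left_mono min.cobounded1 min.cobounded2; simp)+
        then show "T/3 * (- Re (e^3)) * r^3 \<ge> \<kappa>' * r^3" "T/3 * \<kappa> * r^3 \<ge> \<kappa>' * r^3"
          using r0 by (intro mult_right_mono; simp)+
      qed
      have Red: "Re d \<le> Z"
      proof -
        have "norm (exp d) \<le> exp ((T * (1 + 0)^3 + \<bar>X\<bar> * (1 + 0)\<^sup>2 + M * (1 + 0)) * (1 + r)\<^sup>2 - T/3 * (- Re (e^3)) * r^3)"
          using norm_cubic_exp_le[OF T Y _ _ _ r0, of e "- Re (e^3)" 0 0 X] e ce by simp
        then have "Re d \<le> (T + \<bar>X\<bar> + M) * (1 + r)\<^sup>2 - T/3 * (- Re (e^3)) * r^3" by (simp add: norm_exp_eq_Re)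
        also have "\<dots> \<le> D * (1 + r)\<^sup>2 - \<kappa>' * r^3"
        proof (rule diff_mono[OF mult_right_mono r3(1)])
          have "0 \<le> \<bar>X\<bar> * C" "0 \<le> M * C" using nonneg by simp_all
          then show "T + \<bar>X\<bar> + M \<le> D" unfolding D_def distrib_left mult_1_right using nonneg by linarith
        qed simp
        finally show ?thesis unfolding Z_def .
      qed
      have ReE: "Re (E (\<eta> * r)) \<le> Z"
      proof -
        have n2: "norm (\<Phi>2 (\<eta> * r)) \<le> (1 + C) * (\<eta> * r)^2"
        proof -
          have "norm (\<Phi>2 (\<eta> * r)) \<le> norm s2 + norm ((of_real (\<eta> * r) * e)^2)"
            unfolding s2_def by (metis norm_triangle_sub add.commute diff_add_cancel norm_triangle_ineq)
          also have "\<dots> \<le> C * (\<eta> * r)^3 + (\<eta> * r)^2"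
            using s(2) e r0 \<eta> by (intro add_mono) (auto simp: norm_mult norm_power power_mult_distrib)
          also have "C * (\<eta> * r)^3 \<le> C * (\<eta> * r)^2"
            using nonneg \<tau> by (intro mult_left_mono power_decreasing) auto
          finally show ?thesis by (simp add: algebra_simps)
        qed
        have n1: "norm (\<Phi>1 (\<eta> * r)) \<le> (1 + C) * (\<eta> * r)"
        proof -
          have "norm (\<Phi>1 (\<eta> * r)) \<le> norm s1 + norm (of_real (\<eta> * r) * e)"
            unfolding s1_def by (metis norm_triangle_sub add.commute diff_add_cancel norm_triangle_ineq)
          also have "\<dots> \<le> C * (\<eta> * r)^2 + \<eta> * r"
            using s(3) e r0 \<eta> by (intro add_mono) (auto simp: norm_mult)
          also have "C * (\<eta> * r)^2 \<le> C * (\<eta> * r)^1"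
            using nonneg \<tau> by (intro mult_left_mono power_decreasing) auto
          finally show ?thesis by (simp add: algebra_simps)
        qed
        have "Re (E (\<eta> * r)) = T/3 / \<eta>^3 * Re (\<Phi>3 (\<eta> * r)) + Re (- of_real (X / \<eta>^2) * \<Phi>2 (\<eta> * r))
            + Re (of_real (Y / \<eta>) * \<Phi>1 (\<eta> * r)) + Re (\<psi> (\<eta> * r))"
          unfolding E_def by simp
        also have "\<dots> \<le> T/3 / \<eta>^3 * (- \<kappa> * (\<eta> * r)^3) + \<bar>X\<bar> / \<eta>^2 * ((1 + C) * (\<eta> * r)^2)
            + M / \<eta> * ((1 + C) * (\<eta> * r)) + L * (\<eta> * r)"
        proof (intro add_mono)
          show "T/3 / \<eta>^3 * Re (\<Phi>3 (\<eta> * r)) \<le> T/3 / \<eta>^3 * (- \<kappa> * (\<eta> * r)^3)"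
            using steep[OF \<tau>] T \<eta> by (intro mult_left_mono) auto
          have "Re (- of_real (X / \<eta>^2) * \<Phi>2 (\<eta> * r)) \<le> norm (- of_real (X / \<eta>^2) * \<Phi>2 (\<eta> * r))"
            by (rule complex_Re_le_cmod)
          also have "\<dots> = \<bar>X\<bar> / \<eta>^2 * norm (\<Phi>2 (\<eta> * r))" by (simp add: norm_mult norm_divide norm_power)
          also have "\<dots> \<le> \<bar>X\<bar> / \<eta>^2 * ((1 + C) * (\<eta> * r)^2)" using n2 by (intro mult_left_mono) auto
          finally show "Re (- of_real (X / \<eta>^2) * \<Phi>2 (\<eta> * r)) \<le> \<bar>X\<bar> / \<eta>^2 * ((1 + C) * (\<eta> * r)^2)" .
          have "Re (of_real (Y / \<eta>) * \<Phi>1 (\<eta> * r)) \<le> norm (of_real (Y / \<eta>) * \<Phi>1 (\<eta> * r))"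
            by (rule complex_Re_le_cmod)
          also have "\<dots> = \<bar>Y\<bar> / \<eta> * norm (\<Phi>1 (\<eta> * r))" using \<eta> by (simp add: norm_mult norm_divide)
          also have "\<dots> \<le> M / \<eta> * ((1 + C) * (\<eta> * r))" using n1 \<eta> Y nonneg by (intro mult_mono divide_right_mono) auto
          finally show "Re (of_real (Y / \<eta>) * \<Phi>1 (\<eta> * r)) \<le> M / \<eta> * ((1 + C) * (\<eta> * r))" .
          show "Re (\<psi> (\<eta> * r)) \<le> L * (\<eta> * r)" using s(4) complex_Re_le_cmod order_trans by blast
        qed
        also have "\<dots> = - (T/3 * \<kappa> * r^3) + \<bar>X\<bar> * (1 + C) * r^2 + M * (1 + C) * r^1 + L * (\<eta> * r)"
          using \<eta> by (simp add: field_simps power_mult_distrib)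
        also have "\<dots> \<le> - (\<kappa>' * r^3) + \<bar>X\<bar> * (1 + C) * (1 + r)^2 + M * (1 + C) * (1 + r)^2 + L * (1 + r)\<^sup>2"
        proof (intro add_mono mult_left_mono pw r0)
          have "1 \<le> (1 + r)\<^sup>2" by (rule one_le_power) (use r0 in simp)
          moreover have "\<eta> * r \<le> 1" using \<tau> by simp
          ultimately show "\<eta> * r \<le> (1 + r)\<^sup>2" by linarith
        qed (use r3 nonneg in auto)
        also have "\<dots> \<le> Z" unfolding Z_def D_def using T by (simp add: algebra_simps)
        finally show ?thesis .
      qed
      have gn: "norm (g (\<eta> * r)) \<le> 1 + C"
      proof -
        have "norm (g (\<eta> * r)) \<le> norm (g (\<eta> * r) - e) + norm e" by (metis norm_triangle_sub add.commute)
        also have "\<dots> \<le> C * (\<eta> * r) + 1" using g[OF \<tau>] e by simp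
        also have "\<dots> \<le> C * 1 + 1" using nonneg \<tau> by (intro add_mono mult_left_mono) auto
        finally show ?thesis by simp
      qed
      have "J r - I r = (exp (E (\<eta> * r)) - exp d) * g (\<eta> * r) + exp d * (g (\<eta> * r) - e)"
        unfolding J_def I_def ce by (simp add: algebra_simps)
      then have "norm (J r - I r) \<le> norm (exp (E (\<eta> * r)) - exp d) * norm (g (\<eta> * r)) + norm (exp d) * norm (g (\<eta> * r) - e)"
        by (metis norm_triangle_ineq norm_mult)
      also have "\<dots> \<le> (exp Z * (\<eta> * K1 * (1 + r)^4)) * (1 + C) + exp Z * (C * (\<eta> * r^1))"
      proof (intro add_mono mult_mono gn)
        have "norm (exp (E (\<eta> * r)) - exp d) \<le> exp Z * norm (E (\<eta> * r) - d)" by (rule norm_exp_diff_le[OF ReE Red])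
        also have "\<dots> \<le> exp Z * (\<eta> * K1 * (1 + r)^4)" using diff by (intro mult_left_mono) auto
        finally show "norm (exp (E (\<eta> * r)) - exp d) \<le> exp Z * (\<eta> * K1 * (1 + r)^4)" .
      qed (use g[OF \<tau>] Red K1 \<eta> r0 in \<open>auto simp: norm_exp_eq_Re\<close>)
      also have "\<dots> \<le> (exp Z * (\<eta> * K1 * (1 + r)^4)) * (1 + C) + exp Z * (C * (\<eta> * (1 + r)^4))"
        using \<eta> nonneg by (intro add_left_mono mult_left_mono pw r0) auto
      also have "\<dots> = \<eta> * K2 * ((1 + r)^4 * exp Z)" unfolding K2_def by (simp add: algebra_simps)
      also have "\<dots> \<le> \<eta> * K2 * (B * exp (- r))"
        unfolding Z_def using B(2)[OF r0] \<eta> K2 by (intro mult_left_mono) auto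
      finally show ?thesis by (simp add: mult_ac)
    qed
    have cE: "continuous_on {0..1} (\<lambda>\<tau>. exp (E \<tau>) * g \<tau>)"
      unfolding E_def by (intro continuous_intros cont c\<psi>)
    have cI: "continuous_on S I" for S
      unfolding I_def by (intro continuous_intros continuous_on_compose2[OF continuous_cubic_exp[of UNIV]]) auto
    have im: "(\<lambda>r. r / \<eta>) ` {0..1} = {0..1/\<eta>}"
      using \<eta> by (simp add: image_divide_atLeastAtMost)
    have "((\<lambda>r. exp (E (\<eta> * r)) * g (\<eta> * r)) has_integral (1 / \<bar>\<eta>\<bar>) *\<^sub>R integral {0..1} (\<lambda>\<tau>. exp (E \<tau>) * g \<tau>)) ((\<lambda>r. r / \<eta>) ` {0..1})"
      by (rule has_integral_stretch_real) (use \<eta> integrable_integral[OF integrable_continuous_real[OF cE]] in auto)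
    then have hJ: "(J has_integral of_real (1/\<eta>) * integral {0..1} (\<lambda>\<tau>. exp (E \<tau>) * g \<tau>)) {0..1/\<eta>}"
      unfolding im J_def using \<eta> by (simp add: scaleR_conv_of_real)
    have hI: "I integrable_on {0..1/\<eta>}" by (intro integrable_continuous_real cI)
    have "norm (integral {0..1/\<eta>} (\<lambda>r. J r - I r)) \<le> integral {0..1/\<eta>} (\<lambda>r. \<eta> * K2 * B * exp (- r))"
    proof (rule integral_norm_bound_integral)
      show "(\<lambda>r. J r - I r) integrable_on {0..1/\<eta>}"
        using hJ hI by (intro integrable_diff) (auto simp: integrable_on_def)
      show "(\<lambda>r. \<eta> * K2 * B * exp (- r)) integrable_on {0..1/\<eta>}"
        by (intro integrable_continuous_real continuous_intros)
    qed (rule close)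
    also have "\<dots> = (- (\<eta> * K2 * B) * exp (- (1/\<eta>))) - (- (\<eta> * K2 * B) * exp (- 0))"
      by (rule integral_unique, rule fundamental_theorem_of_calculus)
         (use \<eta> in \<open>auto intro!: derivative_eq_intros simp: has_real_derivative_iff_has_vector_derivative[symmetric]\<close>)
    also have "\<dots> \<le> \<eta> * K2 * B" using \<eta> K2 B by simp
    also have "integral {0..1/\<eta>} (\<lambda>r. J r - I r) = of_real (1/\<eta>) * integral {0..1} (\<lambda>\<tau>. exp (E \<tau>) * g \<tau>) - integral {0..1/\<eta>} I"
      using hJ hI by (subst integral_diff) (auto simp: integral_unique)
    finally have p1: "norm (of_real (1/\<eta>) * integral {0..1} (\<lambda>\<tau>. exp (E \<tau>) * g \<tau>) - integral {0..1/\<eta>} I) \<le> \<eta> * K2 * B" .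
    have p2: "norm ((LBINT r:{0..}. I r) - integral {0..1/\<eta>} I) \<le> B' * exp (- (1/\<eta>))"
      by (rule tail_integral_exp_decay[OF cI]) (use \<eta> Y B' in \<open>auto simp: I_def\<close>)
    \<comment> \<open>The part of the limiting ray beyond \<open>r = 1/\<eta>\<close>, which the arc does not see, is negligible.\<close>
    have "1/\<eta> \<le> exp (1/\<eta>)" using exp_ge_add_one_self[of "1/\<eta>"] by linarith
    then have "exp (- (1/\<eta>)) \<le> \<eta>" using \<eta> by (simp add: exp_minus field_simps)
    then have "B' * exp (- (1/\<eta>)) \<le> B' * \<eta>" using B' by simp
    with p2 have p2': "norm (integral {0..1/\<eta>} I - (LBINT r:{0..}. I r)) \<le> B' * \<eta>" by (simp add: norm_minus_commute)
    have "norm (of_real (1/\<eta>) * integral {0..1} (\<lambda>\<tau>. exp (E \<tau>) * g \<tau>) - (LBINT r:{0..}. I r)) \<le> \<eta> * K2 * B + B' * \<eta>"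
      using norm_triangle_mono[OF p1 p2'] by simp
    then show "norm (of_real (1/\<eta>) * integral {0..1} (\<lambda>\<tau>. exp (of_real (T/3 / \<eta>^3) * \<Phi>3 \<tau> - of_real (X / \<eta>^2) * \<Phi>2 \<tau>
          + of_real (Y / \<eta>) * \<Phi>1 \<tau> + \<psi> \<tau>) * g \<tau>)
        - (LBINT r:{0..}. e * cubic_exp T X Y (of_real r * e))) \<le> (K2 * B + B') * \<eta>"
      unfolding E_def I_def by (simp add: algebra_simps)
  qed
qed

section \<open>The lens contour\<close>

text \<open>
  The factors of the parametrised integrand. Since the first summand is \<open>1 - \<tau>\<close> and not \<open>1\<close>,
  quotients of such functions stay regular up to \<open>\<tau> = 1\<close>, which plays the role of \<open>s = \<infinity>\<close> for
  the ray \<open>s e\<close>, \<open>s = \<tau> / (1 - \<tau>)\<close>.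
\<close>

definition lin :: "real \<Rightarrow> complex \<Rightarrow> real \<Rightarrow> complex" where
  "lin x e \<tau> = of_real (1 - \<tau>) + of_real x * (of_real \<tau> * e)"

definition ell :: "real \<Rightarrow> complex \<Rightarrow> real \<Rightarrow> complex" where
  "ell x e \<tau> = Ln (lin x e \<tau>) - Ln (lin 1 e \<tau>)"

text \<open>
  This is \<open>w = 1 - (1 - \<Theta>) (1 - z) / (1 + z)\<close> at the point \<open>z = \<tau> e / (1 - \<tau>)\<close> of the ray with
  direction \<open>e\<close>: a circular arc from \<open>\<Theta>\<close> to \<open>2 - \<Theta>\<close>. For purely imaginary \<open>e\<close> it would be half of
  the circle around \<open>1\<close> through \<open>\<Theta>\<close>; for \<open>Re e > 0\<close> it bulges less, and the arcs for \<open>e\<close> and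
  \<open>cnj e\<close> bound a lens inside that circle.
\<close>

definition lens_arc :: "real \<Rightarrow> complex \<Rightarrow> real \<Rightarrow> complex" where
  "lens_arc \<Theta> e \<tau> = (of_real \<Theta> * of_real (1 - \<tau>) + of_real (2 - \<Theta>) * (of_real \<tau> * e)) / lin 1 e \<tau>"

text \<open>
  The imaginary part is \<open>x \<tau> Im e\<close>, which vanishes only at \<open>\<tau> = 0\<close>, where the value is \<open>1\<close>. So
  the principal logarithm is available along the whole path for every factor, including the
  one with \<open>x = -1\<close>, which turns around the singularity \<open>1\<close>.
\<close>

lemma lin_notin_nonpos:
  assumes "x \<noteq> 0" "Im e \<noteq> 0"
  shows "lin x e \<tau> \<notin> \<real>\<^sub>\<le>\<^sub>0"
proof
  assume *: "lin x e \<tau> \<in> \<real>\<^sub>\<le>\<^sub>0"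
  then have "\<tau> = 0" using assms by (simp add: complex_nonpos_Reals_iff lin_def)
  with * show False by (simp add: complex_nonpos_Reals_iff lin_def)
qed

lemma lin_nonzero: "x \<noteq> 0 \<Longrightarrow> Im e \<noteq> 0 \<Longrightarrow> lin x e \<tau> \<noteq> 0"
  using lin_notin_nonpos[of x e \<tau>] by (metis nonpos_Reals_zero_I)

lemma lin_deriv:
  "(lin x e has_vector_derivative (of_real x * e - 1)) (at \<tau> within S)"
  unfolding lin_def by (auto intro!: derivative_eq_intros simp: algebra_simps)

lemma continuous_lin: "continuous_on S (lin x e)"
  unfolding lin_def by (intro continuous_intros)

lemma ell_deriv:
  assumes "x \<noteq> 0" "Im e \<noteq> 0"
  shows "(ell x e has_vector_derivative of_real (x - 1) * e / (lin x e \<tau> * lin 1 e \<tau>)) (at \<tau> within S)"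
proof -
  have d: "((\<lambda>\<tau>. Ln (lin y e \<tau>)) has_vector_derivative (of_real y * e - 1) * inverse (lin y e \<tau>)) (at \<tau> within S)"
    if "y \<noteq> 0" for y
  proof -
    have "(Ln has_field_derivative inverse (lin y e \<tau>)) (at (lin y e \<tau>) within lin y e ` S)"
      by (rule has_field_derivative_at_within[OF has_field_derivative_Ln[OF lin_notin_nonpos[OF that assms(2)]]])
    from field_vector_diff_chain_within[OF lin_deriv this] show ?thesis by (simp only: o_def)
  qed
  have nz: "lin x e \<tau> \<noteq> 0" "lin 1 e \<tau> \<noteq> 0"
    by (rule lin_nonzero[OF assms], rule lin_nonzero[OF one_neq_zero assms(2)])
  have "(ell x e has_vector_derivative (of_real x * e - 1) * inverse (lin x e \<tau>) - (of_real 1 * e - 1) * inverse (lin 1 e \<tau>)) (at \<tau> within S)"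
    unfolding ell_def by (rule has_vector_derivative_diff[OF d[OF assms(1)] d[OF one_neq_zero]])
  also have "(of_real x * e - 1) * inverse (lin x e \<tau>) - (of_real 1 * e - 1) * inverse (lin 1 e \<tau>)
     = ((of_real x * e - 1) * lin 1 e \<tau> - (e - 1) * lin x e \<tau>) / (lin x e \<tau> * lin 1 e \<tau>)"
    unfolding divide_inverse[symmetric] diff_frac_eq[OF nz] by simp
  also have "(of_real x * e - 1) * lin 1 e \<tau> - (e - 1) * lin x e \<tau> = of_real (x - 1) * e"
    unfolding lin_def by (simp add: algebra_simps)
  finally show ?thesis .
qed

lemma ell_0 [simp]: "ell x e 0 = 0"
  by (simp add: ell_def lin_def)

lemma exp_ell:
  assumes "x \<noteq> 0" "Im e \<noteq> 0"
  shows "exp (ell x e \<tau>) = lin x e \<tau> / lin 1 e \<tau>"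
  using assms lin_nonzero[of x e \<tau>] lin_nonzero[of 1 e \<tau>] by (simp add: ell_def exp_diff)

lemma lens_arc_deriv:
  assumes "Im e \<noteq> 0"
  shows "(lens_arc \<Theta> e has_vector_derivative of_real (2 * (1 - \<Theta>)) * e / (lin 1 e \<tau>)^2) (at \<tau> within S)"
proof -
  have nz: "lin 1 e \<tau> \<noteq> 0" using assms by (simp add: lin_nonzero)
  have "((\<lambda>\<tau>. of_real \<Theta> * of_real (1 - \<tau>) + of_real (2 - \<Theta>) * (of_real \<tau> * e)) has_vector_derivative (of_real (2 - \<Theta>) * e - of_real \<Theta>)) (at \<tau> within S)"
    by (auto intro!: derivative_eq_intros simp: algebra_simps)
  moreover have "((\<lambda>\<tau>. inverse (lin 1 e \<tau>)) has_vector_derivative (of_real 1 * e - 1) * - (inverse (lin 1 e \<tau>) ^ Suc (Suc 0))) (at \<tau> within S)"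
    using field_vector_diff_chain_within[OF lin_deriv has_field_derivative_at_within[OF DERIV_inverse[OF nz]]]
    by (simp only: o_def)
  ultimately have "(lens_arc \<Theta> e has_vector_derivative
     (of_real \<Theta> * of_real (1 - \<tau>) + of_real (2 - \<Theta>) * (of_real \<tau> * e)) * ((of_real 1 * e - 1) * - (inverse (lin 1 e \<tau>) ^ Suc (Suc 0)))
     + (of_real (2 - \<Theta>) * e - of_real \<Theta>) * inverse (lin 1 e \<tau>)) (at \<tau> within S)"
    unfolding lens_arc_def divide_inverse by (rule has_vector_derivative_mult)
  also have "(of_real \<Theta> * of_real (1 - \<tau>) + of_real (2 - \<Theta>) * (of_real \<tau> * e)) * ((of_real 1 * e - 1) * - (inverse (lin 1 e \<tau>) ^ Suc (Suc 0)))
     + (of_real (2 - \<Theta>) * e - of_real \<Theta>) * inverse (lin 1 e \<tau>)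
     = ((of_real (2 - \<Theta>) * e - of_real \<Theta>) * lin 1 e \<tau> - (of_real \<Theta> * of_real (1 - \<tau>) + of_real (2 - \<Theta>) * (of_real \<tau> * e)) * (of_real 1 * e - 1))
      / (lin 1 e \<tau>)^2"
    using nz by (simp add: divide_simps power2_eq_square)
  also have "(of_real (2 - \<Theta>) * e - of_real \<Theta>) * lin 1 e \<tau> - (of_real \<Theta> * of_real (1 - \<tau>) + of_real (2 - \<Theta>) * (of_real \<tau> * e)) * (of_real 1 * e - 1)
     = of_real (2 * (1 - \<Theta>)) * e"
    unfolding lin_def by (simp add: algebra_simps)
  finally show ?thesis .
qed

lemma valid_path_lens_arc:
  assumes "Im e \<noteq> 0"
  shows "valid_path (lens_arc \<Theta> e)"
proof -
  have "continuous_on {0..1} (\<lambda>\<tau>. of_real (2 * (1 - \<Theta>)) * e / (lin 1 e \<tau>)^2)"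
    using assms by (intro continuous_intros continuous_lin) (simp add: lin_nonzero)
  then have "lens_arc \<Theta> e C1_differentiable_on {0..1}"
    unfolding C1_differentiable_on_def
    by (intro exI[of _ "\<lambda>\<tau>. of_real (2 * (1 - \<Theta>)) * e / (lin 1 e \<tau>)^2"] conjI ballI lens_arc_deriv[OF assms])
  then show ?thesis unfolding valid_path_def by (rule C1_differentiable_imp_piecewise)
qed

lemma lens_arc_ends:
  assumes "Im e \<noteq> 0"
  shows "pathstart (lens_arc \<Theta> e) = of_real \<Theta>" "pathfinish (lens_arc \<Theta> e) = of_real (2 - \<Theta>)"
  using assms by (auto simp: pathstart_def pathfinish_def lens_arc_def lin_def)

lemma contour_integral_lens_arc:
  assumes "Im e \<noteq> 0"
  shows "contour_integral (lens_arc \<Theta> e) f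
    = integral {0..1} (\<lambda>\<tau>. f (lens_arc \<Theta> e \<tau>) * (of_real (2 * (1 - \<Theta>)) * e / (lin 1 e \<tau>)^2))"
  unfolding contour_integral_integral
  by (simp add: vector_derivative_at[OF lens_arc_deriv[OF assms]])

text \<open>
  Each factor of the integrand is, along the arc, its value at the saddle times the exponential
  of a logarithm that starts at \<open>0\<close>.
\<close>

lemma lens_arc_ell:
  assumes "0 < \<Theta>" "\<Theta> < 1" "Im e \<noteq> 0" "Q > 0"
  shows "lens_arc \<Theta> e \<tau> = of_real \<Theta> * exp (ell ((2 - \<Theta>) / \<Theta>) e \<tau>)"
    "1 - lens_arc \<Theta> e \<tau> = of_real (1 - \<Theta>) * exp (ell (-1) e \<tau>)"
    "of_real Q + lens_arc \<Theta> e \<tau> = of_real (Q + \<Theta>) * exp (ell ((Q + 2 - \<Theta>) / (Q + \<Theta>)) e \<tau>)"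
proof -
  have nz: "lin 1 e \<tau> \<noteq> 0" using assms by (simp add: lin_nonzero)
  have "(2 - \<Theta>) / \<Theta> \<noteq> 0" "(Q + 2 - \<Theta>) / (Q + \<Theta>) \<noteq> 0" using assms by auto
  note ex = exp_ell[OF this(1) assms(3)] exp_ell[OF this(2) assms(3)] exp_ell[of "-1", OF _ assms(3)]
  have q: "Q + \<Theta> \<noteq> 0" using assms by simp
  have "of_real \<Theta> * lin ((2 - \<Theta>) / \<Theta>) e \<tau> = of_real \<Theta> * of_real (1 - \<tau>) + of_real (2 - \<Theta>) * (of_real \<tau> * e)"
  proof -
    have "complex_of_real \<Theta> * of_real ((2 - \<Theta>) / \<Theta>) = of_real (2 - \<Theta>)"
      using assms unfolding of_real_mult[symmetric] by simp
    then show ?thesis unfolding lin_def distrib_left mult.assoc[symmetric] by simp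
  qed
  then show "lens_arc \<Theta> e \<tau> = of_real \<Theta> * exp (ell ((2 - \<Theta>) / \<Theta>) e \<tau>)"
    unfolding ex lens_arc_def by simp
  have "lin 1 e \<tau> - (of_real \<Theta> * of_real (1 - \<tau>) + of_real (2 - \<Theta>) * (of_real \<tau> * e)) = of_real (1 - \<Theta>) * lin (-1) e \<tau>"
    unfolding lin_def by (simp add: algebra_simps)
  then show "1 - lens_arc \<Theta> e \<tau> = of_real (1 - \<Theta>) * exp (ell (-1) e \<tau>)"
    unfolding lens_arc_def using nz by (simp add: ex diff_divide_eq_iff)
  have "complex_of_real (Q + \<Theta>) * of_real ((Q + 2 - \<Theta>) / (Q + \<Theta>)) = of_real (Q + 2 - \<Theta>)"
    using q unfolding of_real_mult[symmetric] by simp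
  then have "of_real (Q + \<Theta>) * lin ((Q + 2 - \<Theta>) / (Q + \<Theta>)) e \<tau>
      = of_real (Q + \<Theta>) * of_real (1 - \<tau>) + of_real (Q + 2 - \<Theta>) * (of_real \<tau> * e)"
    unfolding lin_def distrib_left mult.assoc[symmetric] by simp
  also have "\<dots> = of_real Q * lin 1 e \<tau> + (of_real \<Theta> * of_real (1 - \<tau>) + of_real (2 - \<Theta>) * (of_real \<tau> * e))"
    unfolding lin_def by (simp add: algebra_simps)
  finally show "of_real Q + lens_arc \<Theta> e \<tau> = of_real (Q + \<Theta>) * exp (ell ((Q + 2 - \<Theta>) / (Q + \<Theta>)) e \<tau>)"
    unfolding lens_arc_def using nz by (simp add: ex add_divide_eq_iff)
qed

lemma Re_lens_arc_ge:
  assumes "0 < \<Theta>" "\<Theta> < 1" "Im e \<noteq> 0" "Re e \<ge> 0" "\<tau> \<in> {0..1}"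
  shows "Re (lens_arc \<Theta> e \<tau>) \<ge> \<Theta>"
proof -
  define k where "k = 2 * (1 - \<Theta>) * \<tau>"
  have k: "k \<ge> 0" unfolding k_def using assms by simp
  have nz: "lin 1 e \<tau> \<noteq> 0" using assms by (simp add: lin_nonzero)
  have "(of_real \<Theta> * of_real (1 - \<tau>) + of_real (2 - \<Theta>) * (of_real \<tau> * e))
      = of_real \<Theta> * lin 1 e \<tau> + of_real k * e"
    unfolding lin_def k_def by (simp add: algebra_simps)
  then have "lens_arc \<Theta> e \<tau> = of_real \<Theta> + of_real k * (e / lin 1 e \<tau>)"
    unfolding lens_arc_def using nz by (simp add: add_divide_distrib)
  then have "Re (lens_arc \<Theta> e \<tau>) = \<Theta> + k * Re (e / lin 1 e \<tau>)"
    by (simp only: plus_complex.simps Re_complex_of_real times_complex.simps Im_complex_of_real mult_zero_left diff_zero)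
  moreover have "Re (e / lin 1 e \<tau>) \<ge> 0"
  proof -
    have "Re e * Re (lin 1 e \<tau>) + Im e * Im (lin 1 e \<tau>) = (1 - \<tau>) * Re e + \<tau> * ((Re e)\<^sup>2 + (Im e)\<^sup>2)"
      by (simp add: lin_def algebra_simps power2_eq_square)
    also have "\<dots> \<ge> 0" using assms by (intro add_nonneg_nonneg mult_nonneg_nonneg) auto
    finally have "Re e * Re (lin 1 e \<tau>) + Im e * Im (lin 1 e \<tau>) \<ge> 0" .
    then show ?thesis by (simp add: Re_divide)
  qed
  ultimately show ?thesis using k by simp
qed

text \<open>
  The lower arc followed by the reversed upper one is a closed path in the half plane
  \<open>Re w \<ge> \<Theta>\<close>; hence it does not wind around \<open>0\<close> or \<open>- q/p\<close>. Around \<open>1\<close> it winds once, because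
  the logarithm of \<open>(1 - w)/(1 - \<Theta>)\<close> changes from \<open>0\<close> to \<open>Ln (- d) - Ln d\<close> along an arc with direction \<open>d\<close>,
  and this equals \<open>- i\<pi>\<close> above and \<open>i\<pi>\<close> below the real axis. The given contour has the same winding
  numbers, so the residue theorem gives both integrals the same value.
\<close>

lemma contour_integral_lens:
  assumes p: "0 < p" "p < 1" and \<Gamma>: "contour_around_1 p \<Gamma>" and \<Theta>: "0 < \<Theta>" "\<Theta> < 1"
    and e: "Im e > 0" "Re e \<ge> 0"
    and f: "f holomorphic_on UNIV - {0, 1, - complex_of_real ((1 - p) / p)}"
  shows "contour_integral \<Gamma> f = contour_integral (lens_arc \<Theta> (cnj e)) f - contour_integral (lens_arc \<Theta> e) f"
proof -
  define Q where "Q = (1 - p) / p"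
  have Q: "Q > 0" unfolding Q_def using p by simp
  let ?P = "{0, 1, - complex_of_real Q}"
  define g where "g = lens_arc \<Theta> (cnj e) +++ reversepath (lens_arc \<Theta> e)"
  have ime: "Im e \<noteq> 0" "Im (cnj e) \<noteq> 0" "Re (cnj e) \<ge> 0" using e by auto
  have vg: "valid_path g"
    unfolding g_def using ime by (auto intro!: valid_path_join valid_path_lens_arc simp: valid_path_imp_reverse lens_arc_ends)
  have lg: "pathfinish g = pathstart g" unfolding g_def using ime by (simp add: lens_arc_ends)
  have pi_arc: "path_image (lens_arc \<Theta> d) \<subseteq> {z. Re z \<ge> \<Theta>}" "path_image (lens_arc \<Theta> d) \<subseteq> UNIV - ?P"
    if "Im d \<noteq> 0" "Re d \<ge> 0" for d
  proof -
    show A: "path_image (lens_arc \<Theta> d) \<subseteq> {z. Re z \<ge> \<Theta>}"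
      using Re_lens_arc_ge[OF \<Theta>] that by (auto simp: path_image_def)
    have "lens_arc \<Theta> d \<tau> \<noteq> 1" for \<tau>
      using lens_arc_ell(2)[OF \<Theta> that(1) Q, of \<tau>] \<Theta> by auto
    then show "path_image (lens_arc \<Theta> d) \<subseteq> UNIV - ?P"
      using A \<Theta> Q by (force simp: path_image_def)
  qed
  have pig: "path_image g \<subseteq> {z. Re z \<ge> \<Theta>}" "path_image g \<subseteq> UNIV - ?P"
    unfolding g_def using ime e pi_arc by (auto simp: path_image_join lens_arc_ends)
  have conv: "convex {z. Re z \<ge> \<Theta>}" using convex_halfspace_Re_ge by simp
  have w0: "winding_number g 0 = 0" "winding_number g (- of_real Q) = 0"
    using winding_number_zero_outside[OF valid_path_imp_path[OF vg] conv lg _ pig(1)] \<Theta> Q by auto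
  have cint: "h contour_integrable_on lens_arc \<Theta> d" if "h holomorphic_on UNIV - ?P" "Im d \<noteq> 0" "Re d \<ge> 0" for h d
    by (rule contour_integrable_holomorphic_simple[OF that(1)])
       (use that pi_arc in \<open>auto intro!: valid_path_lens_arc\<close>)
  have split: "contour_integral g h = contour_integral (lens_arc \<Theta> (cnj e)) h - contour_integral (lens_arc \<Theta> e) h"
    if "h holomorphic_on UNIV - ?P" for h
    unfolding g_def using ime e
    by (subst contour_integral_join) (auto intro!: cint[OF that] valid_path_lens_arc valid_path_imp_reverse
        contour_integrable_reversepath simp: contour_integral_reversepath[OF valid_path_lens_arc])
  have w1: "winding_number g 1 = 1"
  proof -
    let ?h = "\<lambda>w. 1 / (w - 1)"
    \<comment> \<open>On the arc \<open>ell (-1) d\<close> is a logarithm of \<open>(1 - w)/(1 - \<Theta>)\<close>, so it is a primitive of \<open>dw/(w - 1)\<close>.\<close>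
    have arc1: "contour_integral (lens_arc \<Theta> d) ?h = Ln (- d) - Ln d" if d: "Im d \<noteq> 0" for d
    proof -
      have "((\<lambda>\<tau>. of_real (- 1 - 1) * d / (lin (-1) d \<tau> * lin 1 d \<tau>)) has_integral (ell (-1) d 1 - ell (-1) d 0)) {0..1}"
        by (rule fundamental_theorem_of_calculus[OF zero_le_one ell_deriv]) (use d in auto)
      moreover have "of_real (- 1 - 1) * d / (lin (-1) d \<tau> * lin 1 d \<tau>)
         = ?h (lens_arc \<Theta> d \<tau>) * (of_real (2 * (1 - \<Theta>)) * d / (lin 1 d \<tau>)^2)" for \<tau>
      proof -
        have nz: "lin 1 d \<tau> \<noteq> 0" "lin (-1) d \<tau> \<noteq> 0" using d by (simp_all add: lin_nonzero)
        have "lens_arc \<Theta> d \<tau> - 1 = - (of_real (1 - \<Theta>) * (lin (-1) d \<tau> / lin 1 d \<tau>))"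
          using lens_arc_ell(2)[OF \<Theta> d Q, of \<tau>] exp_ell[of "-1" d \<tau>] d by (simp add: algebra_simps)
        moreover have "complex_of_real (1 - \<Theta>) \<noteq> 0" using \<Theta> by simp
        moreover have "of_real (- 1 - 1) * d / (A * B) = 1 / - (c * (A / B)) * (2 * c * d / B\<^sup>2)"
          if "c \<noteq> 0" "A \<noteq> 0" "B \<noteq> 0" for A B c :: complex
          using that by (simp add: field_simps power2_eq_square)
        ultimately show ?thesis using nz by (simp only: of_real_mult of_real_numeral)
      qed
      ultimately show ?thesis
        unfolding contour_integral_lens_arc[OF d] by (simp add: integral_unique ell_def lin_def)
    qed
    have "contour_integral g ?h = (Ln (- cnj e) - Ln (cnj e)) - (Ln (- e) - Ln e)"
      using ime by (subst split) (auto intro!: holomorphic_intros simp: arc1)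
    also have "\<dots> = 2 * of_real pi * \<i>"
      using ime e by (subst (1 2) Ln_minus) (auto simp: complex_eq_iff)
    finally show ?thesis
      using pig(2) by (subst winding_number_valid_path[OF vg]) auto
  qed
  have \<Gamma>': "valid_path \<Gamma>" "pathfinish \<Gamma> = pathstart \<Gamma>" "winding_number \<Gamma> 1 = 1"
    and out: "0 \<in> outside (path_image \<Gamma>)" "- complex_of_real Q \<in> outside (path_image \<Gamma>)" "1 \<in> inside (path_image \<Gamma>)"
    using \<Gamma> unfolding contour_around_1_def Q_def by auto
  have \<Gamma>0: "winding_number \<Gamma> 0 = 0" "winding_number \<Gamma> (- of_real Q) = 0"
    using out \<Gamma>' by (auto intro!: winding_number_zero_in_outside valid_path_imp_path)
  have \<Gamma>pi: "path_image \<Gamma> \<subseteq> UNIV - ?P"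
    using out inside_no_overlap[of "path_image \<Gamma>"] outside_no_overlap[of "path_image \<Gamma>"] by blast
  have f': "f holomorphic_on UNIV - ?P" using f unfolding Q_def .
  have "contour_integral \<Gamma> f = 2 * pi * \<i> * (\<Sum>z\<in>?P. winding_number \<Gamma> z * residue f z)"
    by (rule Residue_theorem[OF open_UNIV connected_UNIV _ f' \<Gamma>'(1,2) \<Gamma>pi]) auto
  moreover have "contour_integral g f = 2 * pi * \<i> * (\<Sum>z\<in>?P. winding_number g z * residue f z)"
    by (rule Residue_theorem[OF open_UNIV connected_UNIV _ f' vg lg pig(2)]) auto
  moreover have "(\<Sum>z\<in>?P. winding_number \<Gamma> z * residue f z) = (\<Sum>z\<in>?P. winding_number g z * residue f z)"
    by (rule sum.cong) (use w0 w1 \<Gamma>0 \<Gamma>'(3) in auto)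
  ultimately show ?thesis using split[OF f'] by simp
qed

section \<open>The kernel as an integral over the lens\<close>

text \<open>
  The kernel's contour integral over one arc, normalised at the saddle. The last factor is the
  derivative of \<open>ell x1 e\<close>, that is, \<open>dw/w\<close>.
\<close>

definition phase_integral :: "real \<Rightarrow> real \<Rightarrow> real \<Rightarrow> real \<Rightarrow> real \<Rightarrow> complex \<Rightarrow> complex" where
  "phase_integral x1 x3 A n B e = integral {0..1} (\<lambda>\<tau>.
     exp (of_real A * ell x1 e \<tau> - of_real n * ell (-1) e \<tau> - of_real B * ell x3 e \<tau>)
     * (of_real (x1 - 1) * e / (lin x1 e \<tau> * lin 1 e \<tau>)))"

text \<open>
  The constant factors of the kernel are precisely the values of the integrand at the saddle,
  so they cancel against the values split off in \<open>lens_arc_ell\<close>. Of the power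
  \<open>w powi (x - y + n - 1)\<close> one factor \<open>1/w\<close> is kept to turn \<open>dw\<close> into the logarithmic
  derivative \<open>dw/w\<close>.
\<close>

lemma S_bar_eq_phase_integral:
  fixes p \<rho> :: real and a b t n :: nat and x y :: int and e :: complex
  assumes p: "0 < p" "p < 1" and \<Gamma>: "contour_around_1 p \<Gamma>"
    and th: "theta p \<rho> a b > 0" "p - (1 - p) * theta p \<rho> a b > 0"
    and e: "Im e > 0" "Re e \<ge> 0"
  defines "\<Theta> \<equiv> theta_hat p \<rho> a b" and "Q \<equiv> (1 - p) / p"
  defines "x1 \<equiv> (2 - \<Theta>) / \<Theta>" and "x3 \<equiv> (Q + 2 - \<Theta>) / (Q + \<Theta>)"
  defines "A \<equiv> real_of_int (x - y) + real n" and "B \<equiv> real t - real (kap_sum a b n)"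
  shows "of_real ((1 + theta p \<rho> a b) ^ t) * S_bar p \<rho> a b \<Gamma> t n y x
    = 1 / (2 * of_real pi * \<i>) * (phase_integral x1 x3 A n B e - phase_integral x1 x3 A n B (cnj e))"
proof -
  define \<theta> where "\<theta> = theta p \<rho> a b"
  define m where "m = x - y"
  define \<kappa> where "\<kappa> = kap_sum a b n"
  have Q: "Q > 0" unfolding Q_def using p by simp
  have \<Theta>: "0 < \<Theta>" "\<Theta> < 1"
  proof -
    show "0 < \<Theta>" unfolding \<Theta>_def theta_hat_def using p th by simp
    show "\<Theta> < 1" unfolding \<Theta>_def theta_hat_def using p th by (simp add: field_simps)
  qed
  have pos: "complex_of_real \<Theta> \<noteq> 0" "complex_of_real (1 - \<Theta>) \<noteq> 0" "complex_of_real (1 + \<theta>) \<noteq> 0"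
    "complex_of_real (Q + \<Theta>) \<noteq> 0" "complex_of_real (1 - p) \<noteq> 0" "complex_of_real p \<noteq> 0"
    using \<Theta> th p Q unfolding \<theta>_def by (auto simp only: of_real_eq_0_iff)
  define f where "f w = w powi (m + int n - 1) / (of_real \<Theta> powi m * (1 - w) ^ n)
         * (1 + of_real p * w / of_real (1 - p)) powi (- int t)
         * ((of_real (1 - p) + of_real p * w) / (of_real (1 - p) + of_real p * of_real \<Theta>)) ^ \<kappa>" for w :: complex
  have aff: "of_real (1 - p) + of_real p * w = of_real p * (of_real Q + w)" for w :: complex
    using pos unfolding Q_def by (simp add: field_simps)
  have aff2: "1 + of_real p * w / of_real (1 - p) = of_real p / of_real (1 - p) * (of_real Q + w)" for w :: complex
    using pos unfolding Q_def by (simp add: field_simps)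
  have coef: "of_real p / of_real (1 - p) * of_real (Q + \<Theta>) = complex_of_real (1 + \<theta>)"
  proof -
    have "p / (1 - p) * (Q + \<Theta>) = 1 + \<theta>" unfolding Q_def \<Theta>_def theta_hat_def \<theta>_def using p by (simp add: field_simps)
    then show ?thesis by (metis of_real_divide of_real_mult)
  qed
  have f: "f holomorphic_on UNIV - {0, 1, - complex_of_real ((1 - p) / p)}"
  proof -
    have "1 + of_real p * w / of_real (1 - p) \<noteq> 0" if "w \<noteq> - complex_of_real ((1 - p) / p)" for w
    proof -
      have "of_real Q + w \<noteq> 0" using that unfolding Q_def by (metis add_eq_0_iff)
      then show ?thesis unfolding aff2 using pos by simp
    qed
    moreover have "of_real (1 - p) + of_real p * of_real \<Theta> \<noteq> (0::complex)"
      using pos unfolding aff of_real_add[symmetric] by simp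
    ultimately show ?thesis
      unfolding f_def using pos by (intro holomorphic_intros) auto
  qed
  have arc: "- (((1 - of_real \<Theta>) / of_real \<Theta>) ^ n) * of_real (1 + \<theta>) ^ t * contour_integral (lens_arc \<Theta> d) f
    = - phase_integral x1 x3 A n B d" if d: "Im d \<noteq> 0" for d
  proof -
    have pt: "((1 - of_real \<Theta>) / of_real \<Theta>) ^ n * of_real (1 + \<theta>) ^ t
        * (f (lens_arc \<Theta> d \<tau>) * (of_real (2 * (1 - \<Theta>)) * d / (lin 1 d \<tau>)^2))
      = exp (of_real A * ell x1 d \<tau> - of_real n * ell (-1) d \<tau> - of_real B * ell x3 d \<tau>)
         * (of_real (x1 - 1) * d / (lin x1 d \<tau> * lin 1 d \<tau>))" for \<tau>
    proof -
      define w where "w = lens_arc \<Theta> d \<tau>"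
      define l1 l2 l3 where "l1 = ell x1 d \<tau>" and "l2 = ell (-1) d \<tau>" and "l3 = ell x3 d \<tau>"
      have w: "w = of_real \<Theta> * exp l1" "1 - w = of_real (1 - \<Theta>) * exp l2" "of_real Q + w = of_real (Q + \<Theta>) * exp l3"
        using lens_arc_ell[OF \<Theta> d Q, of \<tau>] unfolding w_def l1_def l2_def l3_def x1_def x3_def by auto
      have w0: "w \<noteq> 0" unfolding w(1) using \<Theta> by simp
      have x1: "x1 \<noteq> 0" unfolding x1_def using \<Theta> by simp
      have nz: "lin 1 d \<tau> \<noteq> 0" "lin x1 d \<tau> \<noteq> 0" using d x1 by (simp_all add: lin_nonzero)
      have w': "w = of_real \<Theta> * (lin x1 d \<tau> / lin 1 d \<tau>)"
        unfolding w(1) l1_def exp_ell[OF x1 d] ..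
      have "complex_of_real (2 * (1 - \<Theta>)) = of_real \<Theta> * of_real (x1 - 1)"
      proof -
        have "2 * (1 - \<Theta>) = \<Theta> * (x1 - 1)" unfolding x1_def using \<Theta> by (simp add: field_simps)
        then show ?thesis by (simp only: of_real_mult)
      qed
      then have dw: "of_real (2 * (1 - \<Theta>)) * d / (lin 1 d \<tau>)^2 = w * (of_real (x1 - 1) * d / (lin x1 d \<tau> * lin 1 d \<tau>))"
        unfolding w' using nz by (simp add: power2_eq_square)
      have p1: "w powi (m + int n - 1) * w = of_real \<Theta> powi m * of_real \<Theta> ^ n * exp (of_real A * l1)"
      proof -
        have "w powi (m + int n - 1) * w = w powi (m + int n)"
          using power_int_add_1[of w "m + int n - 1"] w0 by simp
        also have "\<dots> = of_real \<Theta> powi (m + int n) * exp (of_int (m + int n) * l1)"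
          unfolding w(1) power_int_mult_distrib exp_power_int ..
        also have "of_real \<Theta> powi (m + int n) = of_real \<Theta> powi m * complex_of_real \<Theta> ^ n"
          using pos by (simp add: power_int_add)
        also have "complex_of_int (m + int n) = of_real A" unfolding A_def m_def by simp
        finally show ?thesis .
      qed
      have p2: "(1 - w)^n = of_real (1 - \<Theta>)^n * exp (of_real n * l2)"
        unfolding w(2) power_mult_distrib by (simp add: exp_of_nat_mult)
      have p3: "(1 + of_real p * w / of_real (1 - p)) powi (- int t) = inverse (of_real (1 + \<theta>)^t) * exp (- of_real t * l3)"
      proof -
        have "1 + of_real p * w / of_real (1 - p) = of_real (1 + \<theta>) * exp l3"
          unfolding aff2 w(3) coef[symmetric] by simp
        then show ?thesis
          by (simp only: power_int_mult_distrib exp_power_int) (simp add: power_int_minus)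
      qed
      have p4: "((of_real (1 - p) + of_real p * w) / (of_real (1 - p) + of_real p * of_real \<Theta>)) ^ \<kappa> = exp (of_real \<kappa> * l3)"
      proof -
        have "(of_real (1 - p) + of_real p * w) / (of_real (1 - p) + of_real p * of_real \<Theta>) = exp l3"
          unfolding aff w(3) of_real_add[symmetric] using pos by simp
        then show ?thesis by (simp add: exp_of_nat_mult)
      qed
      have "f w * w = (w powi (m + int n - 1) * w) / (of_real \<Theta> powi m * (1 - w) ^ n)
         * (1 + of_real p * w / of_real (1 - p)) powi (- int t)
         * ((of_real (1 - p) + of_real p * w) / (of_real (1 - p) + of_real p * of_real \<Theta>)) ^ \<kappa>"
        unfolding f_def by simp
      also have "\<dots> = (of_real \<Theta> powi m * of_real \<Theta> ^ n * exp (of_real A * l1)) / (of_real \<Theta> powi m * (of_real (1 - \<Theta>)^n * exp (of_real n * l2)))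
         * (inverse (of_real (1 + \<theta>)^t) * exp (- of_real t * l3)) * exp (of_real \<kappa> * l3)"
        unfolding p1 p2 p3 p4 ..
      also have "\<dots> = of_real \<Theta> ^ n / (of_real (1 - \<Theta>)^n * of_real (1 + \<theta>)^t)
          * (exp (of_real A * l1) / exp (of_real n * l2) * exp (- of_real t * l3) * exp (of_real \<kappa> * l3))"
        using pos by (simp add: divide_inverse)
      also have "exp (of_real A * l1) / exp (of_real n * l2) * exp (- of_real t * l3) * exp (of_real \<kappa> * l3)
          = exp (of_real A * l1 - of_real n * l2 - of_real B * l3)"
        unfolding exp_diff[symmetric] exp_add[symmetric] B_def \<kappa>_def by (simp add: algebra_simps)
      finally have fw: "f w * w = of_real \<Theta> ^ n / (of_real (1 - \<Theta>)^n * of_real (1 + \<theta>)^t)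
          * exp (of_real A * l1 - of_real n * l2 - of_real B * l3)" .
      have "((1 - of_real \<Theta>) / of_real \<Theta>) ^ n * of_real (1 + \<theta>) ^ t * (f w * w)
          = exp (of_real A * l1 - of_real n * l2 - of_real B * l3)"
        unfolding fw using pos by (simp add: power_divide)
      then show ?thesis
        unfolding w_def[symmetric] dw l1_def l2_def l3_def by (simp only: mult.assoc[symmetric])
    qed
    show ?thesis
      unfolding contour_integral_lens_arc[OF d] phase_integral_def pt[symmetric] integral_mult_right by simp
  qed
  have ime: "Im e \<noteq> 0" "Im (cnj e) \<noteq> 0" using e by auto
  have "of_real ((1 + \<theta>) ^ t) * S_bar p \<rho> a b \<Gamma> t n y x
    = 1 / (2 * of_real pi * \<i>) * (- (((1 - of_real \<Theta>) / of_real \<Theta>) ^ n) * of_real (1 + \<theta>) ^ t * contour_integral \<Gamma> f)"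
    unfolding S_bar_def Let_def f_def m_def \<kappa>_def \<Theta>_def by simp
  also have "contour_integral \<Gamma> f = contour_integral (lens_arc \<Theta> (cnj e)) f - contour_integral (lens_arc \<Theta> e) f"
    by (rule contour_integral_lens[OF p \<Gamma> \<Theta> e f])
  also have "- (((1 - of_real \<Theta>) / of_real \<Theta>) ^ n) * of_real (1 + \<theta>) ^ t *
      (contour_integral (lens_arc \<Theta> (cnj e)) f - contour_integral (lens_arc \<Theta> e) f)
     = phase_integral x1 x3 A n B e - phase_integral x1 x3 A n B (cnj e)"
    unfolding right_diff_distrib arc[OF ime(1)] arc[OF ime(2)] by simp
  finally show ?thesis unfolding \<theta>_def .
qed

section \<open>Steep descent along the arcs\<close>

lemma lipschitz_at_0:
  assumes G: "G holomorphic_on U" "open U" "complex_of_real ` {0..1} \<subseteq> U"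
  shows "\<exists>C\<ge>0. \<forall>\<tau>\<in>{0..1}. norm (G (of_real \<tau>) - G 0) \<le> C * \<tau>"
proof -
  have seg: "closed_segment 0 1 = complex_of_real ` {0..1}"
    by (auto simp: closed_segment_def scaleR_conv_of_real)
  have "deriv G holomorphic_on U" using G by (intro holomorphic_deriv)
  then have "continuous_on (closed_segment 0 1) (deriv G)"
    using G seg by (metis holomorphic_on_imp_continuous_on continuous_on_subset)
  then have "bounded (deriv G ` closed_segment 0 1)"
    by (intro compact_imp_bounded compact_continuous_image) auto
  then obtain C where C: "\<forall>z\<in>closed_segment 0 1. norm (deriv G z) \<le> C" by (auto simp: bounded_iff)
  have "norm (G (of_real \<tau>) - G 0) \<le> \<bar>C\<bar> * \<tau>" if "\<tau> \<in> {0..1}" for \<tau>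
  proof -
    have "norm (G (of_real \<tau>) - G 0) \<le> \<bar>C\<bar> * norm (of_real \<tau> - (0::complex))"
    proof (rule field_differentiable_bound[OF convex_closed_segment])
      fix z :: complex assume z: "z \<in> closed_segment 0 1"
      then have "z \<in> U" using G seg by blast
      then show "(G has_field_derivative deriv G z) (at z within closed_segment 0 1)"
        using holomorphic_derivI[OF G(1,2)] has_field_derivative_at_within by blast
      show "norm (deriv G z) \<le> \<bar>C\<bar>" using C z by force
    qed (use that seg in auto)
    then show ?thesis using that by simp
  qed
  then show ?thesis by (intro exI[of _ "\<bar>C\<bar>"]) auto
qed

text \<open>
  Taylor expansion at \<open>0\<close> to one order, with a remainder valid on all of \<open>[0,1]\<close>: if the
  derivative is \<open>\<tau>\<^sup>k G(\<tau>)\<close>, then replacing \<open>G\<close> by \<open>G 0\<close> costs a factor \<open>\<tau>\<close>.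
\<close>

lemma primitive_order:
  fixes f :: "real \<Rightarrow> complex"
  assumes G: "G holomorphic_on U" "open U" "complex_of_real ` {0..1} \<subseteq> U"
    and f: "\<And>\<tau>. \<tau> \<in> {0..1} \<Longrightarrow> (f has_vector_derivative of_real (\<tau>^k) * G (of_real \<tau>)) (at \<tau> within {0..1})"
    and f0: "f 0 = 0"
  shows "\<exists>C\<ge>0. \<forall>\<tau>\<in>{0..1}. norm (f \<tau> - of_real (\<tau>^Suc k / Suc k) * G 0) \<le> C * \<tau>^(k + 2)"
proof -
  obtain C where C: "C \<ge> 0" "\<forall>\<tau>\<in>{0..1}. norm (G (of_real \<tau>) - G 0) \<le> C * \<tau>"
    using lipschitz_at_0[OF G] by blast
  have "norm (f s - of_real (s^Suc k / Suc k) * G 0) \<le> C * s^(k + 2)" if s: "s \<in> {0..1}" for s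
  proof -
    define h where "h \<tau> = f \<tau> - of_real (\<tau>^Suc k / Suc k) * G 0" for \<tau>
    have "norm (h s - h 0) \<le> C * s^(k + 1) * norm (s - 0)"
    proof (rule differentiable_bound[OF convex_real_interval(5)[of 0 s]])
      fix \<tau> assume \<tau>: "\<tau> \<in> {0..s}"
      have d: "((\<lambda>\<tau>. of_real (\<tau>^Suc k / Suc k)) has_vector_derivative complex_of_real (\<tau>^k)) (at \<tau> within {0..s})"
      proof -
        have "((\<lambda>\<tau>::real. \<tau>^Suc k / Suc k) has_real_derivative \<tau>^k) (at \<tau> within {0..s})"
          by (auto intro!: derivative_eq_intros simp del: power_Suc)
        then show ?thesis
          unfolding has_real_derivative_iff_has_vector_derivative
          by (rule bounded_linear.has_vector_derivative[OF bounded_linear_of_real])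
      qed
      have "(h has_vector_derivative (of_real (\<tau>^k) * G (of_real \<tau>) - of_real (\<tau>^k) * G 0)) (at \<tau> within {0..s})"
        unfolding h_def
        by (intro has_vector_derivative_diff has_vector_derivative_mult_left d has_vector_derivative_within_subset[OF f])
           (use \<tau> s in auto)
      then show "(h has_derivative (\<lambda>r. r *\<^sub>R (of_real (\<tau>^k) * (G (of_real \<tau>) - G 0)))) (at \<tau> within {0..s})"
        unfolding has_vector_derivative_def by (simp add: right_diff_distrib)
      have "norm (of_real (\<tau>^k) * (G (of_real \<tau>) - G 0)) \<le> s^k * (C * s)"
      proof -
        have "norm (G (of_real \<tau>) - G 0) \<le> C * \<tau>" using C(2) \<tau> s by auto
        also have "\<dots> \<le> C * s" using C(1) \<tau> by (intro mult_left_mono) auto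
        finally show ?thesis using \<tau> s C(1) unfolding norm_mult
          by (intro mult_mono) (auto simp: norm_power intro!: power_mono)
      qed
      then have n: "norm (of_real (\<tau>^k) * (G (of_real \<tau>) - G 0)) \<le> C * s^(k + 1)" by (simp add: mult_ac)
      show "onorm (\<lambda>r. r *\<^sub>R (of_real (\<tau>^k) * (G (of_real \<tau>) - G 0))) \<le> C * s^(k + 1)"
        using n by (intro onorm_le) (simp add: mult.commute[of _ "\<bar>_\<bar>"] mult_left_mono)
    qed (use s in auto)
    then show ?thesis using s f0 by (simp add: h_def power_add power2_eq_square mult_ac)
  qed
  with C show ?thesis by blast
qed

definition ell_combo :: "real \<Rightarrow> real \<Rightarrow> real \<Rightarrow> real \<Rightarrow> real \<Rightarrow> complex \<Rightarrow> real \<Rightarrow> complex" where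
  "ell_combo x1 x3 \<alpha>1 \<alpha>2 \<alpha>3 e \<tau> = of_real \<alpha>1 * ell x1 e \<tau> + of_real \<alpha>2 * ell (-1) e \<tau> + of_real \<alpha>3 * ell x3 e \<tau>"

definition denom4 :: "real \<Rightarrow> real \<Rightarrow> complex \<Rightarrow> complex \<Rightarrow> complex" where
  "denom4 x1 x3 e z = ((1 - z) + of_real x1 * (z * e)) * ((1 - z) + of_real x3 * (z * e)) * ((1 - z) - z * e) * ((1 - z) + z * e)"

lemma denom4_lin: "denom4 x1 x3 e (of_real \<tau>) = lin x1 e \<tau> * lin x3 e \<tau> * lin (-1) e \<tau> * lin 1 e \<tau>"
  unfolding denom4_def lin_def by simp

lemma denom4_region:
  assumes "x1 \<noteq> 0" "x3 \<noteq> 0" "Im e \<noteq> 0"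
  shows "open {z. denom4 x1 x3 e z \<noteq> 0}" "complex_of_real ` {0..1} \<subseteq> {z. denom4 x1 x3 e z \<noteq> 0}"
    "denom4 x1 x3 e 0 = 1"
proof -
  show "open {z. denom4 x1 x3 e z \<noteq> 0}" unfolding denom4_def
    by (intro open_Collect_neq continuous_intros)
  show "complex_of_real ` {0..1} \<subseteq> {z. denom4 x1 x3 e z \<noteq> 0}"
    using assms by (auto simp: denom4_lin lin_nonzero)
qed (simp add: denom4_def)

text \<open>
  Over the common denominator the numerator is homogeneous of degree two in \<open>1 - \<tau>\<close> and
  \<open>\<tau> e\<close>. The order to which a phase vanishes at the saddle can be read off from \<open>c0\<close>, \<open>c1\<close>, \<open>c2\<close>.
\<close>

lemma ell_combo_deriv:
  fixes x1 x3 \<alpha>1 \<alpha>2 \<alpha>3 :: real and e :: complex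
  assumes "x1 \<noteq> 0" "x3 \<noteq> 0" "Im e \<noteq> 0"
  defines "c0 \<equiv> \<alpha>1 * (x1 - 1) - 2 * \<alpha>2 + \<alpha>3 * (x3 - 1)"
    and "c1 \<equiv> \<alpha>1 * (x1 - 1) * (x3 - 1) - 2 * \<alpha>2 * (x1 + x3) + \<alpha>3 * (x3 - 1) * (x1 - 1)"
    and "c2 \<equiv> - \<alpha>1 * (x1 - 1) * x3 - 2 * \<alpha>2 * x1 * x3 - \<alpha>3 * (x3 - 1) * x1"
  shows "(ell_combo x1 x3 \<alpha>1 \<alpha>2 \<alpha>3 e has_vector_derivative
     e * (of_real c0 * (1 - of_real \<tau>)^2 + of_real c1 * (1 - of_real \<tau>) * (of_real \<tau> * e) + of_real c2 * (of_real \<tau> * e)^2)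
      / denom4 x1 x3 e (of_real \<tau>)) (at \<tau> within S)"
proof -
  let ?a = "lin x1 e \<tau>" and ?b = "lin x3 e \<tau>" and ?c = "lin (-1) e \<tau>" and ?d = "lin 1 e \<tau>"
  have nz: "?a \<noteq> 0" "?b \<noteq> 0" "?c \<noteq> 0" "?d \<noteq> 0" using assms(1-3) by (simp_all add: lin_nonzero)
  have "(ell_combo x1 x3 \<alpha>1 \<alpha>2 \<alpha>3 e has_vector_derivative
     of_real \<alpha>1 * (of_real (x1 - 1) * e / (?a * ?d)) + of_real \<alpha>2 * (of_real (- 1 - 1) * e / (?c * ?d))
      + of_real \<alpha>3 * (of_real (x3 - 1) * e / (?b * ?d))) (at \<tau> within S)"
    unfolding ell_combo_def using assms(1-3)
    by (intro has_vector_derivative_add has_vector_derivative_mult_right ell_deriv) auto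
  also have "of_real \<alpha>1 * (of_real (x1 - 1) * e / (?a * ?d)) + of_real \<alpha>2 * (of_real (- 1 - 1) * e / (?c * ?d))
      + of_real \<alpha>3 * (of_real (x3 - 1) * e / (?b * ?d))
     = e * (of_real \<alpha>1 * of_real (x1 - 1) * ?b * ?c + of_real \<alpha>2 * of_real (- 1 - 1) * ?a * ?b + of_real \<alpha>3 * of_real (x3 - 1) * ?a * ?c) / (?a * ?b * ?c * ?d)"
  proof -
    have "w1 * (u1 * e / (a * d)) + w2 * (u2 * e / (c * d)) + w3 * (u3 * e / (b * d))
        = e * (w1 * u1 * b * c + w2 * u2 * a * b + w3 * u3 * a * c) / (a * b * c * d)"
      if "a \<noteq> 0" "b \<noteq> 0" "c \<noteq> 0" "d \<noteq> 0" for a b c d u1 u2 u3 w1 w2 w3 :: complex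
      using that by (simp add: divide_simps) (simp add: algebra_simps)
    from this[OF nz] show ?thesis .
  qed
  also have "of_real \<alpha>1 * of_real (x1 - 1) * ?b * ?c + of_real \<alpha>2 * of_real (- 1 - 1) * ?a * ?b + of_real \<alpha>3 * of_real (x3 - 1) * ?a * ?c
      = of_real c0 * (1 - of_real \<tau>)^2 + of_real c1 * (1 - of_real \<tau>) * (of_real \<tau> * e) + of_real c2 * (of_real \<tau> * e)^2"
    unfolding lin_def c0_def c1_def c2_def by (simp add: algebra_simps power2_eq_square)
  finally show ?thesis unfolding denom4_lin .
qed

lemma ell_combo_0 [simp]: "ell_combo x1 x3 \<alpha>1 \<alpha>2 \<alpha>3 e 0 = 0"
  by (simp add: ell_combo_def)

lemma ell_combo_order:
  fixes x1 x3 \<alpha>1 \<alpha>2 \<alpha>3 :: real and e :: complex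
  assumes x: "x1 \<noteq> 0" "x3 \<noteq> 0" "Im e \<noteq> 0"
  defines "c0 \<equiv> \<alpha>1 * (x1 - 1) - 2 * \<alpha>2 + \<alpha>3 * (x3 - 1)"
    and "c1 \<equiv> \<alpha>1 * (x1 - 1) * (x3 - 1) - 2 * \<alpha>2 * (x1 + x3) + \<alpha>3 * (x3 - 1) * (x1 - 1)"
    and "c2 \<equiv> - \<alpha>1 * (x1 - 1) * x3 - 2 * \<alpha>2 * x1 * x3 - \<alpha>3 * (x3 - 1) * x1"
  shows "\<exists>C\<ge>0. \<forall>\<tau>\<in>{0..1}. norm (ell_combo x1 x3 \<alpha>1 \<alpha>2 \<alpha>3 e \<tau> - of_real c0 * (of_real \<tau> * e)) \<le> C * \<tau>^2"
    and "c0 = 0 \<Longrightarrow> \<exists>C\<ge>0. \<forall>\<tau>\<in>{0..1}. norm (ell_combo x1 x3 \<alpha>1 \<alpha>2 \<alpha>3 e \<tau> - of_real (c1/2) * (of_real \<tau> * e)^2) \<le> C * \<tau>^3"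
    and "c0 = 0 \<Longrightarrow> c1 = 0 \<Longrightarrow> \<exists>C\<ge>0. \<forall>\<tau>\<in>{0..1}. norm (ell_combo x1 x3 \<alpha>1 \<alpha>2 \<alpha>3 e \<tau> - of_real (c2/3) * (of_real \<tau> * e)^3) \<le> C * \<tau>^4"
proof -
  let ?L = "ell_combo x1 x3 \<alpha>1 \<alpha>2 \<alpha>3 e"
  let ?U = "{z. denom4 x1 x3 e z \<noteq> 0}"
  note D = ell_combo_deriv[OF x, of \<alpha>1 \<alpha>2 \<alpha>3, folded c0_def c1_def c2_def]
  have hd: "denom4 x1 x3 e holomorphic_on ?U" unfolding denom4_def by (intro holomorphic_intros)
  show "\<exists>C\<ge>0. \<forall>\<tau>\<in>{0..1}. norm (?L \<tau> - of_real c0 * (of_real \<tau> * e)) \<le> C * \<tau>^2"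
  proof -
    let ?G = "\<lambda>z. e * (of_real c0 * (1 - z)^2 + of_real c1 * (1 - z) * (z * e) + of_real c2 * (z * e)^2) / denom4 x1 x3 e z"
    have "\<exists>C\<ge>0. \<forall>\<tau>\<in>{0..1}. norm (?L \<tau> - of_real (\<tau>^Suc 0 / Suc 0) * ?G 0) \<le> C * \<tau>^(0 + 2)"
      by (rule primitive_order[OF _ denom4_region(1,2)[OF x]])
         (use D in \<open>auto intro!: holomorphic_intros hd\<close>)
    then show ?thesis using denom4_region(3)[OF x] by (simp add: mult_ac power2_eq_square)
  qed
  show "\<exists>C\<ge>0. \<forall>\<tau>\<in>{0..1}. norm (?L \<tau> - of_real (c1/2) * (of_real \<tau> * e)^2) \<le> C * \<tau>^3" if "c0 = 0"
  proof -
    let ?G = "\<lambda>z. e^2 * (of_real c1 * (1 - z) + of_real c2 * (z * e)) / denom4 x1 x3 e z"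
    have "\<exists>C\<ge>0. \<forall>\<tau>\<in>{0..1}. norm (?L \<tau> - of_real (\<tau>^Suc 1 / Suc 1) * ?G 0) \<le> C * \<tau>^(1 + 2)"
    proof (rule primitive_order[OF _ denom4_region(1,2)[OF x]])
      fix \<tau> :: real
      show "(?L has_vector_derivative of_real (\<tau>^1) * ?G (of_real \<tau>)) (at \<tau> within {0..1})"
        using D[of \<tau> "{0..1}"] that by (simp add: algebra_simps power2_eq_square)
    qed (auto intro!: holomorphic_intros hd)
    then show ?thesis using denom4_region(3)[OF x] by (simp add: mult_ac power2_eq_square numeral_3_eq_3)
  qed
  show "\<exists>C\<ge>0. \<forall>\<tau>\<in>{0..1}. norm (?L \<tau> - of_real (c2/3) * (of_real \<tau> * e)^3) \<le> C * \<tau>^4" if "c0 = 0" "c1 = 0"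
  proof -
    let ?G = "\<lambda>z. e^3 * of_real c2 / denom4 x1 x3 e z"
    have "\<exists>C\<ge>0. \<forall>\<tau>\<in>{0..1}. norm (?L \<tau> - of_real (\<tau>^Suc 2 / Suc 2) * ?G 0) \<le> C * \<tau>^(2 + 2)"
    proof (rule primitive_order[OF _ denom4_region(1,2)[OF x]])
      fix \<tau> :: real
      show "(?L has_vector_derivative of_real (\<tau>^2) * ?G (of_real \<tau>)) (at \<tau> within {0..1})"
        using D[of \<tau> "{0..1}"] that by (simp add: algebra_simps power2_eq_square power3_eq_cube)
    qed (auto intro!: holomorphic_intros hd)
    then show ?thesis using denom4_region(3)[OF x] by (simp add: mult_ac power3_eq_cube)
  qed
qed

text \<open>
  The quantity is the real part of the derivative of the cubic phase divided by \<open>\<tau>\<^sup>2\<close>. Write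
  \<open>s = 1 - \<tau>\<close>, \<open>c = Re e\<close>, \<open>P = x1 x3\<close>. Multiplied by \<open>|denom4|\<^sup>2\<close> it becomes
  \<open>(4 c\<^sup>3 - 3 c) s\<^sup>4 + (x1 + x3) (2 c\<^sup>2 - 1) s\<^sup>3 \<tau> + (P - 1) c s\<^sup>2 \<tau>\<^sup>2 - (x1 + x3) s \<tau>\<^sup>3 - P c \<tau>\<^sup>4\<close>.
  For small \<open>c > 0\<close> all terms but the middle one are negative, and \<open>c = 1/(2 P)\<close> makes the middle
  one so small that it is absorbed by its two neighbours. The case \<open>c = 0\<close> is the full circle,
  on which the phase also descends but fails to do so at cubic order near the saddle.
\<close>

lemma Re_cube_over_denom4:
  fixes x1 x3 :: real
  assumes x: "x1 > 1" "x3 > 1" and e: "norm e = 1" "Re e = 1 / (2 * x1 * x3)" "Im e \<noteq> 0" and \<tau>: "\<tau> \<in> {0..1}"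
  shows "Re (e^3 / denom4 x1 x3 e (of_real \<tau>)) \<le> - (1 / (16 * (x1 * x3)^3))"
proof -
  define c where "c = Re e"
  define s where "s = 1 - \<tau>"
  define P where "P = x1 * x3"
  have s: "s \<ge> 0" "\<tau> \<ge> 0" "s + \<tau> = 1" using \<tau> by (auto simp: s_def)
  have P: "P > 1" unfolding P_def using x less_1_mult by blast
  have Pc: "P * c = 1/2" unfolding c_def P_def e(2) using x by simp
  have c: "0 < c" "c \<le> 1/2" using P e(2) unfolding c_def P_def by (auto simp: field_simps)
  have ec: "e * cnj e = 1" using complex_norm_square[of e] e(1) by simp
  let ?D = "denom4 x1 x3 e (of_real \<tau>)"
  let ?S = "complex_of_real s" and ?T = "complex_of_real \<tau>"
  have "e^3 * cnj ?D = e^3 * ((?S + of_real x1 * (?T * cnj e)) * (?S + of_real x3 * (?T * cnj e)) * (?S - ?T * cnj e) * (?S + ?T * cnj e))"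
    unfolding denom4_def s_def by simp
  also have "\<dots> = e^3 * ?S^4 + of_real (x1 + x3) * e^2 * (?S^3 * ?T) + of_real (x1 * x3 - 1) * e * (?S^2 * ?T^2)
     - of_real (x1 + x3) * (?S * ?T^3) - of_real (x1 * x3) * cnj e * ?T^4"
    unfolding of_real_add of_real_mult of_real_diff of_real_1 using ec by algebra
  finally have "Re (e^3 * cnj ?D) = Re (e^3) * s^4 + (x1 + x3) * Re (e^2) * (s^3 * \<tau>) + (P - 1) * c * (s^2 * \<tau>^2)
     - (x1 + x3) * (s * \<tau>^3) - P * c * \<tau>^4"
    unfolding of_real_power[symmetric] of_real_mult[symmetric] by (simp add: c_def P_def)
  also have "Re (e^2) = 2 * c^2 - 1"
    using e(1) unfolding cmod_def c_def by (simp add: power2_eq_square)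
  also have "Re (e^3) = 4 * c^3 - 3 * c"
  proof -
    have "(Im e)^2 = 1 - c^2" using e(1) unfolding cmod_def c_def by simp
    moreover have "Re (e^3) = c * c^2 - 3 * c * (Im e)^2"
      unfolding c_def by (simp add: power2_eq_square power3_eq_cube algebra_simps)
    ultimately have "Re (e^3) = c * c^2 - 3 * c * (1 - c^2)" by simp
    then show ?thesis by algebra
  qed
  finally have G: "Re (e^3 * cnj ?D) = (4 * c^3 - 3 * c) * s^4 + (x1 + x3) * (2 * c^2 - 1) * (s^3 * \<tau>) + (P - 1) * c * (s^2 * \<tau>^2)
     - (x1 + x3) * (s * \<tau>^3) - P * c * \<tau>^4" .
  have c2: "c^2 \<le> 1/4" using power_mono[of c "1/2" 2] c by (simp add: power2_eq_square)
  have t1: "(4 * c^3 - 3 * c) * s^4 \<le> - c * s^4"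
  proof (rule mult_right_mono)
    have "4 * c^3 = 4 * c^2 * c" by (simp add: power2_eq_square power3_eq_cube)
    also have "\<dots> \<le> 1 * c" using c c2 by (intro mult_right_mono) auto
    finally show "4 * c^3 - 3 * c \<le> - c" using c by linarith
  qed simp
  have t2: "(x1 + x3) * (2 * c^2 - 1) * (s^3 * \<tau>) \<le> - 1 * (s^3 * \<tau>)"
  proof (rule mult_right_mono)
    have "(x1 + x3) * (2 * c^2 - 1) \<le> (x1 + x3) * (- 1/2)" using x c2 by (intro mult_left_mono) auto
    also have "(x1 + x3) * (- 1/2) \<le> - 1" using x by simp
    finally show "(x1 + x3) * (2 * c^2 - 1) \<le> - 1" .
  qed (use s in simp)
  have t3: "(P - 1) * c * (s^2 * \<tau>^2) \<le> 1/2 * (s^2 * \<tau>^2)"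
    using Pc c by (intro mult_right_mono) (auto simp: algebra_simps)
  have t4: "(x1 + x3) * (s * \<tau>^3) \<ge> 1 * (s * \<tau>^3)" using x s by (intro mult_right_mono) auto
  have t5: "s^2 * \<tau>^2 \<le> s^3 * \<tau> + s * \<tau>^3"
  proof -
    have "0 \<le> (s * \<tau>) * (s - \<tau>)^2" using s by simp
    moreover have "0 \<le> s^2 * \<tau>^2" by simp
    moreover have "(s * \<tau>) * (s - \<tau>)^2 = s^3 * \<tau> + s * \<tau>^3 - 2 * (s^2 * \<tau>^2)" by algebra
    ultimately show ?thesis by linarith
  qed
  have t6: "P * c * \<tau>^4 \<ge> c * \<tau>^4" using Pc c by (intro mult_right_mono; simp only: Pc; simp)
  have t7: "0 \<le> s^3 * \<tau> + s * \<tau>^3" using s by simp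
  have "Re (e^3 * cnj ?D) \<le> - c * (s^4 + \<tau>^4)"
    unfolding G distrib_left using t1 t2 t3 t4 t5 t6 t7 by linarith
  also have "\<dots> \<le> - c * (1/8)"
  proof -
    have "\<tau> = 1 - s" using s by linarith
    \<comment> \<open>On \<open>s + \<tau> = 1\<close> the sum of fourth powers is minimal at \<open>s = \<tau> = 1/2\<close>.\<close>
    have "s^4 + \<tau>^4 - 1/8 = 2 * (s - 1/2)^4 + 3 * (s - 1/2)^2"
      unfolding \<open>\<tau> = 1 - s\<close> by algebra
    then have "s^4 + \<tau>^4 \<ge> 1/8" by (smt (verit) zero_le_power2 zero_le_even_power even_numeral mult_nonneg_nonneg)
    then show ?thesis using c by (intro mult_left_mono_neg) auto
  qed
  finally have R: "Re (e^3 * cnj ?D) \<le> - (c/8)" by simp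
  have lin_le: "norm (lin x e \<tau>) \<le> \<bar>x\<bar>" if "\<bar>x\<bar> \<ge> 1" for x
  proof -
    have "norm (lin x e \<tau>) \<le> norm (complex_of_real (1 - \<tau>)) + norm (of_real x * (of_real \<tau> * e))"
      unfolding lin_def by (rule norm_triangle_ineq)
    also have "\<dots> = s + \<bar>x\<bar> * \<tau>" using s e by (simp add: norm_mult s_def del: of_real_diff)
    also have "\<dots> \<le> \<bar>x\<bar> * s + \<bar>x\<bar> * \<tau>" using that s mult_right_mono[of 1 "\<bar>x\<bar>" s] by simp
    also have "\<dots> = \<bar>x\<bar>" using s by (metis distrib_left mult_1_right)
    finally show ?thesis .
  qed
  have "norm ?D \<le> \<bar>x1\<bar> * \<bar>x3\<bar> * \<bar>- 1\<bar> * \<bar>1\<bar>"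
    unfolding denom4_lin norm_mult by (intro mult_mono lin_le) (use x in auto)
  then have nD: "norm ?D \<le> P" unfolding P_def using x by simp
  have D0: "norm ?D > 0" using x e(3) by (simp add: denom4_lin lin_nonzero)
  have "Re (e^3 / ?D) = Re (e^3 * cnj ?D) / (norm ?D)^2" by (subst complex_div_cnj) simp
  also have "\<dots> \<le> - (c/8) / (norm ?D)^2" using R by (intro divide_right_mono) auto
  also have "\<dots> \<le> - (c/8) / P^2"
    using c nD D0 P by (intro divide_left_mono_neg power_mono) (auto intro!: mult_pos_pos)
  also have "c = 1 / (2 * P)" using Pc P by (simp add: field_simps)
  finally show ?thesis unfolding P_def by (simp add: power2_eq_square power3_eq_cube)
qed

lemma ell_combo_steep:
  fixes x1 x3 :: real
  assumes x: "x1 > 1" "x3 > 1" and e: "norm e = 1" "Re e = 1 / (2 * x1 * x3)" "Im e \<noteq> 0" and \<tau>: "\<tau> \<in> {0..1}"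
    and c0: "\<alpha>1 * (x1 - 1) - 2 * \<alpha>2 + \<alpha>3 * (x3 - 1) = 0"
    and c1: "\<alpha>1 * (x1 - 1) * (x3 - 1) - 2 * \<alpha>2 * (x1 + x3) + \<alpha>3 * (x3 - 1) * (x1 - 1) = 0"
    and c2: "K = - \<alpha>1 * (x1 - 1) * x3 - 2 * \<alpha>2 * x1 * x3 - \<alpha>3 * (x3 - 1) * x1" "K \<ge> 0"
  shows "Re (ell_combo x1 x3 \<alpha>1 \<alpha>2 \<alpha>3 e \<tau>) \<le> - (K / (48 * (x1 * x3)^3)) * \<tau>^3"
proof -
  define k where "k = 1 / (16 * (x1 * x3)^3)"
  define h where "h \<tau> = Re (ell_combo x1 x3 \<alpha>1 \<alpha>2 \<alpha>3 e \<tau>) + K * k * \<tau>^3 / 3" for \<tau>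
  have x0: "x1 \<noteq> 0" "x3 \<noteq> 0" using x by auto
  have "h \<tau> \<le> h 0"
  proof (rule DERIV_nonpos_imp_nonincreasing[where f = h and a = 0 and b = \<tau>])
    fix t assume t: "0 \<le> t" "t \<le> \<tau>"
    have "(ell_combo x1 x3 \<alpha>1 \<alpha>2 \<alpha>3 e has_vector_derivative of_real (K * t^2) * (e^3 / denom4 x1 x3 e (of_real t))) (at t)"
      using ell_combo_deriv[OF x0 e(3), of \<alpha>1 \<alpha>2 \<alpha>3 t UNIV] unfolding c0 c1 c2(1)[symmetric]
      by (simp add: power2_eq_square power3_eq_cube mult_ac)
    note * = bounded_linear.has_vector_derivative[OF bounded_linear_Re this]
    have "((\<lambda>t. Re (ell_combo x1 x3 \<alpha>1 \<alpha>2 \<alpha>3 e t)) has_real_derivative K * t^2 * Re (e^3 / denom4 x1 x3 e (of_real t))) (at t)"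
    proof -
      have "Re (of_real r * z) = r * Re z" for r z by simp
      with * show ?thesis by (simp only: has_real_derivative_iff_has_vector_derivative)
    qed
    then have "(h has_real_derivative K * t^2 * Re (e^3 / denom4 x1 x3 e (of_real t)) + K * k * t^2) (at t)"
      unfolding h_def by (rule DERIV_add) (auto intro!: derivative_eq_intros)
    moreover have "K * t^2 * Re (e^3 / denom4 x1 x3 e (of_real t)) \<le> K * t^2 * (- k)"
      unfolding k_def using Re_cube_over_denom4[OF x e, of t] t \<tau> c2 by (intro mult_left_mono) auto
    ultimately show "\<exists>y. (h has_real_derivative y) (at t) \<and> y \<le> 0"
      by (intro exI conjI) (auto simp: mult_ac)
  qed (use \<tau> in simp)
  then show ?thesis unfolding h_def k_def by simp
qed

section \<open>Asymptotics of the integral over one arc\<close>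

lemma ell_combo_linear_bound:
  assumes "x1 \<noteq> 0" "x3 \<noteq> 0" "Im e \<noteq> 0"
  shows "\<exists>L\<ge>0. \<forall>\<tau>\<in>{0..1}. norm (ell_combo x1 x3 \<alpha>1 \<alpha>2 \<alpha>3 e \<tau>) \<le> L * \<tau>"
proof -
  define c where "c = \<alpha>1 * (x1 - 1) - 2 * \<alpha>2 + \<alpha>3 * (x3 - 1)"
  obtain C where C: "C \<ge> 0"
    "\<forall>\<tau>\<in>{0..1}. norm (ell_combo x1 x3 \<alpha>1 \<alpha>2 \<alpha>3 e \<tau> - of_real c * (of_real \<tau> * e)) \<le> C * \<tau>^2"
    using ell_combo_order(1)[OF assms, of \<alpha>1 \<alpha>2 \<alpha>3] unfolding c_def by blast
  have "norm (ell_combo x1 x3 \<alpha>1 \<alpha>2 \<alpha>3 e \<tau>) \<le> (C + \<bar>c\<bar> * norm e) * \<tau>" if \<tau>: "\<tau> \<in> {0..1}" for \<tau>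
  proof -
    have "norm (ell_combo x1 x3 \<alpha>1 \<alpha>2 \<alpha>3 e \<tau>) \<le> norm (of_real c * (of_real \<tau> * e))
        + norm (ell_combo x1 x3 \<alpha>1 \<alpha>2 \<alpha>3 e \<tau> - of_real c * (of_real \<tau> * e))"
      by (rule norm_triangle_sub)
    also have "\<dots> \<le> \<bar>c\<bar> * (\<tau> * norm e) + C * \<tau>^1"
    proof (rule add_mono)
      have "C * \<tau>^2 \<le> C * \<tau>^1" using C \<tau> by (intro mult_left_mono power_decreasing) auto
      with bspec[OF C(2) \<tau>] show "norm (ell_combo x1 x3 \<alpha>1 \<alpha>2 \<alpha>3 e \<tau> - of_real c * (of_real \<tau> * e)) \<le> C * \<tau>^1"
        by (rule order_trans)
    qed (use \<tau> in \<open>simp add: norm_mult\<close>)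
    finally show ?thesis by (simp add: algebra_simps)
  qed
  then show ?thesis using C by (intro exI[of _ "C + \<bar>c\<bar> * norm e"]) auto
qed

lemma continuous_ell_combo:
  assumes "x1 \<noteq> 0" "x3 \<noteq> 0" "Im e \<noteq> 0"
  shows "continuous_on S (ell_combo x1 x3 \<alpha>1 \<alpha>2 \<alpha>3 e)"
  unfolding continuous_on_eq_continuous_within
  by (intro ballI has_vector_derivative_continuous[OF ell_combo_deriv[OF assms]])

text \<open>
  The exponents \<open>A\<close>, \<open>n\<close>, \<open>b\<close> are split into their parts of order \<open>\<eta>\<^sup>-\<^sup>3\<close>, \<open>\<eta>\<^sup>-\<^sup>2\<close>, \<open>\<eta>\<^sup>-\<^sup>1\<close> and a
  remainder bounded by \<open>R\<close>. The assumptions on the coefficients say that the first part gives a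
  phase vanishing to third order and the second one a phase vanishing to second order. The
  rounding errors end up in the perturbation \<open>\<psi>\<close> of \<open>steep_ray_limit\<close>.
\<close>

lemma ray_asymptotics:
  fixes x1 x3 k \<sigma> T X M R A0 n0 B0 A1 n1 B1 :: real and e :: complex
  assumes x: "x1 > 1" "x3 > 1" and e: "norm e = 1" "Re e = 1 / (2 * x1 * x3)" "Im e \<noteq> 0"
    and k: "k > 0" and T: "T > 0" and MR: "M \<ge> 0" "R \<ge> 0"
    and F0: "A0 * (x1 - 1) + 2 * n0 - B0 * (x3 - 1) = 0"
    and F1: "A0 * (x1 - 1) * (x3 - 1) + 2 * n0 * (x1 + x3) - B0 * (x3 - 1) * (x1 - 1) = 0"
    and F2: "- A0 * (x1 - 1) * x3 + 2 * n0 * x1 * x3 + B0 * (x3 - 1) * x1 = k^3"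
    and H0: "A1 * (x1 - 1) + 2 * n1 - B1 * (x3 - 1) = 0"
    and H1: "\<sigma>\<^sup>2 * (A1 * (x1 - 1) * (x3 - 1) + 2 * n1 * (x1 + x3) - B1 * (x3 - 1) * (x1 - 1)) = - 2 * k\<^sup>2"
  shows "\<exists>B. \<forall>\<eta> Y A n b. 0 < \<eta> \<longrightarrow> \<bar>Y\<bar> \<le> M \<longrightarrow>
      \<bar>A - (A0 * (T / (k * \<eta>)^3) + A1 * (\<sigma>\<^sup>2 * X / (k * \<eta>)\<^sup>2) + Y / (\<eta> * (x1 - 1)))\<bar> \<le> R \<longrightarrow>
      \<bar>n - (n0 * (T / (k * \<eta>)^3) + n1 * (\<sigma>\<^sup>2 * X / (k * \<eta>)\<^sup>2))\<bar> \<le> R \<longrightarrow>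
      \<bar>b - (B0 * (T / (k * \<eta>)^3) + B1 * (\<sigma>\<^sup>2 * X / (k * \<eta>)\<^sup>2))\<bar> \<le> R \<longrightarrow>
      norm (of_real (1 / (\<eta> * (x1 - 1))) * phase_integral x1 x3 A n b e
        - (LBINT r:{0..}. e * cubic_exp T X Y (of_real r * e))) \<le> B * \<eta>"
proof -
  have x0: "x1 \<noteq> 0" "x3 \<noteq> 0" using x by auto
  let ?L = "\<lambda>\<alpha>1 \<alpha>2 \<alpha>3. ell_combo x1 x3 \<alpha>1 \<alpha>2 \<alpha>3 e"
  define F where "F = ?L A0 (- n0) (- B0)"
  define H where "H = ?L A1 (- n1) (- B1)"
  define c where "c = x1 - 1"
  have c: "c > 0" unfolding c_def using x by simp
  define \<Phi>3 where "\<Phi>3 \<tau> = of_real (3 / k^3) * F \<tau>" for \<tau>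
  define \<Phi>2 where "\<Phi>2 \<tau> = of_real (- \<sigma>\<^sup>2 / k\<^sup>2) * H \<tau>" for \<tau>
  define \<Phi>1 where "\<Phi>1 \<tau> = of_real (1 / c) * ell x1 e \<tau>" for \<tau>
  define g where "g \<tau> = e / (lin x1 e \<tau> * lin 1 e \<tau>)" for \<tau>
  define h1 where "h1 = A1 * (x1 - 1) * (x3 - 1) - 2 * (- n1) * (x1 + x3) + (- B1) * (x3 - 1) * (x1 - 1)"
  define \<kappa> where "\<kappa> = 1 / (16 * (x1 * x3)^3)"
  have \<kappa>: "\<kappa> > 0" unfolding \<kappa>_def using x by simp
  have ell_is: "ell x1 e = ?L 1 0 0" "ell (-1) e = ?L 0 1 0" "ell x3 e = ?L 0 0 1"
    by (auto simp: ell_combo_def)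
  have F0': "A0 * (x1 - 1) - 2 * (- n0) + (- B0) * (x3 - 1) = 0" using F0 by simp
  have F1': "A0 * (x1 - 1) * (x3 - 1) - 2 * (- n0) * (x1 + x3) + (- B0) * (x3 - 1) * (x1 - 1) = 0"
    using F1 by simp
  have F2': "- A0 * (x1 - 1) * x3 - 2 * (- n0) * x1 * x3 - (- B0) * (x3 - 1) * x1 = k^3"
    using F2 by simp
  have H0': "A1 * (x1 - 1) - 2 * (- n1) + (- B1) * (x3 - 1) = 0" using H0 by simp
  have H1': "\<sigma>\<^sup>2 * h1 = - 2 * k\<^sup>2" unfolding h1_def using H1 by simp
  obtain C3 where C3: "C3 \<ge> 0" "\<forall>\<tau>\<in>{0..1}. norm (F \<tau> - of_real (k^3/3) * (of_real \<tau> * e)^3) \<le> C3 * \<tau>^4"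
    using ell_combo_order(3)[OF x0 e(3) F0' F1', unfolded F2'] unfolding F_def by blast
  obtain C2 where C2: "C2 \<ge> 0" "\<forall>\<tau>\<in>{0..1}. norm (H \<tau> - of_real (h1/2) * (of_real \<tau> * e)^2) \<le> C2 * \<tau>^3"
    using ell_combo_order(2)[OF x0 e(3) H0'] unfolding H_def h1_def by blast
  have c10: "1 * (x1 - 1) - 2 * 0 + 0 * (x3 - 1) = c" unfolding c_def by simp
  obtain C1 where C1: "C1 \<ge> 0" "\<forall>\<tau>\<in>{0..1}. norm (ell x1 e \<tau> - of_real c * (of_real \<tau> * e)) \<le> C1 * \<tau>^2"
    using ell_combo_order(1)[OF x0 e(3), of 1 0 0, unfolded c10] unfolding ell_is by blast
  obtain Cg where Cg: "Cg \<ge> 0" "\<forall>\<tau>\<in>{0..1}. norm (g \<tau> - e) \<le> Cg * \<tau>"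
  proof -
    let ?D = "\<lambda>z. ((1 - z) + of_real x1 * (z * e)) * ((1 - z) + of_real 1 * (z * e))"
    have "\<exists>C\<ge>0. \<forall>\<tau>\<in>{0..1}. norm ((\<lambda>z. e / ?D z) (of_real \<tau>) - (\<lambda>z. e / ?D z) 0) \<le> C * \<tau>"
    proof (rule lipschitz_at_0[of _ "{z. ?D z \<noteq> 0}"])
      show "(\<lambda>z. e / ?D z) holomorphic_on {z. ?D z \<noteq> 0}" by (intro holomorphic_intros) auto
      show "open {z. ?D z \<noteq> 0}" by (intro open_Collect_neq continuous_intros)
      have D: "?D (of_real \<tau>) = lin x1 e \<tau> * lin 1 e \<tau>" for \<tau> unfolding lin_def by simp
      have "?D (of_real \<tau>) \<noteq> 0" for \<tau>
        unfolding D using lin_nonzero[OF x0(1) e(3), of \<tau>] lin_nonzero[OF one_neq_zero e(3), of \<tau>]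
        by (rule no_zero_divisors)
      then show "complex_of_real ` {0..1} \<subseteq> {z. ?D z \<noteq> 0}" by blast
    qed
    then show thesis using that unfolding g_def lin_def by auto
  qed
  obtain L1 where L1: "L1 \<ge> 0" "\<forall>\<tau>\<in>{0..1}. norm (ell x1 e \<tau>) \<le> L1 * \<tau>"
    unfolding ell_is using ell_combo_linear_bound[OF x0 e(3), of 1 0 0] by blast
  obtain L2 where L2: "L2 \<ge> 0" "\<forall>\<tau>\<in>{0..1}. norm (ell (-1) e \<tau>) \<le> L2 * \<tau>"
    unfolding ell_is using ell_combo_linear_bound[OF x0 e(3), of 0 1 0] by blast
  obtain L3 where L3: "L3 \<ge> 0" "\<forall>\<tau>\<in>{0..1}. norm (ell x3 e \<tau>) \<le> L3 * \<tau>"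
    unfolding ell_is using ell_combo_linear_bound[OF x0 e(3), of 0 0 1] by blast
  note L = L1 L2 L3
  define C where "C = 3 / k^3 * C3 + \<sigma>\<^sup>2 / k\<^sup>2 * C2 + 1 / c * C1 + Cg"
  define L where "L = R * (L1 + L2 + L3)"
  have parts: "0 \<le> 3 / k^3 * C3" "0 \<le> \<sigma>\<^sup>2 / k\<^sup>2 * C2" "0 \<le> 1 / c * C1" using k c C3 C2 C1 by auto
  have C: "C \<ge> 0" "3 / k^3 * C3 \<le> C" "\<sigma>\<^sup>2 / k\<^sup>2 * C2 \<le> C" "1 / c * C1 \<le> C" "Cg \<le> C"
    unfolding C_def using parts Cg by linarith+
  have Lp: "L \<ge> 0" unfolding L_def using L MR by simp
  have conts: "continuous_on {0..1} (?L \<alpha>1 \<alpha>2 \<alpha>3)" for \<alpha>1 \<alpha>2 \<alpha>3 by (rule continuous_ell_combo[OF x0 e(3)])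
  have Re3: "Re (e^3) < 0"
    using Re_cube_over_denom4[OF x e, of 0, folded \<kappa>_def] denom4_region(3)[OF x0 e(3)] \<kappa> by simp
  have "\<exists>B. \<forall>\<eta> Y \<psi>. 0 < \<eta> \<longrightarrow> \<bar>Y\<bar> \<le> M \<longrightarrow> continuous_on {0..1} \<psi> \<longrightarrow>
      (\<forall>\<tau>\<in>{0..1}. norm (\<psi> \<tau>) \<le> L * \<tau>) \<longrightarrow>
      norm (of_real (1/\<eta>) * integral {0..1} (\<lambda>\<tau>. exp (of_real (T/3 / \<eta>^3) * \<Phi>3 \<tau> - of_real (X / \<eta>^2) * \<Phi>2 \<tau>
          + of_real (Y / \<eta>) * \<Phi>1 \<tau> + \<psi> \<tau>) * g \<tau>)
        - (LBINT r:{0..}. e * cubic_exp T X Y (of_real r * e))) \<le> B * \<eta>"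
  proof (rule steep_ray_limit[OF T e(1) Re3 \<kappa> C(1) Lp MR(1)])
    show "continuous_on {0..1} \<Phi>1" "continuous_on {0..1} \<Phi>2" "continuous_on {0..1} \<Phi>3"
      unfolding \<Phi>1_def \<Phi>2_def \<Phi>3_def F_def H_def ell_is by (intro continuous_intros conts)+
    show "continuous_on {0..1} g" unfolding g_def
      using x0 e(3) by (intro continuous_intros continuous_lin) (simp add: lin_nonzero)
  next
    fix \<tau> :: real assume \<tau>: "\<tau> \<in> {0..1}"
    have "Re (F \<tau>) \<le> - (k^3 / (48 * (x1 * x3)^3)) * \<tau>^3"
      unfolding F_def using k by (intro ell_combo_steep[OF x e \<tau> F0' F1' F2'[symmetric]]) simp
    then have "3 / k^3 * Re (F \<tau>) \<le> 3 / k^3 * (- (k^3 / (48 * (x1 * x3)^3)) * \<tau>^3)"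
      using k by (intro mult_left_mono) auto
    also have "\<dots> = - \<kappa> * \<tau>^3" unfolding \<kappa>_def using k by simp
    also have "3 / k^3 * Re (F \<tau>) = Re (\<Phi>3 \<tau>)" unfolding \<Phi>3_def by simp
    finally show "Re (\<Phi>3 \<tau>) \<le> - \<kappa> * \<tau>^3" .
    have scale: "norm (of_real r * f - v) \<le> C * \<tau>^m"
      if "v = of_real r * w" "norm (f - w) \<le> D * \<tau>^m" "\<bar>r\<bar> * D \<le> C" for r D :: real and f v w :: complex and m
    proof -
      have "norm (of_real r * f - v) = \<bar>r\<bar> * norm (f - w)"
        unfolding that(1) right_diff_distrib[symmetric] norm_mult by simp
      also have "\<dots> \<le> \<bar>r\<bar> * (D * \<tau>^m)" using that by (intro mult_left_mono) auto
      also have "\<dots> \<le> C * \<tau>^m" using mult_right_mono[OF that(3), of "\<tau>^m"] \<tau> by (simp add: mult.assoc)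
      finally show ?thesis .
    qed
    have unit: "v = of_real r * (of_real s * v)" if "r * s = 1" for r s :: real and v :: complex
      using that by (metis mult.assoc mult_1 of_real_1 of_real_mult)
    show "norm (\<Phi>3 \<tau> - (of_real \<tau> * e)^3) \<le> C * \<tau>^4"
      unfolding \<Phi>3_def by (rule scale[OF unit bspec[OF C3(2) \<tau>]]) (use k C in auto)
    show "norm (\<Phi>2 \<tau> - (of_real \<tau> * e)^2) \<le> C * \<tau>^3"
    proof -
      have "(- \<sigma>\<^sup>2 / k\<^sup>2) * (h1 / 2) = 1" using H1' k by (simp add: field_simps)
      then show ?thesis unfolding \<Phi>2_def by (rule scale[OF unit bspec[OF C2(2) \<tau>]]) (use C in auto)
    qed
    show "norm (\<Phi>1 \<tau> - of_real \<tau> * e) \<le> C * \<tau>^2"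
      unfolding \<Phi>1_def by (rule scale[OF unit bspec[OF C1(2) \<tau>]]) (use c C in auto)
    show "norm (g \<tau> - e) \<le> C * \<tau>"
      using bspec[OF Cg(2) \<tau>] mult_right_mono[OF C(5), of \<tau>] \<tau> by auto
  qed
  then obtain B where B: "\<And>\<eta> Y \<psi>. 0 < \<eta> \<Longrightarrow> \<bar>Y\<bar> \<le> M \<Longrightarrow> continuous_on {0..1} \<psi> \<Longrightarrow>
      (\<forall>\<tau>\<in>{0..1}. norm (\<psi> \<tau>) \<le> L * \<tau>) \<Longrightarrow>
      norm (of_real (1/\<eta>) * integral {0..1} (\<lambda>\<tau>. exp (of_real (T/3 / \<eta>^3) * \<Phi>3 \<tau> - of_real (X / \<eta>^2) * \<Phi>2 \<tau>
          + of_real (Y / \<eta>) * \<Phi>1 \<tau> + \<psi> \<tau>) * g \<tau>)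
        - (LBINT r:{0..}. e * cubic_exp T X Y (of_real r * e))) \<le> B * \<eta>"
    by blast
  show ?thesis
  proof (intro exI[of _ B] allI impI)
    fix \<eta> Y A n b :: real
    define r1 r2 r3 where "r1 = A - (A0 * (T / (k * \<eta>)^3) + A1 * (\<sigma>\<^sup>2 * X / (k * \<eta>)\<^sup>2) + Y / (\<eta> * (x1 - 1)))"
      and "r2 = n - (n0 * (T / (k * \<eta>)^3) + n1 * (\<sigma>\<^sup>2 * X / (k * \<eta>)\<^sup>2))"
      and "r3 = b - (B0 * (T / (k * \<eta>)^3) + B1 * (\<sigma>\<^sup>2 * X / (k * \<eta>)\<^sup>2))"
    assume \<eta>: "0 < \<eta>" and Y: "\<bar>Y\<bar> \<le> M"
      and "\<bar>A - (A0 * (T / (k * \<eta>)^3) + A1 * (\<sigma>\<^sup>2 * X / (k * \<eta>)\<^sup>2) + Y / (\<eta> * (x1 - 1)))\<bar> \<le> R"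
      and "\<bar>n - (n0 * (T / (k * \<eta>)^3) + n1 * (\<sigma>\<^sup>2 * X / (k * \<eta>)\<^sup>2))\<bar> \<le> R"
      and "\<bar>b - (B0 * (T / (k * \<eta>)^3) + B1 * (\<sigma>\<^sup>2 * X / (k * \<eta>)\<^sup>2))\<bar> \<le> R"
    then have r: "\<bar>r1\<bar> \<le> R" "\<bar>r2\<bar> \<le> R" "\<bar>r3\<bar> \<le> R" unfolding r1_def r2_def r3_def by auto
    define \<psi> where "\<psi> \<tau> = of_real r1 * ell x1 e \<tau> - of_real r2 * ell (-1) e \<tau> - of_real r3 * ell x3 e \<tau>" for \<tau>
    have c\<psi>: "continuous_on {0..1} \<psi>" unfolding \<psi>_def ell_is by (intro continuous_intros conts)
    have b\<psi>: "\<forall>\<tau>\<in>{0..1}. norm (\<psi> \<tau>) \<le> L * \<tau>"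
    proof
      fix \<tau> :: real assume \<tau>: "\<tau> \<in> {0..1}"
      have "norm (\<psi> \<tau>) \<le> norm (of_real r1 * ell x1 e \<tau>) + norm (of_real r2 * ell (-1) e \<tau>) + norm (of_real r3 * ell x3 e \<tau>)"
        unfolding \<psi>_def by (meson norm_triangle_ineq4 order_trans add_right_mono)
      also have "\<dots> \<le> R * (L1 * \<tau>) + R * (L2 * \<tau>) + R * (L3 * \<tau>)"
        unfolding norm_mult norm_of_real using r L \<tau> MR by (intro add_mono mult_mono) auto
      finally show "norm (\<psi> \<tau>) \<le> L * \<tau>" unfolding L_def by (simp add: algebra_simps)
    qed
    define N3 N2 where "N3 = T / (k * \<eta>)^3" and "N2 = \<sigma>\<^sup>2 * X / (k * \<eta>)\<^sup>2"
    have ex: "of_real A * ell x1 e \<tau> - of_real n * ell (-1) e \<tau> - of_real b * ell x3 e \<tau>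
       = of_real (T/3 / \<eta>^3) * \<Phi>3 \<tau> - of_real (X / \<eta>^2) * \<Phi>2 \<tau> + of_real (Y / \<eta>) * \<Phi>1 \<tau> + \<psi> \<tau>" for \<tau>
    proof -
      have f3: "of_real (T/3 / \<eta>^3) * \<Phi>3 \<tau> = of_real N3 * F \<tau>"
      proof -
        have "T/3 / \<eta>^3 * (3 / k^3) = N3" unfolding N3_def by (simp add: power_mult_distrib mult_ac)
        then show ?thesis unfolding \<Phi>3_def mult.assoc[symmetric] of_real_mult[symmetric] by simp
      qed
      have f2: "of_real (X / \<eta>^2) * \<Phi>2 \<tau> = - (of_real N2 * H \<tau>)"
      proof -
        have "X / \<eta>^2 * (- \<sigma>\<^sup>2 / k\<^sup>2) = - N2" unfolding N2_def by (simp add: power_mult_distrib mult_ac)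
        then show ?thesis unfolding \<Phi>2_def mult.assoc[symmetric] of_real_mult[symmetric] by simp
      qed
      have f1: "of_real (Y / \<eta>) * \<Phi>1 \<tau> = of_real (Y / (\<eta> * (x1 - 1))) * ell x1 e \<tau>"
        unfolding \<Phi>1_def c_def mult.assoc[symmetric] of_real_mult[symmetric] by simp
      have "A = A0 * N3 + A1 * N2 + Y / (\<eta> * (x1 - 1)) + r1" "n = n0 * N3 + n1 * N2 + r2" "b = B0 * N3 + B1 * N2 + r3"
        unfolding r1_def r2_def r3_def N3_def N2_def by auto
      then show ?thesis
        unfolding f1 f2 f3 \<psi>_def F_def H_def ell_combo_def by (simp add: algebra_simps)
    qed
    have "of_real (1 / (\<eta> * (x1 - 1))) * phase_integral x1 x3 A n b e = of_real (1/\<eta>) * integral {0..1} (\<lambda>\<tau>. exp (of_real (T/3 / \<eta>^3) * \<Phi>3 \<tau> - of_real (X / \<eta>^2) * \<Phi>2 \<tau>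
          + of_real (Y / \<eta>) * \<Phi>1 \<tau> + \<psi> \<tau>) * g \<tau>)"
    proof -
      have gi: "exp v * (of_real (x1 - 1) * e / (lin x1 e \<tau> * lin 1 e \<tau>)) = of_real c * (exp v * g \<tau>)" for v \<tau>
        unfolding g_def c_def by simp
      have "complex_of_real (1 / (\<eta> * (x1 - 1))) * (of_real c * v) = of_real (1 / \<eta>) * v" for v
        unfolding mult.assoc[symmetric] of_real_mult[symmetric] using c by (simp add: c_def)
      then show ?thesis unfolding phase_integral_def ex gi integral_mult_right .
    qed
    then show "norm (of_real (1 / (\<eta> * (x1 - 1))) * phase_integral x1 x3 A n b e
        - (LBINT r:{0..}. e * cubic_exp T X Y (of_real r * e))) \<le> B * \<eta>"
      using B[OF \<eta> Y c\<psi> b\<psi>] by simp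
  qed
qed

section \<open>Convergence of the scaled kernel\<close>

text \<open>
  The natural parameter at the saddle is \<open>k \<tau>\<close> with \<open>k = \<gamma> \<sigma> (x1 - 1)\<close>: the constant \<open>\<sigma>\<close> makes the
  cubic coefficient equal to \<open>k\<^sup>3\<close>, and \<open>\<gamma>\<close> makes the quadratic one equal to \<open>- 2 k\<^sup>2 / \<sigma>\<^sup>2\<close>. Both
  follow from \<open>(\<gamma> \<sigma>)\<^sup>3 = p q \<theta>\<^sup>2 / (D s (1 + \<theta>))\<close> and the formula for \<open>\<gamma>\<^sup>2\<close>.
\<close>

lemma scaling_constants:
  fixes p \<rho> :: real and a b :: nat
  assumes p: "0 < p" "p < 1" and \<rho>: "0 < \<rho>" "\<rho> < 1" and ab: "a + b \<ge> 1"
  defines "\<Theta> \<equiv> theta_hat p \<rho> a b" and "Q \<equiv> (1 - p) / p" and "l \<equiv> lam a b"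
  defines "x1 \<equiv> (2 - \<Theta>) / \<Theta>" and "x3 \<equiv> (Q + 2 - \<Theta>) / (Q + \<Theta>)"
  defines "k \<equiv> gam p \<rho> a b * sig p \<rho> a b * (x1 - 1)"
  defines "A0 \<equiv> alpha p \<rho> a b + beta p \<rho> a b" and "n0 \<equiv> alpha p \<rho> a b" and "B0 \<equiv> 1 - l * alpha p \<rho> a b"
  shows "theta p \<rho> a b > 0" "p - (1 - p) * theta p \<rho> a b > 0" "x1 > 1" "x3 > 1"
    "gam p \<rho> a b > 0" "sig p \<rho> a b > 0" "k > 0" "alpha p \<rho> a b > 0"
    "A0 * (x1 - 1) + 2 * n0 - B0 * (x3 - 1) = 0"
    "A0 * (x1 - 1) * (x3 - 1) + 2 * n0 * (x1 + x3) - B0 * (x3 - 1) * (x1 - 1) = 0"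
    "- A0 * (x1 - 1) * x3 + 2 * n0 * x1 * x3 + B0 * (x3 - 1) * x1 = k^3"
    "(1/\<rho> - 1) * (x1 - 1) + 2 * (- 1) - l * (x3 - 1) = 0"
    "(sig p \<rho> a b)\<^sup>2 * ((1/\<rho> - 1) * (x1 - 1) * (x3 - 1) + 2 * (- 1) * (x1 + x3) - l * (x3 - 1) * (x1 - 1)) = - 2 * k\<^sup>2"
proof -
  define q where "q = 1 - p"
  define \<theta> where "\<theta> = theta p \<rho> a b"
  define s where "s = p - q * \<theta>"
  define D where "D = p * q * (1 + \<theta>)^2 + l * s^2"
  define \<gamma> where "\<gamma> = gam p \<rho> a b"
  define \<sigma> where "\<sigma> = sig p \<rho> a b"
  have q: "q > 0" unfolding q_def using p by simp
  have l: "0 \<le> l" "l \<le> 1" unfolding l_def lam_def using ab by (auto simp: divide_simps)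
  note tq = theta_quadratic[OF p \<rho> l]
  have \<theta>e: "\<theta> = (p - (1 - p) - p * (1 + l) * \<rho> + sqrt ((p^2 * (1 - l)^2 + 4 * p * l) * \<rho>^2 - 2 * p * (1 + l) * \<rho> + 1)) / (2 * (1 - p) * (1 - l * \<rho>))"
    unfolding \<theta>_def theta_def Let_def l_def ..
  have th: "\<theta> > 0" and s: "s > 0"
    and eq: "s * (1 + \<theta>) = \<rho> * (p * (1 + \<theta>) + l * \<theta> * s)"
    using tq unfolding s_def q_def \<theta>e[symmetric] by auto
  then show "theta p \<rho> a b > 0" "p - (1 - p) * theta p \<rho> a b > 0" unfolding s_def q_def \<theta>_def by auto
  have th1: "1 + \<theta> > 0" using th by simp
  have D: "D > 0" unfolding D_def using p q th1 l by (intro add_pos_nonneg) auto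
  have rinv: "1/\<rho> = p / s + l * \<theta> / (1 + \<theta>)"
  proof -
    have "p / s + l * \<theta> / (1 + \<theta>) = (p * (1 + \<theta>) + l * \<theta> * s) / (s * (1 + \<theta>))"
      using s th1 by (subst add_frac_eq) auto
    also have "\<dots> = 1 / \<rho>"
    proof -
      have "p * (1 + \<theta>) + l * \<theta> * s > 0" using p th1 l th s by (intro add_pos_nonneg) auto
      then show ?thesis unfolding eq using \<rho> by simp
    qed
    finally show ?thesis ..
  qed
  have \<Theta>: "\<Theta> = q * \<theta> / p" unfolding \<Theta>_def theta_hat_def q_def \<theta>_def by simp
  have x1: "x1 = (2 * p - q * \<theta>) / (q * \<theta>)"
    unfolding x1_def \<Theta> using p q th by (simp add: divide_simps)
  have x3: "x3 = (1 + p - q * \<theta>) / (q * (1 + \<theta>))"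
  proof -
    have "Q + 2 - \<Theta> = (1 + p - q * \<theta>) / p" "Q + \<Theta> = q * (1 + \<theta>) / p"
      unfolding Q_def \<Theta> q_def using p by (simp_all add: field_simps)
    then show ?thesis unfolding x3_def using p by simp
  qed
  show x1g: "x1 > 1" unfolding x1 using s q th unfolding s_def by (simp add: less_divide_eq mult.commute)
  show "x3 > 1"
  proof -
    have "q * (1 + \<theta>) < 1 + p - q * \<theta>" using s unfolding s_def q_def by (simp add: algebra_simps)
    then show ?thesis unfolding x3 using q th1 by (simp add: less_divide_eq)
  qed
  have alpha: "alpha p \<rho> a b = s^2 / D"
    unfolding alpha_def Let_def D_def s_def q_def \<theta>_def l_def ..
  have beta: "beta p \<rho> a b = p * (q * (1 + \<theta>)^2 - 1) / D"
    unfolding beta_def Let_def D_def s_def q_def \<theta>_def l_def ..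
  show "alpha p \<rho> a b > 0" unfolding alpha using s D by simp
  have A0: "A0 = q * \<theta>^2 / D"
  proof -
    have "s^2 + p * (q * (1 + \<theta>)^2 - 1) = q * \<theta>^2" unfolding s_def q_def by algebra
    then show ?thesis unfolding A0_def alpha beta add_divide_distrib[symmetric] by simp
  qed
  have n0: "n0 = s^2 / D" unfolding n0_def alpha ..
  have B0: "B0 = p * q * (1 + \<theta>)^2 / D"
    unfolding B0_def alpha using D by (simp add: D_def divide_simps)
  have g2: "\<gamma>\<^sup>2 = \<theta> * D / (2 * s^2 * (1 + \<theta>)^2)" and g: "\<gamma> > 0"
  proof -
    have "p * q * \<theta> / (2 * s^2) + \<theta> * l / (2 * (1 + \<theta>)^2) = (p * q * \<theta> * (2 * (1 + \<theta>)^2) + \<theta> * l * (2 * s^2)) / ((2 * s^2) * (2 * (1 + \<theta>)^2))"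
      using s th1 by (subst add_frac_eq) auto
    also have "\<dots> = (2 * (\<theta> * D)) / (2 * (2 * s^2 * (1 + \<theta>)^2))"
      unfolding D_def by (simp add: algebra_simps)
    also have "\<dots> = \<theta> * D / (2 * s^2 * (1 + \<theta>)^2)" by (rule mult_divide_mult_cancel_left) simp
    finally have *: "\<gamma> = sqrt (\<theta> * D / (2 * s^2 * (1 + \<theta>)^2))"
      unfolding \<gamma>_def gam_def Let_def \<theta>_def[symmetric] q_def[symmetric] s_def[symmetric] l_def[symmetric] by simp
    have "\<theta> * D / (2 * s^2 * (1 + \<theta>)^2) > 0" using th D s th1 by simp
    then show "\<gamma>\<^sup>2 = \<theta> * D / (2 * s^2 * (1 + \<theta>)^2)" "\<gamma> > 0" unfolding * by auto
  qed
  then show "gam p \<rho> a b > 0" unfolding \<gamma>_def by simp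
  have \<sigma>: "\<sigma> = root 3 (2 * p * q * \<theta> * (1 + \<theta>) * s / (\<gamma> * D^2))"
    unfolding \<sigma>_def sig_def Let_def \<theta>_def[symmetric] q_def[symmetric] s_def[symmetric] l_def[symmetric]
      \<gamma>_def[symmetric] D_def[symmetric] ..
  have rp: "2 * p * q * \<theta> * (1 + \<theta>) * s / (\<gamma> * D^2) > 0" using p q th th1 s g D by simp
  have sg: "\<sigma> > 0" unfolding \<sigma> using rp by simp
  then show "sig p \<rho> a b > 0" unfolding \<sigma>_def .
  have s3: "\<sigma>^3 = 2 * p * q * \<theta> * (1 + \<theta>) * s / (\<gamma> * D^2)"
    unfolding \<sigma> using rp by (intro real_root_pow_pos2) auto
  have k: "k = \<gamma> * \<sigma> * (x1 - 1)" unfolding k_def \<gamma>_def \<sigma>_def ..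
  show "k > 0" unfolding k using g sg x1g by simp
  have gs: "(\<gamma> * \<sigma>)^3 = p * q * \<theta>^2 / (D * s * (1 + \<theta>))"
  proof -
    have "(\<gamma> * \<sigma>)^3 = \<gamma>\<^sup>2 * (\<gamma> * \<sigma>^3)" by (simp add: power_mult_distrib power2_eq_square power3_eq_cube)
    also have "\<gamma> * \<sigma>^3 = 2 * p * q * \<theta> * (1 + \<theta>) * s / D^2" unfolding s3 using g by simp
    also have "\<gamma>\<^sup>2 * \<dots> = p * q * \<theta>^2 / (D * s * (1 + \<theta>))"
      unfolding g2 using D s th1 th by (simp add: power2_eq_square mult_ac)
    finally show ?thesis .
  qed
  note ids = phase_identities[OF q_def q p(1) th s_def s D_def D x1 x3 A0 n0 B0]
  show "A0 * (x1 - 1) + 2 * n0 - B0 * (x3 - 1) = 0"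
    "A0 * (x1 - 1) * (x3 - 1) + 2 * n0 * (x1 + x3) - B0 * (x3 - 1) * (x1 - 1) = 0"
    by (rule ids(1), rule ids(2))
  show "- A0 * (x1 - 1) * x3 + 2 * n0 * x1 * x3 + B0 * (x3 - 1) * x1 = k^3"
    unfolding ids(3) k power_mult_distrib[of "\<gamma> * \<sigma>"] gs ..
  show "(1/\<rho> - 1) * (x1 - 1) + 2 * (- 1) - l * (x3 - 1) = 0" using ids(4)[OF rinv] by simp
  have "(1/\<rho> - 1) * (x1 - 1) * (x3 - 1) + 2 * (- 1) * (x1 + x3) - l * (x3 - 1) * (x1 - 1) = - 2 * \<gamma>\<^sup>2 * (x1 - 1)^2"
    using ids(5)[OF rinv] unfolding g2 by simp
  then show "(sig p \<rho> a b)\<^sup>2 * ((1/\<rho> - 1) * (x1 - 1) * (x3 - 1) + 2 * (- 1) * (x1 + x3) - l * (x3 - 1) * (x1 - 1)) = - 2 * k\<^sup>2"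
    unfolding k \<sigma>_def[symmetric] by (simp add: power_mult_distrib)
qed

lemma scaled_variables_approx:
  fixes p \<rho> T X \<epsilon> \<zeta> u :: real and a b :: nat
  assumes p: "0 < p" "p < 1" and \<rho>: "0 < \<rho>" "\<rho> < 1" and ab: "a + b \<ge> 1" and T: "T > 0" and \<epsilon>: "\<epsilon> > 0"
    and n_pos: "alpha p \<rho> a b * \<epsilon> powr (-3/2) * T - (sig p \<rho> a b)^2 * \<epsilon> powr (-1) * X \<ge> 0"
  defines "N3 \<equiv> \<epsilon> powr (-3/2) * T" and "N2 \<equiv> (sig p \<rho> a b)\<^sup>2 * \<epsilon> powr (-1) * X"
    and "G \<equiv> gam p \<rho> a b * sig p \<rho> a b * \<epsilon> powr (-1/2)"
  defines "t \<equiv> t_sc \<epsilon> T" and "n \<equiv> n_sc p \<rho> a b \<epsilon> T X"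
    and "x \<equiv> x_sc p \<rho> a b \<epsilon> T X u" and "y \<equiv> y_sc p \<rho> a b \<epsilon> \<zeta>"
  shows "\<bar>real_of_int (x - y) + real n - ((alpha p \<rho> a b + beta p \<rho> a b) * N3 + (1/\<rho> - 1) * N2 + G * (u - \<zeta>))\<bar> \<le> real (a + b) + 4"
    "\<bar>real n - (alpha p \<rho> a b * N3 + (- 1) * N2)\<bar> \<le> real (a + b) + 4"
    "\<bar>real t - real (kap_sum a b n) - ((1 - lam a b * alpha p \<rho> a b) * N3 + lam a b * N2)\<bar> \<le> real (a + b) + 4"
proof -
  have fl: "\<bar>real_of_int \<lfloor>v\<rfloor> - v\<bar> \<le> 1" for v :: real by linarith
  have nfl: "\<bar>real (nat \<lfloor>v\<rfloor>) - v\<bar> \<le> 1" if "v \<ge> 0" for v :: real using that by linarith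
  have t: "\<bar>real t - N3\<bar> \<le> 1" unfolding t_def t_sc_def N3_def by (rule nfl) (use T in simp)
  have n: "\<bar>real n - (alpha p \<rho> a b * N3 + (- 1) * N2)\<bar> \<le> 1"
  proof -
    have "alpha p \<rho> a b * N3 + (- 1) * N2 = alpha p \<rho> a b * \<epsilon> powr (-3/2) * T - (sig p \<rho> a b)^2 * \<epsilon> powr (-1) * X"
      unfolding N3_def N2_def by simp
    then show ?thesis unfolding n_def n_sc_def using nfl[OF n_pos] by simp
  qed
  have x: "\<bar>real_of_int x - (beta p \<rho> a b * N3 + (1/\<rho>) * N2 + G * u)\<bar> \<le> 1"
    unfolding x_def x_sc_def N3_def N2_def G_def mult.assoc[symmetric] by (rule fl)
  have y: "\<bar>real_of_int y - G * \<zeta>\<bar> \<le> 1" unfolding y_def y_sc_def G_def by (rule fl)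
  show "\<bar>real n - (alpha p \<rho> a b * N3 + (- 1) * N2)\<bar> \<le> real (a + b) + 4" using n by linarith
  have "(alpha p \<rho> a b + beta p \<rho> a b) * N3 + (1/\<rho> - 1) * N2 + G * (u - \<zeta>)
    = (beta p \<rho> a b * N3 + (1/\<rho>) * N2 + G * u) - G * \<zeta> + (alpha p \<rho> a b * N3 + (- 1) * N2)"
    by (simp add: algebra_simps)
  then show "\<bar>real_of_int (x - y) + real n - ((alpha p \<rho> a b + beta p \<rho> a b) * N3 + (1/\<rho> - 1) * N2 + G * (u - \<zeta>))\<bar> \<le> real (a + b) + 4"
    using x y n unfolding of_int_diff by linarith
  have l: "0 \<le> lam a b" "lam a b \<le> 1" unfolding lam_def using ab by (auto simp: divide_simps)
  have ln: "\<bar>lam a b * real n - lam a b * (alpha p \<rho> a b * N3 + (- 1) * N2)\<bar> \<le> 1"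
  proof -
    have "\<bar>lam a b * real n - lam a b * (alpha p \<rho> a b * N3 + (- 1) * N2)\<bar> = lam a b * \<bar>real n - (alpha p \<rho> a b * N3 + (- 1) * N2)\<bar>"
      unfolding right_diff_distrib[symmetric] abs_mult using l by simp
    also have "\<dots> \<le> 1 * 1" using l n by (intro mult_mono) auto
    finally show ?thesis by simp
  qed
  have "(1 - lam a b * alpha p \<rho> a b) * N3 + lam a b * N2 = N3 - lam a b * (alpha p \<rho> a b * N3 + (- 1) * N2)"
    by (simp add: algebra_simps)
  then show "\<bar>real t - real (kap_sum a b n) - ((1 - lam a b * alpha p \<rho> a b) * N3 + lam a b * N2)\<bar> \<le> real (a + b) + 4"
    using t ln kap_sum_approx[OF ab, of n] by linarith
qed

theorem proposition5p2:
  fixes p \<rho> T X M :: real and a b :: nat and \<Gamma> :: "real \<Rightarrow> complex"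
  assumes "0 < p" "p < 1" and "0 < \<rho>" "\<rho> < 1" and "a + b \<ge> 1"
    and "contour_around_1 p \<Gamma>"
    and "T > 0" and "M > 0"
  shows "uniform_limit {(\<zeta>, u). \<bar>\<zeta> - u\<bar> \<le> M}
           (\<lambda>\<epsilon> (\<zeta>, u). S_bar_eps p \<rho> a b \<Gamma> \<epsilon> T X \<zeta> u)
           (\<lambda>(\<zeta>, u). S_lim (- T) (- X) \<zeta> u)
           (at_right 0)"
proof -
  note p = assms(1,2) and \<rho> = assms(3,4) and ab = assms(5) and \<Gamma> = assms(6) and T = assms(7) and M = assms(8)
  define \<Theta> where "\<Theta> = theta_hat p \<rho> a b"
  define Q where "Q = (1 - p) / p"
  define x1 where "x1 = (2 - \<Theta>) / \<Theta>"
  define x3 where "x3 = (Q + 2 - \<Theta>) / (Q + \<Theta>)"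
  define \<sigma> where "\<sigma> = sig p \<rho> a b"
  define \<gamma> where "\<gamma> = gam p \<rho> a b"
  define k where "k = \<gamma> * \<sigma> * (x1 - 1)"
  define \<alpha> where "\<alpha> = alpha p \<rho> a b"
  define \<beta> where "\<beta> = beta p \<rho> a b"
  define l where "l = lam a b"
  note sc = scaling_constants[OF p \<rho> ab, folded \<Theta>_def Q_def, folded x1_def x3_def \<sigma>_def \<gamma>_def \<alpha>_def \<beta>_def l_def, folded k_def]
  \<comment> \<open>The angle of the lens; this value of \<open>Re e\<close> is the one for which \<open>Re_cube_over_denom4\<close> holds.\<close>
  define c where "c = 1 / (2 * x1 * x3)"
  define e where "e = Complex c (sqrt (1 - c\<^sup>2))"
  have c: "0 < c" "c \<le> 1/2"
  proof -
    have "1 < x1 * x3" using sc(3,4) less_1_mult by blast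
    then show "0 < c" "c \<le> 1/2" unfolding c_def by (auto simp: field_simps)
  qed
  have c2: "c\<^sup>2 < 1" using c by (simp add: power_less_one_iff)
  have e: "norm e = 1" "Re e = 1 / (2 * x1 * x3)" "Im e > 0"
    unfolding e_def using c2 by (auto simp: cmod_def c_def)
  have e': "norm (cnj e) = 1" "Re (cnj e) = 1 / (2 * x1 * x3)" using e by auto
  have ime: "Im e \<noteq> 0" "Im (cnj e) \<noteq> 0" using e(3) by auto
  have Re_e: "0 < Re e" "Re e \<le> 1/2" using c e(2) unfolding c_def by auto
  define R where "R = real (a + b) + 4"
  have R: "R \<ge> 0" unfolding R_def by simp
  have ray: "\<exists>B. \<forall>\<eta> Y A n b. 0 < \<eta> \<longrightarrow> \<bar>Y\<bar> \<le> M \<longrightarrow>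
      \<bar>A - ((\<alpha> + \<beta>) * (T / (k * \<eta>)^3) + (1/\<rho> - 1) * (\<sigma>\<^sup>2 * X / (k * \<eta>)\<^sup>2) + Y / (\<eta> * (x1 - 1)))\<bar> \<le> R \<longrightarrow>
      \<bar>n - (\<alpha> * (T / (k * \<eta>)^3) + (- 1) * (\<sigma>\<^sup>2 * X / (k * \<eta>)\<^sup>2))\<bar> \<le> R \<longrightarrow>
      \<bar>b - ((1 - l * \<alpha>) * (T / (k * \<eta>)^3) + l * (\<sigma>\<^sup>2 * X / (k * \<eta>)\<^sup>2))\<bar> \<le> R \<longrightarrow>
      norm (of_real (1 / (\<eta> * (x1 - 1))) * phase_integral x1 x3 A n b d
        - (LBINT r:{0..}. d * cubic_exp T X Y (of_real r * d))) \<le> B * \<eta>"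
    if d: "norm d = 1" "Re d = 1 / (2 * x1 * x3)" "Im d \<noteq> 0" for d
    by (rule ray_asymptotics[OF sc(3,4) d sc(7) T less_imp_le[OF M] R sc(9-13)])
  obtain B1 where B1: "\<And>\<eta> Y A n b. 0 < \<eta> \<Longrightarrow> \<bar>Y\<bar> \<le> M \<Longrightarrow>
      \<bar>A - ((\<alpha> + \<beta>) * (T / (k * \<eta>)^3) + (1/\<rho> - 1) * (\<sigma>\<^sup>2 * X / (k * \<eta>)\<^sup>2) + Y / (\<eta> * (x1 - 1)))\<bar> \<le> R \<Longrightarrow>
      \<bar>n - (\<alpha> * (T / (k * \<eta>)^3) + (- 1) * (\<sigma>\<^sup>2 * X / (k * \<eta>)\<^sup>2))\<bar> \<le> R \<Longrightarrow>
      \<bar>b - ((1 - l * \<alpha>) * (T / (k * \<eta>)^3) + l * (\<sigma>\<^sup>2 * X / (k * \<eta>)\<^sup>2))\<bar> \<le> R \<Longrightarrow>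
      norm (of_real (1 / (\<eta> * (x1 - 1))) * phase_integral x1 x3 A n b e
        - (LBINT r:{0..}. e * cubic_exp T X Y (of_real r * e))) \<le> B1 * \<eta>"
    using ray[OF e(1,2) ime(1)] by blast
  obtain B2 where B2: "\<And>\<eta> Y A n b. 0 < \<eta> \<Longrightarrow> \<bar>Y\<bar> \<le> M \<Longrightarrow>
      \<bar>A - ((\<alpha> + \<beta>) * (T / (k * \<eta>)^3) + (1/\<rho> - 1) * (\<sigma>\<^sup>2 * X / (k * \<eta>)\<^sup>2) + Y / (\<eta> * (x1 - 1)))\<bar> \<le> R \<Longrightarrow>
      \<bar>n - (\<alpha> * (T / (k * \<eta>)^3) + (- 1) * (\<sigma>\<^sup>2 * X / (k * \<eta>)\<^sup>2))\<bar> \<le> R \<Longrightarrow>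
      \<bar>b - ((1 - l * \<alpha>) * (T / (k * \<eta>)^3) + l * (\<sigma>\<^sup>2 * X / (k * \<eta>)\<^sup>2))\<bar> \<le> R \<Longrightarrow>
      norm (of_real (1 / (\<eta> * (x1 - 1))) * phase_integral x1 x3 A n b (cnj e)
        - (LBINT r:{0..}. cnj e * cubic_exp T X Y (of_real r * cnj e))) \<le> B2 * \<eta>"
    using ray[OF e' ime(2)] by blast
  define K where "K = (B1 + B2) / (2 * pi) / k"
  have bound: "norm (S_bar_eps p \<rho> a b \<Gamma> \<epsilon> T X \<zeta> u - S_lim (- T) (- X) \<zeta> u) \<le> K * sqrt \<epsilon>"
    if \<epsilon>: "\<epsilon> > 0" and npos: "\<alpha> * \<epsilon> powr (-3/2) * T - \<sigma>\<^sup>2 * \<epsilon> powr (-1) * X \<ge> 0" and Y: "\<bar>\<zeta> - u\<bar> \<le> M" for \<epsilon> \<zeta> u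
  proof -
    \<comment> \<open>With this \<open>\<eta>\<close> the prefactor \<open>\<gamma> \<sigma> \<epsilon>\<^sup>-\<^sup>1\<^sup>/\<^sup>2\<close> is \<open>1 / (\<eta> (x1 - 1))\<close>.\<close>
    define \<eta> where "\<eta> = sqrt \<epsilon> / k"
    define t n where "t = t_sc \<epsilon> T" and "n = n_sc p \<rho> a b \<epsilon> T X"
    define x y where "x = x_sc p \<rho> a b \<epsilon> T X u" and "y = y_sc p \<rho> a b \<epsilon> \<zeta>"
    define A where "A = real_of_int (x - y) + real n"
    define b' where "b' = real t - real (kap_sum a b n)"
    have \<eta>: "\<eta> > 0" unfolding \<eta>_def using \<epsilon> sc(7) by simp
    have k\<eta>: "k * \<eta> = sqrt \<epsilon>" unfolding \<eta>_def using sc(7) by simp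
    have sq: "sqrt \<epsilon> = \<epsilon> powr (1/2)" using \<epsilon> by (simp add: powr_half_sqrt)
    have e1: "\<epsilon> powr (-1/2) = 1 / sqrt \<epsilon>" unfolding sq using \<epsilon> by (simp add: powr_minus_divide)
    have e2: "\<epsilon> powr (-1) = 1 / (k * \<eta>)\<^sup>2" unfolding k\<eta> using \<epsilon> by (simp add: powr_minus_divide)
    have e3: "\<epsilon> powr (-3/2) = 1 / (k * \<eta>)^3"
    proof -
      have "\<epsilon> powr (-3/2) = \<epsilon> powr (-1 + -1/2)" by (rule arg_cong[where f = "\<lambda>v. \<epsilon> powr v"]) simp
      also have "\<dots> = \<epsilon> powr (-1) * \<epsilon> powr (-1/2)" by (rule powr_add)
      also have "\<dots> = 1 / ((k * \<eta>)\<^sup>2 * (k * \<eta>))" unfolding e2 e1 k\<eta> by simp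
      finally show ?thesis by (simp add: power2_eq_square power3_eq_cube)
    qed
    have G: "\<gamma> * \<sigma> * \<epsilon> powr (-1/2) = 1 / (\<eta> * (x1 - 1))"
      unfolding e1 k\<eta>[symmetric] k_def using sc(3,5,6) by simp
    note ap = scaled_variables_approx(1)[OF p \<rho> ab T \<epsilon> npos[unfolded \<alpha>_def \<sigma>_def], where \<zeta> = \<zeta> and u = u]
      scaled_variables_approx(2,3)[OF p \<rho> ab T \<epsilon> npos[unfolded \<alpha>_def \<sigma>_def]]
    note ap = ap[folded \<alpha>_def \<beta>_def \<sigma>_def \<gamma>_def l_def, folded x_def y_def n_def t_def, folded A_def b'_def R_def]
    have Yu: "\<bar>u - \<zeta>\<bar> \<le> M" using Y by linarith
    have ap': "\<bar>A - ((\<alpha> + \<beta>) * (T / (k * \<eta>)^3) + (1/\<rho> - 1) * (\<sigma>\<^sup>2 * X / (k * \<eta>)\<^sup>2) + (u - \<zeta>) / (\<eta> * (x1 - 1)))\<bar> \<le> R"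
      "\<bar>real n - (\<alpha> * (T / (k * \<eta>)^3) + (- 1) * (\<sigma>\<^sup>2 * X / (k * \<eta>)\<^sup>2))\<bar> \<le> R"
      "\<bar>b' - ((1 - l * \<alpha>) * (T / (k * \<eta>)^3) + l * (\<sigma>\<^sup>2 * X / (k * \<eta>)\<^sup>2))\<bar> \<le> R"
      using ap unfolding G e2 e3 by simp_all
    let ?I = "\<lambda>d. LBINT r:{0..}. d * cubic_exp T X (u - \<zeta>) (of_real r * d)"
    let ?g = "complex_of_real (1 / (\<eta> * (x1 - 1)))"
    have "S_bar_eps p \<rho> a b \<Gamma> \<epsilon> T X \<zeta> u = ?g * (of_real ((1 + theta p \<rho> a b) ^ t) * S_bar p \<rho> a b \<Gamma> t n y x)"
      unfolding S_bar_eps_def \<gamma>_def[symmetric] \<sigma>_def[symmetric] G t_def n_def x_def y_def by (simp add: mult.assoc)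
    also have "of_real ((1 + theta p \<rho> a b) ^ t) * S_bar p \<rho> a b \<Gamma> t n y x
      = 1 / (2 * of_real pi * \<i>) * (phase_integral x1 x3 A n b' e - phase_integral x1 x3 A n b' (cnj e))"
      unfolding A_def b'_def x1_def x3_def Q_def \<Theta>_def
      by (rule S_bar_eq_phase_integral[OF p \<Gamma> sc(1,2) e(3) less_imp_le[OF Re_e(1)]])
    finally have S: "S_bar_eps p \<rho> a b \<Gamma> \<epsilon> T X \<zeta> u
      = 1 / (2 * of_real pi * \<i>) * (?g * phase_integral x1 x3 A n b' e - ?g * phase_integral x1 x3 A n b' (cnj e))"
      by (simp add: algebra_simps)
    have "?I e - ?I (cnj e) = 2 * of_real pi * \<i> * S_lim (- T) (- X) \<zeta> u"
      by (rule wedge_integral_eq_S_lim[OF T e(1) Re_e e(3)])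
    then have L: "S_lim (- T) (- X) \<zeta> u = 1 / (2 * of_real pi * \<i>) * (?I e - ?I (cnj e))" by simp
    have "S_bar_eps p \<rho> a b \<Gamma> \<epsilon> T X \<zeta> u - S_lim (- T) (- X) \<zeta> u
      = 1 / (2 * of_real pi * \<i>) * ((?g * phase_integral x1 x3 A n b' e - ?I e)
          - (?g * phase_integral x1 x3 A n b' (cnj e) - ?I (cnj e)))"
      unfolding S L by (simp add: algebra_simps)
    then have "norm (S_bar_eps p \<rho> a b \<Gamma> \<epsilon> T X \<zeta> u - S_lim (- T) (- X) \<zeta> u)
      = 1 / (2 * pi) * norm ((?g * phase_integral x1 x3 A n b' e - ?I e)
          - (?g * phase_integral x1 x3 A n b' (cnj e) - ?I (cnj e)))"
      by (simp add: norm_mult norm_divide)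
    also have "\<dots> \<le> 1 / (2 * pi) * (B1 * \<eta> + B2 * \<eta>)"
      by (intro mult_left_mono order_trans[OF norm_triangle_ineq4] add_mono
          B1[OF \<eta> Yu ap'] B2[OF \<eta> Yu ap']) simp
    also have "\<dots> = K * sqrt \<epsilon>" unfolding K_def \<eta>_def distrib_right[symmetric] by simp
    finally show ?thesis .
  qed
  \<comment> \<open>For small \<open>\<epsilon>\<close> the leading term dominates, so the truncation at \<open>0\<close> in \<open>n_sc\<close> does nothing.\<close>
  have ev: "eventually (\<lambda>\<epsilon>. \<alpha> * \<epsilon> powr (-3/2) * T - \<sigma>\<^sup>2 * \<epsilon> powr (-1) * X \<ge> 0) (at_right 0)"
  proof -
    have "((\<lambda>\<epsilon>. \<alpha> * T - \<sigma>\<^sup>2 * X * sqrt \<epsilon>) \<longlongrightarrow> \<alpha> * T - \<sigma>\<^sup>2 * X * sqrt 0) (at_right 0)"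
      by (intro tendsto_intros)
    then have "eventually (\<lambda>\<epsilon>. \<alpha> * T - \<sigma>\<^sup>2 * X * sqrt \<epsilon> > 0) (at_right 0)"
      by (rule order_tendstoD) (use sc(8) T in simp)
    then show ?thesis using eventually_at_right_less[of 0]
    proof eventually_elim
      case (elim \<epsilon>)
      have "\<epsilon> powr (-1) = \<epsilon> powr (-3/2) * sqrt \<epsilon>"
      proof -
        have "\<epsilon> powr (-3/2) * \<epsilon> powr (1/2) = \<epsilon> powr (-3/2 + 1/2)" by (rule powr_add[symmetric])
        also have "\<dots> = \<epsilon> powr (-1)" by (rule arg_cong[where f = "\<lambda>v. \<epsilon> powr v"]) simp
        finally show ?thesis using elim(2) by (simp only: powr_half_sqrt)
      qed
      then have "\<alpha> * \<epsilon> powr (-3/2) * T - \<sigma>\<^sup>2 * \<epsilon> powr (-1) * X = \<epsilon> powr (-3/2) * (\<alpha> * T - \<sigma>\<^sup>2 * X * sqrt \<epsilon>)"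
        by (simp add: algebra_simps)
      then show ?case using elim(1) by simp
    qed
  qed
  have lim0: "((\<lambda>\<epsilon>. K * sqrt \<epsilon>) \<longlongrightarrow> 0) (at_right 0)"
  proof -
    have "((\<lambda>\<epsilon>. K * sqrt \<epsilon>) \<longlongrightarrow> K * sqrt 0) (at_right 0)" by (intro tendsto_intros)
    then show ?thesis by simp
  qed
  show ?thesis
  proof (rule uniform_limitI)
    fix r :: real assume r: "r > 0"
    have "eventually (\<lambda>\<epsilon>. K * sqrt \<epsilon> < r) (at_right 0)" using order_tendstoD(2)[OF lim0 r] .
    with ev eventually_at_right_less[of 0]
    show "\<forall>\<^sub>F \<epsilon> in at_right 0. \<forall>z\<in>{(\<zeta>, u). \<bar>\<zeta> - u\<bar> \<le> M}.
        dist (case z of (\<zeta>, u) \<Rightarrow> S_bar_eps p \<rho> a b \<Gamma> \<epsilon> T X \<zeta> u) (case z of (\<zeta>, u) \<Rightarrow> S_lim (- T) (- X) \<zeta> u) < r"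
    proof eventually_elim
      case (elim \<epsilon>)
      show ?case
      proof clarify
        fix \<zeta> u assume "\<bar>\<zeta> - u\<bar> \<le> M"
        from bound[OF elim(2) elim(1) this] elim(3)
        show "dist (S_bar_eps p \<rho> a b \<Gamma> \<epsilon> T X \<zeta> u) (S_lim (- T) (- X) \<zeta> u) < r"
          unfolding dist_norm by linarith
      qed
    qed
  qed
qed

end
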